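(* Let $\Omega\subset\mathbb{R}^2$ be a bounded polygonal domain. Let $\alpha_\epsilon:\Omega\to\mathbb{R}$ be measurable with $0<\alpha_0\le\alpha_\epsilon(x)\le\alpha_1$ for almost every $x\in\Omega$, where $\alpha_0,\alpha_1$ are constants. Let $b:\mathbb{R}\to\mathbb{R}$ be continuous, $b\in W^{2,\infty}(\mathbb{R})$, with $0<b_0\le b(t)$ for all $t\in\mathbb{R}$, where $b_0$ is a constant. Let $f\in L^2(\Omega)$, and let $V_r=V_h\oplus V_b\subset H^1_0(\Omega)$ be the residual-free bubble space associated with a partition $\mathcal{T}_h$ of $\Omega$. Then there exists $u_r\in V_r$ such that $$\int_\Omega\alpha_\epsilon(x)\,b(u_r)\,\nabla u_r\cdot\nabla v_r\,dx=\int_\Omega f v_r\,dx\qquad\text{for all }v_r\in V_r.$$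
   Context: $\mathcal{T}_h=\{K\}$ is a partition of $\Omega$ into finite elements $K$ (with mesh size $h$). $V_h\subset H^1_0(\Omega)$ is an associated finite-dimensional finite element subspace of piecewise polynomial functions. The bubble space is $V_b=\{v\in H^1_0(\Omega): v|_K\in H^1_0(K)\text{ for all }K\in\mathcal{T}_h\}$ and the enriched (residual-free bubble) space is $V_r=V_h\oplus V_b$. *)

theory Defs
  imports
    "HOL-Analysis.Analysis"
    "HOL-Library.Function_Algebras"
    "HOL-Library.Set_Algebras"
begin

text \<open>
  Elements of Lebesgue and Sobolev spaces on an open set \<open>\<Omega>\<close> are represented by total functions.
  For open \<open>\<Omega>\<close>, membership in these spaces depends only on the restriction to \<open>\<Omega>\<close> and is
  invariant under changes on null sets; in particular, restricting a function to an open subset \<open>K\<close> amounts to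
  regarding the same function as a function on \<open>K\<close>.
\<close>

subsection \<open>Lebesgue spaces\<close>

definition L2 :: "'a::euclidean_space set \<Rightarrow> ('a \<Rightarrow> 'b::euclidean_space) set" where
  "L2 \<Omega> = {u. set_borel_measurable lebesgue \<Omega> u \<and>
               set_integrable lebesgue \<Omega> (\<lambda>x. (norm (u x))\<^sup>2)}"

definition Linf :: "'a::euclidean_space set \<Rightarrow> ('a \<Rightarrow> 'b::euclidean_space) set" where
  "Linf \<Omega> = {u. set_borel_measurable lebesgue \<Omega> u \<and>
                 (\<exists>C. AE x in lebesgue. x \<in> \<Omega> \<longrightarrow> norm (u x) \<le> C)}"

definition L1_loc :: "'a::euclidean_space set \<Rightarrow> ('a \<Rightarrow> 'b::euclidean_space) set" where
  "L1_loc \<Omega> = {u. \<forall>C. compact C \<and> C \<subseteq> \<Omega> \<longrightarrow> set_integrable lebesgue C u}"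

subsection \<open>Test functions\<close>

primrec Ck :: "nat \<Rightarrow> ('a::euclidean_space \<Rightarrow> real) \<Rightarrow> bool" where
  "Ck 0 \<phi> \<longleftrightarrow> continuous_on UNIV \<phi>"
| "Ck (Suc k) \<phi> \<longleftrightarrow> \<phi> differentiable_on UNIV \<and>
     (\<forall>i\<in>Basis. Ck k (\<lambda>x. frechet_derivative \<phi> (at x) i))"

definition test_functions :: "'a::euclidean_space set \<Rightarrow> ('a \<Rightarrow> real) set" where
  "test_functions \<Omega> = {\<phi>. (\<forall>k. Ck k \<phi>) \<and> compact (closure {x. \<phi> x \<noteq> 0}) \<and>
                           closure {x. \<phi> x \<noteq> 0} \<subseteq> \<Omega>}"

subsection \<open>Weak derivatives and Sobolev spaces\<close>

definition has_weak_gradient ::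
    "'a::euclidean_space set \<Rightarrow> ('a \<Rightarrow> real) \<Rightarrow> ('a \<Rightarrow> 'a) \<Rightarrow> bool" where
  "has_weak_gradient \<Omega> u g \<longleftrightarrow> u \<in> L1_loc \<Omega> \<and> g \<in> L1_loc \<Omega> \<and>
     (\<forall>\<phi>\<in>test_functions \<Omega>. \<forall>i\<in>Basis.
        (LINT x:\<Omega>|lebesgue. u x * frechet_derivative \<phi> (at x) i) =
        - (LINT x:\<Omega>|lebesgue. (g x \<bullet> i) * \<phi> x))"

text \<open>For open \<open>\<Omega>\<close> the weak gradient is unique up to null sets, so the choice is immaterial.\<close>

definition weak_gradient :: "'a::euclidean_space set \<Rightarrow> ('a \<Rightarrow> real) \<Rightarrow> 'a \<Rightarrow> 'a" where
  "weak_gradient \<Omega> u = (SOME g. has_weak_gradient \<Omega> u g)"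

definition H1 :: "'a::euclidean_space set \<Rightarrow> ('a \<Rightarrow> real) set" where
  "H1 \<Omega> = {u \<in> L2 \<Omega>. \<exists>g\<in>L2 \<Omega>. has_weak_gradient \<Omega> u g}"

definition H1_norm :: "'a::euclidean_space set \<Rightarrow> ('a \<Rightarrow> real) \<Rightarrow> real" where
  "H1_norm \<Omega> u = sqrt ((LINT x:\<Omega>|lebesgue. (u x)\<^sup>2) +
                        (LINT x:\<Omega>|lebesgue. (norm (weak_gradient \<Omega> u x))\<^sup>2))"

definition H10 :: "'a::euclidean_space set \<Rightarrow> ('a \<Rightarrow> real) set" where
  "H10 \<Omega> = {u \<in> H1 \<Omega>. \<forall>e>0. \<exists>\<phi>\<in>test_functions \<Omega>. H1_norm \<Omega> (u - \<phi>) < e}"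

text \<open>\<open>W\<^sup>2\<^sup>,\<^sup>\<infinity>(\<real>)\<close>; on the real line the weak gradient is the weak derivative.\<close>

definition W2_inf :: "(real \<Rightarrow> real) set" where
  "W2_inf = {b \<in> Linf UNIV. \<exists>b'\<in>Linf UNIV. \<exists>b''\<in>Linf UNIV.
               has_weak_gradient UNIV b b' \<and> has_weak_gradient UNIV b' b''}"

subsection \<open>Polygonal domains and partitions into elements\<close>

definition polygonal_domain :: "(real^2) set \<Rightarrow> bool" where
  "polygonal_domain \<Omega> \<longleftrightarrow> \<Omega> \<noteq> {} \<and> open \<Omega> \<and> connected \<Omega> \<and> bounded \<Omega> \<and>
     (\<exists>S. finite S \<and> frontier \<Omega> = (\<Union>(p, q)\<in>S. closed_segment p q))"

text \<open>Elements are taken to be open, so that \<open>H10 K\<close> makes sense for an element \<open>K\<close>.\<close>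

definition element_partition :: "(real^2) set \<Rightarrow> real \<Rightarrow> (real^2) set set \<Rightarrow> bool" where
  "element_partition \<Omega> h \<T> \<longleftrightarrow> finite \<T> \<and> (\<forall>K\<in>\<T>. polygonal_domain K) \<and>
     pairwise disjnt \<T> \<and> \<Union>\<T> \<subseteq> \<Omega> \<and> closure \<Omega> = (\<Union>K\<in>\<T>. closure K) \<and>
     h = Max (diameter ` \<T>)"

subsection \<open>Finite element, bubble and residual-free bubble spaces\<close>

global_interpretation fun_space: vector_space "\<lambda>(c::real) (v::'a \<Rightarrow> real). (\<lambda>x. c * v x)"
  by unfold_locales (auto simp: fun_eq_iff algebra_simps)

definition finite_element_space ::
    "(real^2) set \<Rightarrow> (real^2) set set \<Rightarrow> (real^2 \<Rightarrow> real) set \<Rightarrow> bool" where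
  "finite_element_space \<Omega> \<T> V \<longleftrightarrow> V \<subseteq> H10 \<Omega> \<and> fun_space.subspace V \<and>
     (\<exists>B. finite B \<and> V \<subseteq> fun_space.span B) \<and>
     (\<forall>v\<in>V. \<forall>K\<in>\<T>. \<exists>p. real_polynomial_function p \<and> (\<forall>x\<in>K. v x = p x))"

definition bubble_space :: "(real^2) set \<Rightarrow> (real^2) set set \<Rightarrow> (real^2 \<Rightarrow> real) set" where
  "bubble_space \<Omega> \<T> = {v \<in> H10 \<Omega>. \<forall>K\<in>\<T>. v \<in> H10 K}"

text \<open>
  \<open>W = U \<oplus> V\<close> inside \<open>H10 \<Omega>\<close>. Since functions represent their classes modulo null sets, the
  trivial intersection is expressed almost everywhere.
\<close>

definition is_direct_sum ::
    "'a::euclidean_space set \<Rightarrow> ('a \<Rightarrow> real) set \<Rightarrow> ('a \<Rightarrow> real) set \<Rightarrow> ('a \<Rightarrow> real) set \<Rightarrow> bool" where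
  "is_direct_sum \<Omega> W U V \<longleftrightarrow> W = U + V \<and>
     (\<forall>v \<in> U \<inter> V. AE x in lebesgue. x \<in> \<Omega> \<longrightarrow> v x = 0)"

end

theory Submission
  imports Defs
begin

text \<open>
  Freezing the coefficient \<open>b\<close> at some \<open>w \<in> L\<^sup>2\<close> leaves a symmetric coercive linear problem on the closed subspace
  \<open>V\<^sub>r\<close> of \<open>H\<^sup>1\<^sub>0\<close>, with a solution \<open>T w\<close> bounded independently of \<open>w\<close>. As a map into \<open>L\<^sup>2\<close>, \<open>T\<close> has relatively compact
  range (Rellich) and is continuous (dominated convergence along subsequences), so Schauder's theorem gives
  a fixed point, which is the desired \<open>u\<^sub>r\<close>. The Poincare inequality and Rellich compactness both come from
  one estimate for test functions: translating by \<open>h\<close> moves \<open>\<phi>\<close> in \<open>L\<^sup>2\<close> by at most \<open>|h|\<close> times the norm of its gradient.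
  Functions are identified with the pair of their zero extension and that of their weak gradient in the
  Hilbert space \<open>L\<^sup>2 \<times> L\<^sup>2\<close>, where closedness of \<open>V\<^sub>r\<close> is that of a closed subspace plus a finite-dimensional one.
\<close>

section \<open>Fixed points and symmetric forms\<close>

text \<open>They do converge on each fixed gradient, and this suffices: \<open>T w' - T w\<close> is
  estimated with the form at \<open>w'\<close>, whose difference from the form at \<open>w\<close>
  is then applied only to the fixed element \<open>T w\<close>. The premise \<open>cont\<close> of
  \<open>quasilinear_existence\<close> asks for exactly this. Coercivity, and with it the bound on
  \<open>T w\<close>, depends only on the two lower bounds of the coefficients and on the Poincare
  constant, so one compact set receives every value of the fixed-point map. The finite element
  structure enters through closedness alone. Restriction to an element is multiplication by its
  indicator, a continuous operator on the graph space, so the bubble condition is an intersection of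
  preimages of closed sets; \<open>Vh\<close> then adds finitely many directions.\<close>

lemma cube_approx_fixpoint:
  fixes G :: "(nat \<Rightarrow> real) \<Rightarrow> nat \<Rightarrow> real"
  assumes range: "\<And>c i. \<forall>j<n. c j \<in> {0..1} \<Longrightarrow> i < n \<Longrightarrow> G c i \<in> {0..1}"
    and uc: "\<And>e. e > 0 \<Longrightarrow> \<exists>d>0. \<forall>c c'. (\<forall>j<n. c j \<in> {0..1} \<and> c' j \<in> {0..1} \<and> \<bar>c j - c' j\<bar> \<le> d) \<longrightarrow>
               (\<forall>i<n. \<bar>G c i - G c' i\<bar> \<le> e)"
    and "e > 0"
  obtains c where "\<forall>j<n. c j \<in> {0..1}" "\<forall>i<n. \<bar>G c i - c i\<bar> \<le> e"
proof -
  obtain d where d: "d > 0" and dG: "\<And>c c' i. (\<forall>j<n. c j \<in> {0..1} \<and> c' j \<in> {0..1} \<and> \<bar>c j - c' j\<bar> \<le> d) \<Longrightarrow>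
               i < n \<Longrightarrow> \<bar>G c i - G c' i\<bar> \<le> e/2"
    using uc[of "e/2"] \<open>e > 0\<close> by (metis half_gt_zero)
  \<comment> \<open>A grid step \<open>1/p\<close> below \<open>d\<close> lets \<open>G\<close> vary
    by at most \<open>e/2\<close> between vertices of a grid cell, and below \<open>e/2\<close> it
    does the same for the coordinates.\<close>
  obtain p :: nat where p: "p > 0" "1 / p < min d (e/2)"
    using real_arch_inverse[of "min d (e/2)"] d \<open>e > 0\<close>
    by (auto simp: inverse_eq_divide simp del: min_less_iff_conj)
  define \<phi> :: "(nat \<Rightarrow> nat) \<Rightarrow> nat \<Rightarrow> real" where "\<phi> x j = x j / p" for x j
  \<comment> \<open>Label 0 means that \<open>G\<close> moves coordinate \<open>i\<close> upwards.
    The face \<open>x i = 0\<close> receives 0 by decree, as Kuhn's lemma demands; on the opposite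
    face \<open>G\<close> is at most 1, so label 1 is automatic.\<close>
  define label :: "(nat \<Rightarrow> nat) \<Rightarrow> nat \<Rightarrow> nat"
    where "label x i = (if x i = 0 \<or> \<phi> x i < G (\<phi> x) i then 0 else 1)" for x i
  have cube: "\<phi> x j \<in> {0..1}" if "x j \<le> p" for x j
    using that p by (auto simp: \<phi>_def)
  have Gr: "G (\<phi> x) i \<in> {0..1}" if "\<forall>j<n. x j \<le> p" "i < n" for x i
    using that by (intro range) (auto intro!: cube simp del: atLeastAtMost_iff)
  \<comment> \<open>Kuhn's lemma yields a grid cell in which, for every coordinate, both labels
    occur: one vertex bounds \<open>G\<close> from below, another from above.\<close>
  obtain q where q: "\<forall>i<n. q i < p"
    and qq: "\<forall>i<n. \<exists>r s. (\<forall>j<n. q j \<le> r j \<and> r j \<le> q j + 1) \<and> (\<forall>j<n. q j \<le> s j \<and> s j \<le> q j + 1) \<and> label r i \<noteq> label s i"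
  proof (rule kuhn_lemma[of p n label])
    show "\<forall>x. (\<forall>i<n. x i \<le> p) \<longrightarrow> (\<forall>i<n. x i = p \<longrightarrow> label x i = 1)"
    proof (intro allI impI)
      fix x i assume a: "\<forall>i<n. x i \<le> p" "i < n" "x i = p"
      then have "G (\<phi> x) i \<le> 1" "\<phi> x i = 1" using Gr[of x i] p by (auto simp: \<phi>_def)
      then show "label x i = 1" using p a by (simp add: label_def)
    qed
  qed (use p in \<open>auto simp: label_def\<close>)
  have near: "\<bar>G (\<phi> q) i - G (\<phi> r) i\<bar> \<le> e/2 \<and> \<phi> q i \<le> \<phi> r i \<and> \<phi> r i \<le> \<phi> q i + e/2 \<and> (\<forall>j<n. r j \<le> p)"
    if r: "\<forall>j<n. q j \<le> r j \<and> r j \<le> q j + 1" and "i < n" for r i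
  proof -
    have step: "\<phi> q j \<le> \<phi> r j \<and> \<phi> r j \<le> \<phi> q j + 1/p" if "j < n" for j
    proof -
      have "real (r j) \<le> real (q j) + 1" using r that by (metis of_nat_1 of_nat_add of_nat_le_iff)
      then show ?thesis using r that p by (simp add: \<phi>_def divide_simps)
    qed
    have rp: "r j \<le> p" if "j < n" for j using r q that by (metis Suc_eq_plus1 Suc_leI le_trans)
    have "\<bar>G (\<phi> q) i - G (\<phi> r) i\<bar> \<le> e/2"
    proof (rule dG)
      show "\<forall>j<n. \<phi> q j \<in> {0..1} \<and> \<phi> r j \<in> {0..1} \<and> \<bar>\<phi> q j - \<phi> r j\<bar> \<le> d"
      proof (intro allI impI conjI)
        fix j assume "j < n"
        then show "\<phi> q j \<in> {0..1}" "\<phi> r j \<in> {0..1}" using rp q by (auto intro!: cube simp del: atLeastAtMost_iff simp: less_imp_le)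
        show "\<bar>\<phi> q j - \<phi> r j\<bar> \<le> d" using step[OF \<open>j<n\<close>] p(2) by linarith
      qed
    qed fact
    then show ?thesis using step[OF \<open>i < n\<close>] p(2) rp by auto
  qed
  \<comment> \<open>The corner \<open>q\<close> is the least vertex, so the lower bound loses only
    the variation of \<open>G\<close>; the upper bound in \<open>lab1\<close> also loses the grid
    step, whence \<open>e\<close> instead of \<open>e/2\<close>.\<close>
  have lab0: "\<phi> q i - e/2 \<le> G (\<phi> q) i" if r: "\<forall>j<n. q j \<le> r j \<and> r j \<le> q j + 1" "i < n" "label r i = 0" for r i
  proof -
    have "\<phi> r i \<le> G (\<phi> r) i"
      using that(3) Gr[of r i] near[OF r(1,2)] r(2) by (auto simp: label_def \<phi>_def split: if_splits)
    then show ?thesis using near[OF r(1,2)] by linarith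
  qed
  have lab1: "G (\<phi> q) i \<le> \<phi> q i + e" if r: "\<forall>j<n. q j \<le> r j \<and> r j \<le> q j + 1" "i < n" "label r i = 1" for r i
  proof -
    have "\<phi> r i \<ge> G (\<phi> r) i" using that(3) by (auto simp: label_def split: if_splits)
    then show ?thesis using near[OF r(1,2)] by linarith
  qed
  show thesis
  proof
    show "\<forall>j<n. \<phi> q j \<in> {0..1}" using q by (auto intro!: cube simp del: atLeastAtMost_iff simp: less_imp_le)
    show "\<forall>i<n. \<bar>G (\<phi> q) i - \<phi> q i\<bar> \<le> e"
    proof (intro allI impI)
      fix i assume i: "i < n"
      obtain r s where rs: "\<forall>j<n. q j \<le> r j \<and> r j \<le> q j + 1" "\<forall>j<n. q j \<le> s j \<and> s j \<le> q j + 1" "label r i \<noteq> label s i"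
        using qq i by blast
      have "label r i = 0 \<and> label s i = 1 \<or> label r i = 1 \<and> label s i = 0"
        using rs(3) by (auto simp: label_def split: if_splits)
      then have "\<phi> q i - e/2 \<le> G (\<phi> q) i \<and> G (\<phi> q) i \<le> \<phi> q i + e"
        using lab0 lab1 rs(1,2) i by blast
      then show "\<bar>G (\<phi> q) i - \<phi> q i\<bar> \<le> e" using \<open>e > 0\<close> by linarith
    qed
  qed
qed

text \<open>By induction the set is a continuous image of the previous one times the interval
  \<open>{-C..C}\<close>. It provides the compact domain in \<open>schauder_approx_fixpoint\<close>
  and the compact nets in \<open>rellich_test\<close>.\<close>

lemma compact_box_combinations:
  fixes y :: "'i \<Rightarrow> 'x::real_normed_vector"
  assumes "finite I"
  shows "compact {(\<Sum>i\<in>I. c i *\<^sub>R y i) |c. \<forall>i\<in>I. \<bar>c i\<bar> \<le> C}"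
  using assms
proof (induction I)
  case (insert k I)
  let ?D = "{(\<Sum>i\<in>I. c i *\<^sub>R y i) |c. \<forall>i\<in>I. \<bar>c i\<bar> \<le> C}"
  let ?D' = "{(\<Sum>i\<in>insert k I. c i *\<^sub>R y i) |c. \<forall>i\<in>insert k I. \<bar>c i\<bar> \<le> C}"
  have "?D' = (\<lambda>(a, t). t *\<^sub>R y k + a) ` (?D \<times> {-C..C})"
  proof (intro equalityI subsetI)
    fix z assume "z \<in> ?D'"
    then obtain c where c: "z = (\<Sum>i\<in>insert k I. c i *\<^sub>R y i)" "\<forall>i\<in>insert k I. \<bar>c i\<bar> \<le> C" by blast
    then have "z = c k *\<^sub>R y k + (\<Sum>i\<in>I. c i *\<^sub>R y i)" using insert by simp
    moreover have "(\<Sum>i\<in>I. c i *\<^sub>R y i) \<in> ?D" "c k \<in> {-C..C}" using c by (auto simp: abs_le_iff)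
    ultimately show "z \<in> (\<lambda>(a, t). t *\<^sub>R y k + a) ` (?D \<times> {-C..C})"
      by (intro image_eqI[of _ _ "(\<Sum>i\<in>I. c i *\<^sub>R y i, c k)"]) simp_all
  next
    fix z assume "z \<in> (\<lambda>(a, t). t *\<^sub>R y k + a) ` (?D \<times> {-C..C})"
    then obtain c t where c: "z = t *\<^sub>R y k + (\<Sum>i\<in>I. c i *\<^sub>R y i)" "\<forall>i\<in>I. \<bar>c i\<bar> \<le> C" "t \<in> {-C..C}"
      by (elim imageE) auto
    have "(\<Sum>i\<in>I. (c(k := t)) i *\<^sub>R y i) = (\<Sum>i\<in>I. c i *\<^sub>R y i)" using insert by (intro sum.cong) auto
    then have "z = (\<Sum>i\<in>insert k I. (c(k := t)) i *\<^sub>R y i)" using insert c by simp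
    moreover have "\<forall>i\<in>insert k I. \<bar>(c(k := t)) i\<bar> \<le> C" using c by auto
    ultimately show "z \<in> ?D'" by blast
  qed
  moreover have "compact ((\<lambda>(a, t). t *\<^sub>R y k + a) ` (?D \<times> {-C..C}))"
    by (intro compact_continuous_image compact_Times insert.IH)
       (auto simp: case_prod_beta intro!: continuous_intros)
  ultimately show ?case by simp
qed simp

text \<open>Brouwer's theorem on the cube is applied to the weights of the Schauder projection: no convex set of
  values is needed, because \<open>F\<close> is defined on the whole space.\<close>

lemma schauder_approx_fixpoint:
  fixes F :: "'x::real_normed_vector \<Rightarrow> 'x"
  assumes cont: "continuous_on UNIV F" and K: "compact K" and FK: "\<And>x. F x \<in> K" and "e > 0"
  obtains x where "norm (x - F x) \<le> 2 * e"
proof -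
  obtain k where k: "finite k" "K \<subseteq> (\<Union>x\<in>k. ball x e)"
    using K[unfolded compact_eq_totally_bounded, THEN conjunct2, rule_format, OF \<open>e > 0\<close>] by blast
  obtain n and y :: "nat \<Rightarrow> 'x" where y: "k = y ` {..<n}"
    using finite_imp_nat_seg_image_inj_on[OF k(1)] unfolding lessThan_def by blast
  \<comment> \<open>Tent functions: \<open>w i\<close> is positive exactly within distance
    \<open>e\<close> of \<open>y i\<close>. As these balls cover \<open>K\<close>, the total weight
    \<open>W\<close> is positive on \<open>K\<close>.\<close>
  define w where "w i z = max 0 (e - dist z (y i))" for i z
  define W where "W z = (\<Sum>i<n. w i z)" for z
  have w0: "w i z \<ge> 0" for i z by (simp add: w_def)
  have Wpos: "W z > 0" if "z \<in> K" for z
  proof -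
    have "z \<in> (\<Union>x\<in>y ` {..<n}. ball x e)" using k(2) that y by blast
    then obtain i where i: "i < n" "dist z (y i) < e" by (auto simp: dist_commute)
    have "0 < w i z" using i by (simp add: w_def)
    also have "w i z \<le> W z" unfolding W_def using i w0 by (intro member_le_sum) auto
    finally show ?thesis .
  qed
  define Y where "Y c = (\<Sum>i<n. c i *\<^sub>R y i)" for c
  \<comment> \<open>A fixed point \<open>c\<close> of \<open>G\<close> would make \<open>Y c\<close>
    the Schauder projection of \<open>F (Y c)\<close>, which lies within \<open>e\<close> of
    \<open>F (Y c)\<close>.\<close>
  define G where "G c i = w i (F (Y c)) / W (F (Y c))" for c i
  \<comment> \<open>\<open>F\<close> is merely continuous on the whole space; uniform continuity of
    the weights is obtained on this compact set, which contains \<open>Y c\<close> for all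
    \<open>c\<close> in the cube.\<close>
  define D where "D = {(\<Sum>i\<in>{..<n}. c i *\<^sub>R y i) |c. \<forall>i\<in>{..<n}. \<bar>c i\<bar> \<le> 1}"
  have D: "compact D" unfolding D_def by (rule compact_box_combinations) simp
  have YD: "Y c \<in> D" if "\<forall>j<n. c j \<in> {0..1}" for c
    unfolding D_def Y_def using that by (intro CollectI exI[of _ c]) auto
  have G01: "G c i \<in> {0..1}" if "i < n" for c i
  proof -
    have "w i (F (Y c)) \<le> W (F (Y c))" unfolding W_def using that w0 by (intro member_le_sum) auto
    then show ?thesis using Wpos[OF FK] w0 by (simp add: G_def divide_simps)
  qed
  have uci: "\<exists>d>0. \<forall>z\<in>D. \<forall>z'\<in>D. dist z' z < d \<longrightarrow> dist (w i (F z') / W (F z')) (w i (F z) / W (F z)) < r"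
    if "r > 0" for r i
  proof -
    have "continuous_on D (\<lambda>z. w i (F z) / W (F z))"
      unfolding w_def W_def
      apply (intro continuous_intros continuous_on_subset[OF cont])
      using Wpos[OF FK] by (auto simp: W_def w_def less_le)
    from compact_uniformly_continuous[OF this D] show ?thesis
      using that unfolding uniformly_continuous_on_def by blast
  qed
  \<comment> \<open>A Lipschitz constant of \<open>Y\<close> for the maximum norm on coefficients;
    the summand 1 keeps it positive in degenerate cases.\<close>
  define S where "S = 1 + (\<Sum>i<n. norm (y i))"
  have S: "S > 0" unfolding S_def by (meson add_pos_nonneg norm_ge_zero sum_nonneg zero_less_one)
  have Ydiff: "norm (Y c - Y c') \<le> d * S" if "\<forall>j<n. \<bar>c j - c' j\<bar> \<le> d" "d \<ge> 0" for c c' d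
  proof -
    have "norm (Y c - Y c') = norm (\<Sum>i<n. (c i - c' i) *\<^sub>R y i)"
      by (simp add: Y_def sum_subtractf scaleR_diff_left)
    also have "\<dots> \<le> (\<Sum>i<n. d * norm (y i))"
      using that by (intro sum_norm_le) (auto intro!: mult_right_mono)
    also have "\<dots> \<le> d * S" using that by (simp add: S_def sum_distrib_left[symmetric] distrib_left)
    finally show ?thesis .
  qed
  define r where "r = e / S"
  have r: "r > 0" using S \<open>e > 0\<close> by (simp add: r_def)
  obtain c where c: "\<forall>j<n. c j \<in> {0..1}" "\<forall>i<n. \<bar>G c i - c i\<bar> \<le> r"
  proof (rule cube_approx_fixpoint[of n G r])
    fix r :: real assume r: "r > 0"
    have "\<forall>i. \<exists>d>0. \<forall>z\<in>D. \<forall>z'\<in>D. dist z' z < d \<longrightarrow> dist (w i (F z') / W (F z')) (w i (F z) / W (F z)) < r"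
      using uci[OF r] by (rule allI)
    from choice[OF this] obtain d where d': "\<forall>i. d i > 0 \<and> (\<forall>z\<in>D. \<forall>z'\<in>D. dist z' z < d i \<longrightarrow>
        dist (w i (F z') / W (F z')) (w i (F z) / W (F z)) < r)" by (elim exE)
    have d: "d i > 0" "z \<in> D \<Longrightarrow> z' \<in> D \<Longrightarrow> dist z' z < d i \<Longrightarrow>
        dist (w i (F z') / W (F z')) (w i (F z) / W (F z)) < r" for i z z'
      using spec[OF d', of i] by blast+
    \<comment> \<open>Inserting 1 keeps the minimum defined when \<open>n = 0\<close>, and the
      factor 2 makes the inequality below strict.\<close>
    define d' where "d' = Min (insert 1 (d ` {..<n})) / (2 * S)"
    have m: "Min (insert 1 (d ` {..<n})) > 0" using d by (subst Min_gr_iff) auto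
    show "\<exists>d>0. \<forall>c c'. (\<forall>j<n. c j \<in> {0..1} \<and> c' j \<in> {0..1} \<and> \<bar>c j - c' j\<bar> \<le> d) \<longrightarrow> (\<forall>i<n. \<bar>G c i - G c' i\<bar> \<le> r)"
    proof (intro exI[of _ d'] conjI allI impI)
      show "d' > 0" using m S by (simp add: d'_def)
      fix c c' i
      assume a: "\<forall>j<n. c j \<in> {0..1} \<and> c' j \<in> {0..1} \<and> \<bar>c j - c' j\<bar> \<le> d'" and i: "i < n"
      have "norm (Y c - Y c') \<le> d' * S" using a \<open>d' > 0\<close> by (intro Ydiff) auto
      also have "\<dots> < Min (insert 1 (d ` {..<n}))" using m S by (simp add: d'_def)
      also have "\<dots> \<le> d i" using i by (intro Min_le) auto
      finally have "dist (G c i) (G c' i) < r"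
        unfolding G_def using a by (intro d(2) YD) (auto simp: dist_norm)
      then show "\<bar>G c i - G c' i\<bar> \<le> r" by (simp add: dist_real_def)
    qed
  qed (use G01 r in auto)
  define x where "x = Y c"
  have sG: "(\<Sum>i<n. G c i) = 1"
    using Wpos[OF FK, of x] by (simp add: G_def sum_divide_distrib[symmetric] x_def W_def)
  have "norm (Y c - Y (G c)) \<le> r * S" using c r by (intro Ydiff) (auto simp: abs_minus_commute)
  then have 1: "norm (x - Y (G c)) \<le> e" using S by (simp add: r_def x_def)
  have "norm (Y (G c) - F x) = norm (\<Sum>i<n. G c i *\<^sub>R (y i - F x))"
    using sG by (simp add: Y_def scaleR_diff_right sum_subtractf scaleR_sum_left[symmetric])
  also have "\<dots> \<le> (\<Sum>i<n. G c i * e)"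
  proof (rule sum_norm_le)
    fix i assume "i \<in> {..<n}"
    then have G0: "G c i \<ge> 0" using G01[of i c] by auto
    \<comment> \<open>Centres farther than \<open>e\<close> from \<open>F x\<close> carry weight
      zero, so only nearby centres contribute to the convex combination.\<close>
    show "norm (G c i *\<^sub>R (y i - F x)) \<le> G c i * e"
    proof (cases "dist (F x) (y i) \<le> e")
      case True
      then show ?thesis using G0 by (simp add: dist_norm norm_minus_commute mult_left_mono)
    next
      case False
      then have "G c i = 0" by (simp add: G_def w_def x_def)
      then show ?thesis by simp
    qed
  qed
  also have "\<dots> = e" using sG by (simp add: sum_distrib_right[symmetric])
  finally have "norm (Y (G c) - F x) \<le> e" .
  with 1 have "norm (x - F x) \<le> 2 * e"
    using norm_triangle_ineq[of "x - Y (G c)" "Y (G c) - F x"] by simp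
  then show thesis using that by blast
qed

text \<open>Compactness gives a convergent subsequence of the values of \<open>F\<close> at
  approximate fixed points. The points themselves follow it, because their distance to these values
  tends to zero.\<close>

theorem schauder_fixpoint:
  fixes F :: "'x::real_normed_vector \<Rightarrow> 'x"
  assumes cont: "continuous_on UNIV F" and K: "compact K" and FK: "\<And>x. F x \<in> K"
  obtains x where "F x = x"
proof -
  have "\<exists>x. norm (x - F x) \<le> 2 * (1 / Suc n)" for n
    using schauder_approx_fixpoint[OF cont K FK, of "1 / Suc n"] by auto
  then obtain x where x: "\<And>n. norm (x n - F (x n)) \<le> 2 * (1 / Suc n)" by metis
  obtain z r where r: "strict_mono r" "((\<lambda>n. F (x n)) \<circ> r) \<longlonglongrightarrow> z"
    using K[unfolded compact_def, rule_format, of "\<lambda>n. F (x n)"] FK by blast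
  have "(\<lambda>n. 2 * (1 / Suc n)) \<longlonglongrightarrow> 2 * (0::real)"
    by (intro tendsto_intros) (use LIMSEQ_inverse_real_of_nat in \<open>simp add: inverse_eq_divide\<close>)
  then have "(\<lambda>n. 2 * (1 / Suc n)) \<longlonglongrightarrow> (0::real)" by simp
  then have "(\<lambda>n. x n - F (x n)) \<longlonglongrightarrow> 0"
    by (rule Lim_null_comparison[rotated]) (use x in auto)
  then have "(\<lambda>n. x (r n) - F (x (r n))) \<longlonglongrightarrow> 0"
    using r(1) LIMSEQ_subseq_LIMSEQ[of _ 0 r] by (auto simp: o_def)
  from tendsto_add[OF this r(2)[unfolded o_def]] have "(\<lambda>n. x (r n)) \<longlonglongrightarrow> z" by simp
  moreover have "isCont F z" using cont by (simp add: continuous_on_eq_continuous_at)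
  ultimately have "(\<lambda>n. F (x (r n))) \<longlonglongrightarrow> F z" by (metis isCont_tendsto_compose)
  then have "F z = z" using r(2) LIMSEQ_unique unfolding o_def by blast
  then show thesis using that by blast
qed

section \<open>Linear and quasilinear problems for symmetric coercive forms\<close>

text \<open>By symmetry the equation is the stationarity condition of the energy \<open>J\<close>. A
  minimising sequence is Cauchy by the parallelogram identity and coercivity, and the first
  variation at its limit gives the equation.\<close>

lemma symmetric_lax_milgram:
  fixes B :: "'h::{real_normed_vector, complete_space} \<Rightarrow> 'h \<Rightarrow> real"
  assumes M: "subspace M" "closed M" and B: "bounded_bilinear B" and sym: "\<And>u v. B u v = B v u"
    and c: "c > 0" and coer: "\<And>v. v \<in> M \<Longrightarrow> c * (norm v)\<^sup>2 \<le> B v v"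
    and l: "bounded_linear l"
  obtains u where "u \<in> M" "\<forall>v\<in>M. B u v = l v"
proof -
  interpret B: bounded_bilinear B by fact
  interpret l: bounded_linear l by fact
  define J where "J v = B v v / 2 - l v" for v
  obtain L where "L \<ge> 0" "\<forall>v. norm (l v) \<le> norm v * L" using l.nonneg_bounded by blast
  then have L: "L \<ge> 0" "\<And>v. \<bar>l v\<bar> \<le> norm v * L" by auto
  have below: "- L\<^sup>2 / (2*c) \<le> J v" if "v \<in> M" for v
  proof -
    \<comment> \<open>Completing the square bounds the energy from below, uniformly on
      \<open>M\<close>.\<close>
    have "0 \<le> (c * norm v - L)\<^sup>2" by simp
    then have "- L\<^sup>2 \<le> c * (c * (norm v)\<^sup>2) - 2 * c * (norm v * L)"
      by (simp add: power2_diff power_mult_distrib power2_eq_square algebra_simps)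
    also have "\<dots> \<le> c * B v v - 2 * c * l v"
    proof -
      have "l v \<le> norm v * L" using L(2)[of v] by linarith
      then show ?thesis using coer[OF that] c by (intro diff_mono mult_left_mono) auto
    qed
    also have "\<dots> = 2 * c * J v" by (simp add: J_def algebra_simps)
    finally show ?thesis using c by (simp add: divide_simps mult.commute)
  qed
  define I where "I = Inf (J ` M)"
  have M0: "0 \<in> M" using M by (simp add: subspace_0)
  have bdd: "bdd_below (J ` M)" using below by (rule bdd_belowI2)
  have IJ: "I \<le> J v" if "v \<in> M" for v unfolding I_def using bdd that by (rule cINF_lower)
  have "\<exists>v\<in>M. J v < I + 1 / Suc n" for n
  proof -
    have "Inf (J ` M) < I + 1 / Suc n" by (simp add: I_def)
    then show ?thesis using M0 bdd by (subst (asm) cInf_less_iff) auto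
  qed
  then obtain x where x: "\<And>n. x n \<in> M" "\<And>n. J (x n) < I + 1 / Suc n" by metis
  have par: "c * (norm (x m - x n))\<^sup>2 \<le> 4 / Suc m + 4 / Suc n" for m n
  proof -
    have "c * (norm (x m - x n))\<^sup>2 \<le> B (x m - x n) (x m - x n)"
      using x M by (intro coer subspace_diff)
    \<comment> \<open>The parallelogram identity for \<open>B\<close>: the linear parts of the three
      energies cancel, and the midpoint lies in \<open>M\<close>, so its energy is at least
      \<open>I\<close>.\<close>
    also have "\<dots> = 4 * J (x m) + 4 * J (x n) - 8 * J ((1/2) *\<^sub>R (x m + x n))"
      by (simp add: J_def B.diff_left B.diff_right B.add_left B.add_right B.scaleR_left B.scaleR_right
          l.add l.scaleR sym[of "x n" "x m"] algebra_simps)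
    also have "\<dots> \<le> 4 * (I + 1 / Suc m) + 4 * (I + 1 / Suc n) - 8 * I"
      using x(2)[of m] x(2)[of n] IJ[of "(1/2) *\<^sub>R (x m + x n)"] x(1) M
      by (simp add: subspace_add subspace_scale)
    finally show ?thesis by simp
  qed
  have "Cauchy x"
  proof (rule metric_CauchyI)
    fix e :: real assume e: "e > 0"
    obtain N where N: "1 / Suc N < c * e\<^sup>2 / 8" using nat_approx_posE[of "c * e\<^sup>2 / 8"] e c by auto
    show "\<exists>M. \<forall>m\<ge>M. \<forall>n\<ge>M. dist (x m) (x n) < e"
    proof (intro exI[of _ N] allI impI)
      fix m n assume mn: "m \<ge> N" "n \<ge> N"
      then have "1 / real (Suc m) \<le> 1 / Suc N" "1 / real (Suc n) \<le> 1 / Suc N" by (auto simp: frac_le)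
      then have "4 / real (Suc m) + 4 / real (Suc n) < c * e\<^sup>2" using N by simp
      with par[of m n] have "c * (norm (x m - x n))\<^sup>2 < c * e\<^sup>2" by linarith
      then have "(norm (x m - x n))\<^sup>2 < e\<^sup>2" using c by simp
      then show "dist (x m) (x n) < e" unfolding dist_norm using e by (meson less_imp_le power2_less_imp_less)
    qed
  qed
  then obtain u where u: "x \<longlonglongrightarrow> u" using convergent_eq_Cauchy by blast
  have uM: "u \<in> M" by (rule closed_sequentially[OF M(2) x(1) u])
  have "(\<lambda>n. J (x n)) \<longlonglongrightarrow> J u" unfolding J_def
    by (intro tendsto_intros B.tendsto u l.tendsto) auto
  moreover have "(\<lambda>n. I + 1 / Suc n) \<longlonglongrightarrow> I + 0"
    by (intro tendsto_intros) (use LIMSEQ_inverse_real_of_nat in \<open>simp add: inverse_eq_divide\<close>)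
  ultimately have "J u \<le> I + 0" using x(2) by (intro LIMSEQ_le[of "\<lambda>n. J (x n)" _ "\<lambda>n. I + 1 / Suc n"]) (auto simp: less_imp_le)
  have "B u v = l v" if v: "v \<in> M" for v
  proof -
    define d where "d = B u v - l v"
    have q: "0 \<le> t * d + t\<^sup>2 * (B v v / 2)" for t
    proof -
      have "J u \<le> J (u + t *\<^sub>R v)"
        using \<open>J u \<le> I + 0\<close> IJ[of "u + t *\<^sub>R v"] uM v M by (simp add: subspace_add subspace_scale)
      then show ?thesis
        by (simp add: J_def d_def B.add_left B.add_right B.scaleR_left B.scaleR_right
          l.add l.scaleR sym[of v u] algebra_simps power2_eq_square)
    qed
    \<comment> \<open>A strictly positive bound for \<open>B v v\<close>. With the step
      \<open>t = - d / b\<close> the quadratic inequality \<open>q\<close> becomes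
      \<open>0 \<le> - d\<^sup>2 / (2 * b)\<close>.\<close>
    define b where "b = 1 + \<bar>B v v\<bar>"
    then have b: "b > 0" by simp
    have "0 \<le> (- d / b) * d + (- d / b)\<^sup>2 * (B v v / 2)" by (rule q)
    also have "\<dots> \<le> (- d / b) * d + (- d / b)\<^sup>2 * (b / 2)"
      by (intro add_left_mono mult_left_mono) (auto simp: b_def)
    also have "\<dots> = - (d\<^sup>2 / (2 * b))" using b by (simp add: power2_eq_square field_simps)
    finally have "d\<^sup>2 / (2 * b) \<le> 0" by simp
    with b have "d\<^sup>2 \<le> 0" by (simp add: divide_le_0_iff)
    then have "d = 0" by simp
    then show ?thesis by (simp add: d_def)
  qed
  with uM show thesis using that by blast
qed

text \<open>Coefficients are frozen in a space \<open>'x\<close> separate from the Hilbert space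
  \<open>'h\<close>, and \<open>j\<close> is a map from \<open>'h\<close> to \<open>'x\<close> that
  is compact on bounded parts of \<open>M\<close>. At a fixed point \<open>w = j (T w)\<close> the
  solution \<open>T w\<close> has its own coefficient. In \<open>cont\<close> the null sequence may
  depend on \<open>u\<close>: only pointwise convergence of the forms is demanded, uniformly over
  the second argument.\<close>

theorem quasilinear_existence:
  fixes B :: "'x::real_normed_vector \<Rightarrow> 'h::{real_normed_vector, complete_space} \<Rightarrow> 'h \<Rightarrow> real"
  assumes M: "subspace M" "closed M" and B: "\<And>w. bounded_bilinear (B w)"
    and sym: "\<And>w u v. B w u v = B w v u"
    and c: "c > 0" and coer: "\<And>w v. v \<in> M \<Longrightarrow> c * (norm v)\<^sup>2 \<le> B w v v"
    and l: "bounded_linear l" and j: "bounded_linear j"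
    and cpt: "\<And>R. \<exists>K. compact K \<and> j ` {v \<in> M. norm v \<le> R} \<subseteq> K"
    and cont: "\<And>w w' u. w' \<longlonglongrightarrow> w \<Longrightarrow> u \<in> M \<Longrightarrow>
      \<exists>e. e \<longlonglongrightarrow> 0 \<and> (\<forall>n::nat. \<forall>v\<in>M. \<bar>B (w' n) u v - B w u v\<bar> \<le> e n * norm v)"
  obtains u where "u \<in> M" "\<forall>v\<in>M. B (j u) u v = l v"
proof -
  have "\<exists>u\<in>M. \<forall>v\<in>M. B w u v = l v" for w
    using symmetric_lax_milgram[OF M B sym c coer l, of w] by blast
  then have "\<forall>w. \<exists>u. u \<in> M \<and> (\<forall>v\<in>M. B w u v = l v)" by blast
  from choice[OF this] obtain T where "\<forall>w. T w \<in> M \<and> (\<forall>v\<in>M. B w (T w) v = l v)" ..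
  then have TM: "\<And>w. T w \<in> M" and T: "\<And>w v. v \<in> M \<Longrightarrow> B w (T w) v = l v" by auto
  obtain L where "L \<ge> 0" "\<forall>v. norm (l v) \<le> norm v * L" using bounded_linear.nonneg_bounded[OF l] by blast
  then have L: "L \<ge> 0" "\<And>v. \<bar>l v\<bar> \<le> norm v * L" by auto
  have bound: "norm (T w) \<le> L / c" for w
  proof -
    have "c * (norm (T w))\<^sup>2 \<le> norm (T w) * L"
      using coer[OF TM, of w w] T[OF TM, of w w] L(2)[of "T w"] by linarith
    then have "c * norm (T w) \<le> L"
      by (cases "norm (T w) = 0") (use L in \<open>auto simp: power2_eq_square\<close>)
    then show ?thesis using c by (simp add: pos_le_divide_eq mult.commute)
  qed
  have TC: "(\<lambda>n. T (w' n)) \<longlonglongrightarrow> T w" if w': "w' \<longlonglongrightarrow> w" for w w'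
  proof -
    obtain e :: "nat \<Rightarrow> real" where e: "e \<longlonglongrightarrow> 0" and eB': "\<forall>n. \<forall>v\<in>M. \<bar>B (w' n) (T w) v - B w (T w) v\<bar> \<le> e n * norm v"
      using cont[OF w' TM[of w]] by (elim exE conjE)
    have eB: "\<And>n v. v \<in> M \<Longrightarrow> \<bar>B (w' n) (T w) v - B w (T w) v\<bar> \<le> e n * norm v" using eB' by blast
    have "norm (T (w' n) - T w) \<le> \<bar>e n\<bar> / c" for n
    proof -
      interpret Bn: bounded_bilinear "B (w' n)" by fact
      define v where "v = T (w' n) - T w"
      have v: "v \<in> M" using TM M by (simp add: v_def subspace_diff)
      \<comment> \<open>Coercivity is used at \<open>w' n\<close>. Both solutions have the same
        right-hand side, so what remains is the difference of the two forms at the fixed first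
        argument \<open>T w\<close>.\<close>
      have "c * (norm v)\<^sup>2 \<le> B (w' n) (T (w' n) - T w) v" using coer[OF v] by (simp add: v_def)
      also have "\<dots> = B w (T w) v - B (w' n) (T w) v" using T[OF v] by (simp add: Bn.diff_left)
      also have "\<dots> \<le> \<bar>B (w' n) (T w) v - B w (T w) v\<bar>" by linarith
      also have "\<dots> \<le> e n * norm v" by (rule eB[OF v])
      also have "\<dots> \<le> \<bar>e n\<bar> * norm v" by (intro mult_right_mono) auto
      finally have "c * norm v \<le> \<bar>e n\<bar>"
        by (cases "norm v = 0") (auto simp: power2_eq_square)
      then show ?thesis using c by (simp add: v_def pos_le_divide_eq mult.commute)
    qed
    then have bd: "eventually (\<lambda>n. norm (T (w' n) - T w) \<le> \<bar>e n\<bar> / c) sequentially" by simp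
    have "(\<lambda>n. \<bar>e n\<bar> / c) \<longlonglongrightarrow> 0"
      using tendsto_divide[OF tendsto_rabs_zero[OF e] tendsto_const[of c]] c by simp
    with bd have "(\<lambda>n. T (w' n) - T w) \<longlonglongrightarrow> 0" by (rule Lim_null_comparison)
    then show ?thesis by (simp add: LIM_zero_iff)
  qed
  obtain K where K: "compact K" "j ` {v \<in> M. norm v \<le> L / c} \<subseteq> K" using cpt by blast
  obtain w where w: "j (T w) = w"
  proof (rule schauder_fixpoint[of "\<lambda>w. j (T w)" K])
    show "continuous_on UNIV (\<lambda>w. j (T w))"
      unfolding continuous_on_sequentially o_def using bounded_linear.tendsto[OF j TC] by blast
  qed (use K TM bound in auto)
  show thesis
  proof (rule that[OF TM[of w]])
    show "\<forall>v\<in>M. B (j (T w)) (T w) v = l v" unfolding w using T by blast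
  qed
qed

text \<open>Vectors are added one at a time. A vector outside a closed subspace has positive
  distance to it, which controls the coefficient of that vector by the norm of the whole sum; hence
  the coefficients of a convergent sequence converge.\<close>

lemma closed_subspace_plus_span:
  fixes S :: "'h::{real_normed_vector, complete_space} set"
  assumes "finite F" "subspace S" "closed S"
  shows "closed {s + t |s t. s \<in> S \<and> t \<in> span F}"
  using assms(1)
proof (induction F)
  case empty
  then show ?case using assms by simp
next
  case (insert a F)
  let ?N = "{s + t |s t. s \<in> S \<and> t \<in> span F}"
  let ?N' = "{s + t |s t. s \<in> S \<and> t \<in> span (insert a F)}"
  have N: "subspace ?N" using subspace_sums[OF assms(2) subspace_span[of F]] .
  have eq: "?N' = {n + k *\<^sub>R a |n k. n \<in> ?N}"
  proof (intro equalityI subsetI)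
    fix z assume "z \<in> ?N'"
    then obtain s t where st: "z = s + t" "s \<in> S" "t \<in> span (insert a F)" by blast
    then obtain k where "t - k *\<^sub>R a \<in> span F" unfolding span_breakdown_eq by blast
    with st have "z = (s + (t - k *\<^sub>R a)) + k *\<^sub>R a" "s + (t - k *\<^sub>R a) \<in> ?N" by auto
    then show "z \<in> {n + k *\<^sub>R a |n k. n \<in> ?N}" by blast
  next
    fix z assume "z \<in> {n + k *\<^sub>R a |n k. n \<in> ?N}"
    then obtain s t k where z: "z = s + (t + k *\<^sub>R a)" "s \<in> S" "t \<in> span F" by (auto simp: add.assoc)
    then have "t + k *\<^sub>R a \<in> span (insert a F)" by (auto simp: span_breakdown_eq intro!: exI[of _ k])
    then show "z \<in> ?N'" using z by blast
  qed
  show ?case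
  proof (cases "a \<in> ?N")
    case True
    then have "n + k *\<^sub>R a \<in> ?N" if "n \<in> ?N" for n k
      using subspace_add[OF N that subspace_scale[OF N]] by blast
    moreover have "\<exists>n' k. n = n' + k *\<^sub>R a \<and> n' \<in> ?N" if "n \<in> ?N" for n
      using that by (intro exI[of _ n] exI[of _ 0]) simp
    ultimately have "?N' = ?N" unfolding eq by blast
    then show ?thesis using insert.IH by simp
  next
    case False
    have "?N \<noteq> {}" using subspace_0[OF N] by blast
    define d where "d = infdist a ?N"
    have "infdist a ?N \<noteq> 0"
      using in_closed_iff_infdist_zero[OF insert.IH \<open>?N \<noteq> {}\<close>] False by blast
    then have d: "d > 0" unfolding d_def using infdist_nonneg[of a ?N] by linarith
    \<comment> \<open>Dividing by \<open>k\<close> reduces the claim to the distance from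
      \<open>a\<close> to an element of the subspace.\<close>
    have bd: "\<bar>k\<bar> * d \<le> norm (n + k *\<^sub>R a)" if "n \<in> ?N" for n k
    proof (cases "k = 0")
      case False
      have "(- 1 / k) *\<^sub>R n \<in> ?N" using that by (rule subspace_scale[OF N])
      then have "d \<le> dist a ((- 1 / k) *\<^sub>R n)" unfolding d_def by (rule infdist_le)
      then have "\<bar>k\<bar> * d \<le> \<bar>k\<bar> * norm (a + (1/k) *\<^sub>R n)"
        by (intro mult_left_mono) (auto simp: dist_norm)
      also have "\<dots> = norm (k *\<^sub>R (a + (1/k) *\<^sub>R n))" by simp
      also have "\<dots> = norm (n + k *\<^sub>R a)" using False by (simp add: scaleR_add_right add.commute)
      finally show ?thesis .
    qed simp
    show ?thesis unfolding closed_sequential_limits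
    proof (intro allI impI, elim conjE)
      fix x z assume x: "\<forall>i. x i \<in> ?N'" and z: "x \<longlonglongrightarrow> z"
      have "\<forall>i. \<exists>p. fst p \<in> ?N \<and> x i = fst p + snd p *\<^sub>R a"
      proof
        fix i
        obtain n k where "n \<in> ?N" "x i = n + k *\<^sub>R a" using spec[OF x, of i] unfolding eq by blast
        then show "\<exists>p. fst p \<in> ?N \<and> x i = fst p + snd p *\<^sub>R a"
          by (intro exI[of _ "(n, k)"]) (simp only: fst_conv snd_conv)
      qed
      from choice[OF this] obtain p where p: "\<forall>i. fst (p i) \<in> ?N \<and> x i = fst (p i) + snd (p i) *\<^sub>R a" ..
      define n k where "n i = fst (p i)" and "k i = snd (p i)" for i
      have n: "n i \<in> ?N" and xi: "x i = n i + k i *\<^sub>R a" for i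
        using spec[OF p, of i] unfolding n_def k_def by blast+
      have "Cauchy k"
      proof (rule metric_CauchyI)
        fix e :: real assume "e > 0"
        then obtain m0 where m0: "\<And>i j. i \<ge> m0 \<Longrightarrow> j \<ge> m0 \<Longrightarrow> dist (x i) (x j) < e * d"
          using LIMSEQ_imp_Cauchy[OF z, unfolded Cauchy_def, rule_format, of "e * d"] d by auto
        show "\<exists>M. \<forall>i\<ge>M. \<forall>j\<ge>M. dist (k i) (k j) < e"
        proof (intro exI[of _ m0] allI impI)
          fix i j assume ij: "i \<ge> m0" "j \<ge> m0"
          have "\<bar>k i - k j\<bar> * d \<le> norm ((n i - n j) + (k i - k j) *\<^sub>R a)"
            by (intro bd subspace_diff[OF N] n)
          also have "\<dots> = dist (x i) (x j)" by (simp add: xi dist_norm algebra_simps)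
          also have "\<dots> < e * d" using m0 ij by blast
          finally show "dist (k i) (k j) < e" using d by (simp add: dist_real_def)
        qed
      qed
      then obtain k0 where k0: "k \<longlonglongrightarrow> k0" using convergent_eq_Cauchy by blast
      have "(\<lambda>i. x i - k i *\<^sub>R a) \<longlonglongrightarrow> z - k0 *\<^sub>R a" by (intro tendsto_intros z k0)
      then have "n \<longlonglongrightarrow> z - k0 *\<^sub>R a" by (simp add: xi)
      then have "z - k0 *\<^sub>R a \<in> ?N" by (rule closed_sequentially[OF insert.IH n])
      then have "(z - k0 *\<^sub>R a) + k0 *\<^sub>R a \<in> ?N'" unfolding eq by blast
      then show "z \<in> ?N'" by simp
    qed
  qed
qed

section \<open>The Hilbert space of square-integrable functions modulo null sets\<close>

text \<open>Integrability is over the whole space, so that one Hilbert space serves every domain; a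
  domain enters through zero extension and multiplication by its indicator.\<close>

definition sq_int :: "('a::euclidean_space \<Rightarrow> 'b::euclidean_space) \<Rightarrow> bool" where
  "sq_int f \<longleftrightarrow> f \<in> borel_measurable lebesgue \<and> integrable lebesgue (\<lambda>x. (norm (f x))\<^sup>2)"

lemma sq_intI: "f \<in> borel_measurable lebesgue \<Longrightarrow> integrable lebesgue (\<lambda>x. (norm (f x))\<^sup>2) \<Longrightarrow> sq_int f"
  by (simp add: sq_int_def)

lemma sq_int_measurable[measurable_dest]: "sq_int f \<Longrightarrow> f \<in> borel_measurable lebesgue"
  by (simp add: sq_int_def)

lemma sq_int_integrable: "sq_int f \<Longrightarrow> integrable lebesgue (\<lambda>x. (norm (f x))\<^sup>2)"
  by (simp add: sq_int_def)

lemma sq_int_zero[simp]: "sq_int (\<lambda>_. 0)"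
  by (simp add: sq_int_def)

lemma sq_int_bound:
  assumes g: "sq_int g" and [measurable]: "f \<in> borel_measurable lebesgue"
    and bd: "AE x in lebesgue. norm (f x) \<le> C * norm (g x)"
  shows "sq_int f"
proof (rule sq_intI)
  show "integrable lebesgue (\<lambda>x. (norm (f x))\<^sup>2)"
  proof (rule Bochner_Integration.integrable_bound)
    show "integrable lebesgue (\<lambda>x. C\<^sup>2 * (norm (g x))\<^sup>2)" using sq_int_integrable[OF g] by simp
    show "AE x in lebesgue. norm ((norm (f x))\<^sup>2) \<le> norm (C\<^sup>2 * (norm (g x))\<^sup>2)"
      using bd
    proof eventually_elim
      case (elim x)
      then have "(norm (f x))\<^sup>2 \<le> (C * norm (g x))\<^sup>2" by (intro power_mono) auto
      then show ?case by (simp add: power_mult_distrib)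
    qed
  qed simp
qed simp

lemma sq_int_scaleR: "sq_int f \<Longrightarrow> sq_int (\<lambda>x. c *\<^sub>R f x)"
  by (rule sq_int_bound[where g = f and C = "\<bar>c\<bar>"]) auto

lemma sq_int_add:
  assumes f: "sq_int f" and g: "sq_int g" shows "sq_int (\<lambda>x. f x + g x)"
proof (rule sq_intI)
  note [measurable] = sq_int_measurable[OF f] sq_int_measurable[OF g]
  show "(\<lambda>x. f x + g x) \<in> borel_measurable lebesgue" by simp
  show "integrable lebesgue (\<lambda>x. (norm (f x + g x))\<^sup>2)"
  proof (rule Bochner_Integration.integrable_bound)
    show "integrable lebesgue (\<lambda>x. 2 * (norm (f x))\<^sup>2 + 2 * (norm (g x))\<^sup>2)"
      using sq_int_integrable[OF f] sq_int_integrable[OF g] by simp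
    have "(norm (f x + g x))\<^sup>2 \<le> 2 * (norm (f x))\<^sup>2 + 2 * (norm (g x))\<^sup>2" for x
    proof -
      have "(norm (f x + g x))\<^sup>2 \<le> (norm (f x) + norm (g x))\<^sup>2" by (intro power_mono norm_triangle_ineq) simp
      also have "\<dots> \<le> 2 * (norm (f x))\<^sup>2 + 2 * (norm (g x))\<^sup>2"
        using zero_le_power2[of "norm (f x) - norm (g x)"] by (simp add: power2_sum power2_diff)
      finally show ?thesis .
    qed
    then show "AE x in lebesgue. norm ((norm (f x + g x))\<^sup>2) \<le> norm (2 * (norm (f x))\<^sup>2 + 2 * (norm (g x))\<^sup>2)"
      by auto
  qed simp
qed

lemma sq_int_uminus: "sq_int f \<Longrightarrow> sq_int (\<lambda>x. - f x)"
  using sq_int_scaleR[of f "-1"] by simp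

lemma sq_int_diff: "sq_int f \<Longrightarrow> sq_int g \<Longrightarrow> sq_int (\<lambda>x. f x - g x)"
  using sq_int_add[of f "\<lambda>x. - g x"] sq_int_uminus[of g] by simp

lemma sq_int_inner:
  assumes f: "sq_int f" and g: "sq_int g" shows "integrable lebesgue (\<lambda>x. f x \<bullet> g x)"
proof (rule Bochner_Integration.integrable_bound)
  note [measurable] = sq_int_measurable[OF f] sq_int_measurable[OF g]
  show "(\<lambda>x. f x \<bullet> g x) \<in> borel_measurable lebesgue" by simp
  show "integrable lebesgue (\<lambda>x. (norm (f x))\<^sup>2 + (norm (g x))\<^sup>2)"
    using sq_int_integrable[OF f] sq_int_integrable[OF g] by simp
  have "\<bar>f x \<bullet> g x\<bar> \<le> (norm (f x))\<^sup>2 + (norm (g x))\<^sup>2" for x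
  proof -
    have "\<bar>f x \<bullet> g x\<bar> \<le> norm (f x) * norm (g x)" by (rule Cauchy_Schwarz_ineq2)
    also have "\<dots> \<le> (norm (f x))\<^sup>2 + (norm (g x))\<^sup>2"
    proof -
      have "2 * (norm (f x) * norm (g x)) \<le> (norm (f x))\<^sup>2 + (norm (g x))\<^sup>2"
        using sum_squares_bound[of "norm (f x)" "norm (g x)"] by (simp add: mult.assoc)
      moreover have "0 \<le> norm (f x) * norm (g x)" by simp
      ultimately show ?thesis by linarith
    qed
    finally show ?thesis .
  qed
  then show "AE x in lebesgue. norm (f x \<bullet> g x) \<le> norm ((norm (f x))\<^sup>2 + (norm (g x))\<^sup>2)" by simp
qed

\<comment> \<open>The quotient is partial: functions that are not square-integrable belong to no
  class, which is why the rules for computing with \<open>to_l2\<close> carry \<open>sq_int\<close>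
  premises.\<close>
quotient_type (overloaded) ('a, 'b) l2 = "'a::euclidean_space \<Rightarrow> 'b::euclidean_space" /
  partial: "\<lambda>f g. sq_int f \<and> sq_int g \<and> (AE x in lebesgue. f x = g x)"
  morphisms rep_l2 to_l2
proof (rule part_equivpI)
  show "\<exists>f::'a \<Rightarrow> 'b. sq_int f \<and> sq_int f \<and> (AE x in lebesgue. f x = f x)"
    by (rule exI[of _ "\<lambda>_. 0"]) simp
qed (auto simp: symp_def transp_def)

instantiation l2 :: (euclidean_space, euclidean_space) real_vector
begin

lift_definition zero_l2 :: "('a, 'b) l2" is "\<lambda>_. 0" by simp
lift_definition plus_l2 :: "('a, 'b) l2 \<Rightarrow> ('a, 'b) l2 \<Rightarrow> ('a, 'b) l2" is "\<lambda>f g x. f x + g x"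
  by (auto intro: sq_int_add)
lift_definition minus_l2 :: "('a, 'b) l2 \<Rightarrow> ('a, 'b) l2 \<Rightarrow> ('a, 'b) l2" is "\<lambda>f g x. f x - g x"
  by (auto intro: sq_int_diff)
lift_definition uminus_l2 :: "('a, 'b) l2 \<Rightarrow> ('a, 'b) l2" is "\<lambda>f x. - f x"
  by (auto intro: sq_int_uminus)
lift_definition scaleR_l2 :: "real \<Rightarrow> ('a, 'b) l2 \<Rightarrow> ('a, 'b) l2" is "\<lambda>c f x. c *\<^sub>R f x"
  by (auto intro: sq_int_scaleR)

instance
  by standard (transfer; auto simp: algebra_simps intro: sq_int_add sq_int_diff sq_int_uminus sq_int_scaleR)+

end

instantiation l2 :: (euclidean_space, euclidean_space) real_inner
begin

lift_definition inner_l2 :: "('a, 'b) l2 \<Rightarrow> ('a, 'b) l2 \<Rightarrow> real" is "\<lambda>f g. \<integral>x. f x \<bullet> g x \<partial>lebesgue"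
  by (intro integral_cong_AE) auto

definition norm_l2 :: "('a, 'b) l2 \<Rightarrow> real" where "norm_l2 u = sqrt (inner u u)"
definition dist_l2 :: "('a, 'b) l2 \<Rightarrow> ('a, 'b) l2 \<Rightarrow> real" where "dist_l2 u v = norm (u - v)"
definition sgn_l2 :: "('a, 'b) l2 \<Rightarrow> ('a, 'b) l2" where "sgn_l2 u = u /\<^sub>R norm u"
definition uniformity_l2 :: "(('a, 'b) l2 \<times> ('a, 'b) l2) filter"
  where "uniformity_l2 = (INF e\<in>{0<..}. principal {(x, y). dist x y < e})"
definition open_l2 :: "('a, 'b) l2 set \<Rightarrow> bool"
  where "open_l2 U = (\<forall>x\<in>U. eventually (\<lambda>(x', y). x' = x \<longrightarrow> y \<in> U) uniformity)"

instance
proof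
  fix x y z :: "('a, 'b) l2" and r :: real
  show "inner x y = inner y x" by transfer (simp add: inner_commute)
  show "inner (x + y) z = inner x z + inner y z"
    by transfer (simp add: inner_add_left sq_int_inner)
  show "inner (r *\<^sub>R x) y = r * inner x y" by transfer simp
  show "0 \<le> inner x x" by transfer simp
  show "(inner x x = 0) = (x = 0)"
  proof transfer
    fix f :: "'a \<Rightarrow> 'b"
    assume f: "sq_int f \<and> sq_int f \<and> (AE x in lebesgue. f x = f x)"
    then have "(\<integral>x. f x \<bullet> f x \<partial>lebesgue) = 0 \<longleftrightarrow> (AE x in lebesgue. f x \<bullet> f x = 0)"
      by (intro integral_nonneg_eq_0_iff_AE) (auto intro: sq_int_inner)
    then show "((\<integral>x. f x \<bullet> f x \<partial>lebesgue) = 0) = (sq_int f \<and> sq_int (\<lambda>_. 0::'b) \<and> (AE x in lebesgue. f x = 0))"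
      using f by simp
  qed
qed (simp_all add: norm_l2_def dist_l2_def sgn_l2_def uniformity_l2_def open_l2_def)

end

lemma sq_int_rep_l2[simp]: "sq_int (rep_l2 u)"
  using Quotient_rel_rep[OF Quotient_l2, of u u] by simp

lemma to_l2_rep_l2[simp]: "to_l2 (rep_l2 u) = u"
  by (rule Quotient_abs_rep[OF Quotient_l2])

lemma to_l2_eq_iff: "sq_int f \<Longrightarrow> sq_int g \<Longrightarrow> to_l2 f = to_l2 g \<longleftrightarrow> (AE x in lebesgue. f x = g x)"
  using Quotient_rel[OF Quotient_l2, of f g] by auto

lemma AE_rep_l2_to_l2: "sq_int f \<Longrightarrow> AE x in lebesgue. rep_l2 (to_l2 f) x = f x"
  using to_l2_eq_iff[of "rep_l2 (to_l2 f)" f] by simp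

lemma plus_to_l2: "sq_int f \<Longrightarrow> sq_int g \<Longrightarrow> to_l2 f + to_l2 g = to_l2 (\<lambda>x. f x + g x)"
  by (simp add: plus_l2.abs_eq)

lemma minus_to_l2: "sq_int f \<Longrightarrow> sq_int g \<Longrightarrow> to_l2 f - to_l2 g = to_l2 (\<lambda>x. f x - g x)"
  by (simp add: minus_l2.abs_eq)

lemma scaleR_to_l2: "sq_int f \<Longrightarrow> c *\<^sub>R to_l2 f = to_l2 (\<lambda>x. c *\<^sub>R f x)"
  by (simp add: scaleR_l2.abs_eq)

lemma inner_to_l2: "sq_int f \<Longrightarrow> sq_int g \<Longrightarrow> to_l2 f \<bullet> to_l2 g = (\<integral>x. f x \<bullet> g x \<partial>lebesgue)"
  by (simp add: inner_l2.abs_eq)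

lemma norm_to_l2_sq: "sq_int f \<Longrightarrow> (norm (to_l2 f))\<^sup>2 = (\<integral>x. (norm (f x))\<^sup>2 \<partial>lebesgue)"
  by (simp add: power2_norm_eq_inner inner_to_l2)

lemma sum_to_l2: "(\<And>i. i \<in> I \<Longrightarrow> sq_int (f i)) \<Longrightarrow>
    (\<Sum>i\<in>I. to_l2 (f i)) = to_l2 (\<lambda>x. \<Sum>i\<in>I. f i x) \<and> sq_int (\<lambda>x. \<Sum>i\<in>I. f i x)"
  by (induction I rule: infinite_finite_induct)
    (auto simp: plus_to_l2 sq_int_add zero_l2.abs_eq)

lemma norm_to_l2_le:
  assumes f: "sq_int f" and g: "sq_int g" and "AE x in lebesgue. norm (f x) \<le> norm (g x)"
  shows "norm (to_l2 f) \<le> norm (to_l2 g)"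
proof -
  have "(norm (to_l2 f))\<^sup>2 \<le> (norm (to_l2 g))\<^sup>2"
    unfolding norm_to_l2_sq[OF f] norm_to_l2_sq[OF g]
    using assms by (intro integral_mono_AE sq_int_integrable) (auto intro: power_mono)
  then show ?thesis by (rule power2_le_imp_le) simp
qed

section \<open>Completeness and almost everywhere convergence in L2\<close>

lemma Cauchy_fast_subseq:
  fixes X :: "nat \<Rightarrow> 'm::metric_space"
  assumes "Cauchy X" and e: "\<And>k. e k > (0::real)"
  obtains r where "strict_mono r" "\<And>k. dist (X (r (Suc k))) (X (r k)) < e k"
proof -
  have "\<exists>N. \<forall>m\<ge>N. \<forall>n\<ge>N. dist (X m) (X n) < e k" for k using assms unfolding Cauchy_def by blast
  then obtain N where N: "\<And>k m n. m \<ge> N k \<Longrightarrow> n \<ge> N k \<Longrightarrow> dist (X m) (X n) < e k" by metis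
  \<comment> \<open>The partial sum dominates \<open>N k\<close>, and the added \<open>k\<close>
    makes \<open>r\<close> strictly increasing.\<close>
  define r where "r k = (\<Sum>i\<le>k. N i) + k" for k
  have "strict_mono r" unfolding strict_mono_Suc_iff r_def by simp
  moreover have "r k \<ge> N k" for k unfolding r_def
    using member_le_sum[of k "{..k}" N] by simp
  ultimately show thesis using that N by (meson less_imp_le order_trans strict_mono_less lessI)
qed

text \<open>The Riesz-Fischer argument: a fast subsequence converges almost everywhere, and Fatou's
  lemma carries its mutual L2 distances over to the pointwise limit.\<close>

instance l2 :: (euclidean_space, euclidean_space) complete_space
proof
  fix X :: "nat \<Rightarrow> ('a, 'b) l2" assume X: "Cauchy X"
  obtain r where r: "strict_mono r" "\<And>k. dist (X (r (Suc k))) (X (r k)) < (1/2)^k"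
    using Cauchy_fast_subseq[OF X, of "\<lambda>k. (1/2)^k"] by auto
  define f where "f k = rep_l2 (X (r k))" for k
  have fsq: "sq_int (f k)" for k by (simp add: f_def)
  note [measurable] = sq_int_measurable[OF fsq]
  have tf: "to_l2 (f k) = X (r k)" for k by (simp add: f_def)
  have nd: "(\<integral>x. (norm (f m x - f k x))\<^sup>2 \<partial>lebesgue) = (dist (X (r m)) (X (r k)))\<^sup>2" for m k
    unfolding dist_norm tf[symmetric] by (simp add: minus_to_l2 fsq norm_to_l2_sq sq_int_diff)
  have nn: "(\<integral>\<^sup>+x. ennreal ((norm (f m x - f k x))\<^sup>2) \<partial>lebesgue) = ennreal ((dist (X (r m)) (X (r k)))\<^sup>2)" for m k
    by (subst nn_integral_eq_integral) (auto simp: nd intro!: sq_int_integrable sq_int_diff fsq)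
  \<comment> \<open>The weight \<open>2^k\<close> still leaves integrals of at most
    \<open>(1/2)^k\<close>, so the weighted sum is finite almost everywhere. Where it is finite, the
    increments are eventually below \<open>(sqrt (1/2))^k\<close> and therefore summable.\<close>
  define d where "d k x = ennreal (2^k * (norm (f (Suc k) x - f k x))\<^sup>2)" for k x
  have dm[measurable]: "d k \<in> borel_measurable lebesgue" for k unfolding d_def by measurable
  have dint: "(\<integral>\<^sup>+x. d k x \<partial>lebesgue) \<le> ennreal ((1/2)^k)" for k
  proof -
    have "(\<integral>\<^sup>+x. d k x \<partial>lebesgue) = ennreal (2^k) * ennreal ((dist (X (r (Suc k))) (X (r k)))\<^sup>2)"
      unfolding d_def nn[symmetric] by (subst nn_integral_cmult[symmetric]) (auto simp: ennreal_mult)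
    also have "\<dots> \<le> ennreal (2^k) * ennreal (((1/2)^k)\<^sup>2)"
      using r(2)[of k] by (intro mult_left_mono ennreal_leI power_mono) auto
    also have "\<dots> = ennreal ((1/2)^k)"
      by (subst ennreal_mult[symmetric]) (auto simp: power2_eq_square power_divide)
    finally show ?thesis .
  qed
  have "(\<integral>\<^sup>+x. (\<Sum>k. d k x) \<partial>lebesgue) = (\<Sum>k. \<integral>\<^sup>+x. d k x \<partial>lebesgue)" by (intro nn_integral_suminf) simp
  also have "\<dots> \<le> (\<Sum>k. ennreal ((1/2)^k))" by (intro suminf_le dint) auto
  also have "\<dots> = ennreal (\<Sum>k. (1/2)^k)" by (intro suminf_ennreal2 summable_geometric) auto
  finally have "(\<integral>\<^sup>+x. (\<Sum>k. d k x) \<partial>lebesgue) \<noteq> \<infinity>" by (auto simp: top_unique)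
  then have "AE x in lebesgue. (\<Sum>k. d k x) \<noteq> \<infinity>" by (intro nn_integral_PInf_AE) auto
  then have conv: "AE x in lebesgue. convergent (\<lambda>k. f k x)"
  proof eventually_elim
    case (elim x)
    define a where "a k = norm (f (Suc k) x - f k x)" for k
    have "summable (\<lambda>k. 2^k * (a k)\<^sup>2)"
      using elim by (intro summable_suminf_not_top) (auto simp: d_def a_def)
    then have "(\<lambda>k. 2^k * (a k)\<^sup>2) \<longlonglongrightarrow> 0" by (rule summable_LIMSEQ_zero)
    then have "eventually (\<lambda>k. 2^k * (a k)\<^sup>2 < 1) sequentially" by (auto intro: order_tendstoD)
    then have "eventually (\<lambda>k. norm (f (Suc k) x - f k x) \<le> (sqrt (1/2))^k) sequentially"
    proof eventually_elim
      case (elim k)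
      then have "(a k)\<^sup>2 \<le> (1/2)^k" by (simp add: power_divide divide_simps mult.commute)
      also have "\<dots> = ((sqrt (1/2))^k)\<^sup>2" by (metis power_commutes power_mult real_sqrt_pow2 divide_nonneg_nonneg zero_le_one zero_le_numeral mult.commute)
      finally show ?case unfolding a_def by (rule power2_le_imp_le) simp
    qed
    then have "summable (\<lambda>k. f (Suc k) x - f k x)"
      by (rule summable_comparison_test_ev) (intro summable_geometric, simp add: real_sqrt_divide)
    then have "convergent (\<lambda>n. \<Sum>k<n. f (Suc k) x - f k x)" by (simp add: summable_iff_convergent)
    then have "convergent (\<lambda>n. f n x - f 0 x)" by (simp only: sum_lessThan_telescope[of "\<lambda>k. f k x"])
    then show ?case by (metis convergent_diff_const_right_iff)
  qed
  define g where "g x = lim (\<lambda>k. f k x)" for x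
  have gm[measurable]: "g \<in> borel_measurable lebesgue"
    unfolding g_def by (rule borel_measurable_lim_metric) simp
  have lim: "AE x in lebesgue. (\<lambda>k. f k x) \<longlonglongrightarrow> g x"
    using conv by eventually_elim (simp add: g_def convergent_LIMSEQ_iff)
  have fatou: "(\<integral>\<^sup>+x. ennreal ((norm (g x - f k x))\<^sup>2) \<partial>lebesgue) \<le> ennreal (e\<^sup>2)"
    if e: "eventually (\<lambda>m. dist (X (r m)) (X (r k)) \<le> e) sequentially" for k e
  proof -
    have "(\<integral>\<^sup>+x. ennreal ((norm (g x - f k x))\<^sup>2) \<partial>lebesgue) =
        (\<integral>\<^sup>+x. liminf (\<lambda>m. ennreal ((norm (f m x - f k x))\<^sup>2)) \<partial>lebesgue)"
    proof (rule nn_integral_cong_AE)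
      show "AE x in lebesgue. ennreal ((norm (g x - f k x))\<^sup>2) = liminf (\<lambda>m. ennreal ((norm (f m x - f k x))\<^sup>2))"
        using lim
      proof eventually_elim
        case (elim x)
        have "(\<lambda>m. ennreal ((norm (f m x - f k x))\<^sup>2)) \<longlonglongrightarrow> ennreal ((norm (g x - f k x))\<^sup>2)"
          by (intro tendsto_ennrealI tendsto_intros elim)
        then show ?case by (metis lim_imp_Liminf trivial_limit_sequentially)
      qed
    qed
    also have "\<dots> \<le> liminf (\<lambda>m. \<integral>\<^sup>+x. ennreal ((norm (f m x - f k x))\<^sup>2) \<partial>lebesgue)"
      by (intro nn_integral_liminf) simp
    also have "\<dots> \<le> liminf (\<lambda>m::nat. ennreal (e\<^sup>2))"
    proof (rule Liminf_mono)
      show "eventually (\<lambda>m. (\<integral>\<^sup>+x. ennreal ((norm (f m x - f k x))\<^sup>2) \<partial>lebesgue) \<le> ennreal (e\<^sup>2)) sequentially"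
        using e by eventually_elim (auto simp: nn intro!: ennreal_leI power_mono)
    qed
    also have "\<dots> = ennreal (e\<^sup>2)" by (simp add: Liminf_const)
    finally show ?thesis .
  qed
  have gf: "sq_int (\<lambda>x. g x - f k x) \<and> (\<integral>x. (norm (g x - f k x))\<^sup>2 \<partial>lebesgue) \<le> e\<^sup>2"
    if e: "eventually (\<lambda>m. dist (X (r m)) (X (r k)) \<le> e) sequentially" for k e
  proof -
    have i: "integrable lebesgue (\<lambda>x. (norm (g x - f k x))\<^sup>2)"
      by (rule integrableI_bounded) (use le_less_trans[OF fatou[OF e], of \<infinity>] in \<open>auto simp: less_top[symmetric]\<close>)
    then have "ennreal (\<integral>x. (norm (g x - f k x))\<^sup>2 \<partial>lebesgue) \<le> ennreal (e\<^sup>2)"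
      using fatou[OF e] by (subst (asm) nn_integral_eq_integral) auto
    then show ?thesis using i by (auto intro!: sq_intI)
  qed
  have ev: "\<exists>N. \<forall>k\<ge>N. eventually (\<lambda>m. dist (X (r m)) (X (r k)) \<le> e) sequentially" if "e > 0" for e
  proof -
    obtain N where "\<And>m k. m \<ge> N \<Longrightarrow> k \<ge> N \<Longrightarrow> dist (X m) (X k) < e" using X \<open>e > 0\<close> unfolding Cauchy_def by blast
    then have "dist (X (r m)) (X (r k)) \<le> e" if "m \<ge> N" "k \<ge> N" for m k
      using that seq_suble[OF r(1)] by (meson less_imp_le order_trans)
    then show ?thesis unfolding eventually_sequentially by blast
  qed
  obtain k0 where "eventually (\<lambda>m. dist (X (r m)) (X (r k0)) \<le> 1) sequentially" using ev[of 1] by auto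
  from gf[OF this] have "sq_int (\<lambda>x. (g x - f k0 x) + f k0 x)" by (intro sq_int_add fsq) auto
  then have g: "sq_int g" by simp
  have "(\<lambda>k. X (r k)) \<longlonglongrightarrow> to_l2 g"
  proof (rule metric_LIMSEQ_I)
    fix e :: real assume "e > 0"
    then obtain N where N: "\<forall>k\<ge>N. eventually (\<lambda>m. dist (X (r m)) (X (r k)) \<le> e/2) sequentially" using ev[of "e/2"] by auto
    have "dist (X (r k)) (to_l2 g) < e" if "k \<ge> N" for k
    proof -
      have "(norm (to_l2 g - to_l2 (f k)))\<^sup>2 \<le> (e/2)\<^sup>2"
        using gf[of k "e/2"] N that by (simp add: minus_to_l2 g fsq norm_to_l2_sq sq_int_diff)
      then have "norm (to_l2 g - to_l2 (f k)) \<le> e/2" by (rule power2_le_imp_le) (use \<open>e > 0\<close> in simp)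
      then show ?thesis using \<open>e > 0\<close> by (simp add: tf dist_norm norm_minus_commute)
    qed
    then show "\<exists>N. \<forall>k\<ge>N. dist (X (r k)) (to_l2 g) < e" by blast
  qed
  then show "convergent X"
    using Cauchy_converges_subseq[OF X r(1), of "to_l2 g"] by (auto simp: convergent_def o_def)
qed

text \<open>The squared pointwise distances tend to zero in L1, and such sequences have subsequences
  tending to zero almost everywhere. Values at points are needed because \<open>b\<close> acts
  pointwise.\<close>

lemma l2_tendsto_AE_subseq:
  assumes "X \<longlonglongrightarrow> u"
  obtains r where "strict_mono r" "AE x in lebesgue. (\<lambda>n. rep_l2 (X (r n)) x) \<longlonglongrightarrow> rep_l2 u x"
proof -
  let ?d = "\<lambda>n x. (norm (rep_l2 (X n) x - rep_l2 u x))\<^sup>2"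
  have nd: "(\<integral>x. ?d n x \<partial>lebesgue) = (norm (X n - u))\<^sup>2" for n
    using norm_to_l2_sq[of "\<lambda>x. rep_l2 (X n) x - rep_l2 u x"] minus_to_l2[of "rep_l2 (X n)" "rep_l2 u"]
    by (simp add: sq_int_diff)
  have "(\<lambda>n. (norm (X n - u))\<^sup>2) \<longlonglongrightarrow> (norm (u - u))\<^sup>2" by (intro tendsto_intros assms)
  then have "(\<lambda>n. (\<integral>x. norm (?d n x) \<partial>lebesgue)) \<longlonglongrightarrow> 0" by (simp add: nd)
  moreover have "integrable lebesgue (?d n)" for n by (intro sq_int_integrable sq_int_diff) auto
  ultimately obtain r where r: "strict_mono r" "AE x in lebesgue. (\<lambda>n. ?d (r n) x) \<longlonglongrightarrow> 0"
    using tendsto_L1_AE_subseq[of lebesgue ?d] by blast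
  from r(2) have "AE x in lebesgue. (\<lambda>n. rep_l2 (X (r n)) x) \<longlonglongrightarrow> rep_l2 u x"
  proof eventually_elim
    case (elim x)
    then have "(\<lambda>n. sqrt (?d (r n) x)) \<longlonglongrightarrow> sqrt 0" by (rule tendsto_real_sqrt)
    then show ?case by (simp add: LIM_zero_iff tendsto_norm_zero_iff)
  qed
  with r(1) show thesis using that by blast
qed

section \<open>Multiplication operators on L2\<close>

lemma sq_int_mult:
  fixes f :: "'a::euclidean_space \<Rightarrow> 'b::euclidean_space"
  assumes f: "sq_int f" and m: "m \<in> borel_measurable lebesgue" and C: "AE x in lebesgue. \<bar>m x\<bar> \<le> C"
  shows "sq_int (\<lambda>x. m x *\<^sub>R f x)"
proof (rule sq_int_bound[OF f])
  show "(\<lambda>x. m x *\<^sub>R f x) \<in> borel_measurable lebesgue"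
    using m sq_int_measurable[OF f] by (rule borel_measurable_scaleR)
  show "AE x in lebesgue. norm (m x *\<^sub>R f x) \<le> C * norm (f x)"
    using C by eventually_elim (simp add: mult_right_mono)
qed

definition mult_l2 :: "('a::euclidean_space \<Rightarrow> real) \<Rightarrow> ('a, 'b::euclidean_space) l2 \<Rightarrow> ('a, 'b) l2" where
  "mult_l2 m u = to_l2 (\<lambda>x. m x *\<^sub>R rep_l2 u x)"

lemma mult_to_l2:
  assumes f: "sq_int f" and m: "m \<in> borel_measurable lebesgue" and C: "AE x in lebesgue. \<bar>m x\<bar> \<le> C"
  shows "mult_l2 m (to_l2 f) = to_l2 (\<lambda>x. m x *\<^sub>R f x)"
  unfolding mult_l2_def
  using AE_rep_l2_to_l2[OF f] sq_int_mult[OF sq_int_rep_l2[of "to_l2 f"] m C] sq_int_mult[OF f m C]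
  by (subst to_l2_eq_iff) auto

lemma bounded_linear_mult_l2:
  assumes m: "m \<in> borel_measurable lebesgue" and C: "AE x in lebesgue. \<bar>m x\<bar> \<le> C"
  shows "bounded_linear (mult_l2 m :: ('a::euclidean_space, 'b::euclidean_space) l2 \<Rightarrow> _)"
proof (rule bounded_linear_intro[where K = "\<bar>C\<bar>"])
  fix u v :: "('a, 'b) l2" and c :: real
  note sq = sq_int_mult[OF sq_int_rep_l2 m C]
  have "mult_l2 m (u + v) = mult_l2 m (to_l2 (rep_l2 u) + to_l2 (rep_l2 v))" by simp
  also have "\<dots> = mult_l2 m u + mult_l2 m v"
    unfolding mult_l2_def[of m u] mult_l2_def[of m v]
    by (simp only: plus_to_l2 sq_int_rep_l2 sq mult_to_l2[OF _ m C] sq_int_add scaleR_add_right)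
  finally show "mult_l2 m (u + v) = mult_l2 m u + mult_l2 m v" .
  have "mult_l2 m (c *\<^sub>R u) = mult_l2 m (c *\<^sub>R to_l2 (rep_l2 u))" by simp
  also have "\<dots> = c *\<^sub>R mult_l2 m u"
    unfolding mult_l2_def[of m u]
    by (simp only: scaleR_to_l2 sq_int_rep_l2 sq mult_to_l2[OF _ m C] sq_int_scaleR scaleR_scaleR mult.commute)
  finally show "mult_l2 m (c *\<^sub>R u) = c *\<^sub>R mult_l2 m u" .
  have "norm (mult_l2 m u) \<le> norm (to_l2 (\<lambda>x. C *\<^sub>R rep_l2 u x))"
    unfolding mult_l2_def
  proof (rule norm_to_l2_le[OF sq sq_int_scaleR[OF sq_int_rep_l2]])
    show "AE x in lebesgue. norm (m x *\<^sub>R rep_l2 u x) \<le> norm (C *\<^sub>R rep_l2 u x)"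
      using C by eventually_elim (simp add: mult_right_mono)
  qed
  also have "\<dots> = norm (C *\<^sub>R u)" by (simp add: scaleR_to_l2[symmetric])
  finally show "norm (mult_l2 m u) \<le> norm u * \<bar>C\<bar>" by (simp add: mult.commute)
qed

lemma inner_mult_l2:
  assumes "m \<in> borel_measurable lebesgue" "AE x in lebesgue. \<bar>m x\<bar> \<le> C"
  shows "mult_l2 m u \<bullet> v = (\<integral>x. m x * (rep_l2 u x \<bullet> rep_l2 v x) \<partial>lebesgue)"
  using inner_to_l2[OF sq_int_mult[OF sq_int_rep_l2[of u] assms] sq_int_rep_l2[of v]] by (simp add: mult_l2_def)

abbreviation restrict_l2 :: "'a::euclidean_space set \<Rightarrow> ('a, 'b::euclidean_space) l2 \<Rightarrow> ('a, 'b) l2" where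
  "restrict_l2 S \<equiv> mult_l2 (indicator S)"

lemma AE_indicator_le_1: "AE x in M. \<bar>indicat_real S x\<bar> \<le> 1"
  by (simp add: indicator_def)

lemma sq_int_indicator:
  assumes "sq_int f" "S \<in> sets lebesgue" shows "sq_int (\<lambda>x. indicator S x *\<^sub>R f x)"
  using assms(1) borel_measurable_indicator[OF assms(2)] AE_indicator_le_1 by (rule sq_int_mult)

lemma restrict_to_l2:
  assumes "sq_int f" "S \<in> sets lebesgue"
  shows "restrict_l2 S (to_l2 f) = to_l2 (\<lambda>x. indicator S x *\<^sub>R f x)"
  using assms(1) borel_measurable_indicator[OF assms(2)] AE_indicator_le_1 by (rule mult_to_l2)

lemma bounded_linear_restrict_l2:
  assumes "S \<in> sets lebesgue"
  shows "bounded_linear (restrict_l2 S :: ('a::euclidean_space, 'b::euclidean_space) l2 \<Rightarrow> _)"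
  using borel_measurable_indicator[OF assms] AE_indicator_le_1 by (rule bounded_linear_mult_l2)

section \<open>Test functions and the fundamental lemma\<close>

lemma frechet_derivative_eqI: "(f has_derivative f') (at x) \<Longrightarrow> frechet_derivative f (at x) = f'"
  by (rule frechet_derivative_at[symmetric])

lemma Ck_Suc_I:
  assumes "\<And>x. (\<phi> has_derivative \<phi>' x) (at x)" and "\<And>i. i \<in> Basis \<Longrightarrow> Ck k (\<lambda>x. \<phi>' x i)"
  shows "Ck (Suc k) \<phi>"
proof -
  have "frechet_derivative \<phi> (at x) = \<phi>' x" for x using assms(1) by (rule frechet_derivative_eqI)
  moreover have "\<phi> differentiable_on UNIV"
    using assms(1) by (auto simp: differentiable_on_def differentiable_def)
  ultimately show ?thesis using assms(2) by simp
qed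

lemma Ck_Suc_has_derivative:
  assumes "Ck (Suc k) \<phi>" shows "(\<phi> has_derivative frechet_derivative \<phi> (at x)) (at x)"
  using assms by (auto simp: differentiable_on_def frechet_derivative_works[symmetric])

lemma Ck_imp_continuous: "Ck k \<phi> \<Longrightarrow> continuous_on UNIV \<phi>"
  by (cases k) (auto intro: differentiable_imp_continuous_on)

lemma Ck_SucD: "Ck (Suc k) \<phi> \<Longrightarrow> Ck k \<phi>"
proof (induction k arbitrary: \<phi>)
  case 0
  then show ?case using Ck_imp_continuous[of "Suc 0" \<phi>] by simp
next
  case (Suc k)
  then show ?case unfolding Ck.simps(2)[of "Suc k"] by (subst Ck.simps(2)) blast
qed

lemma Ck_const: "Ck k (\<lambda>_. c)"
proof (induction k arbitrary: c)
  case (Suc k)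
  then show ?case by (intro Ck_Suc_I[where \<phi>' = "\<lambda>_ _. 0"]) auto
qed simp

lemma Ck_add: "Ck k \<phi> \<Longrightarrow> Ck k \<psi> \<Longrightarrow> Ck k (\<lambda>x. \<phi> x + \<psi> x)"
proof (induction k arbitrary: \<phi> \<psi>)
  case (Suc k)
  show ?case
  proof (rule Ck_Suc_I)
    fix x show "((\<lambda>x. \<phi> x + \<psi> x) has_derivative
        (\<lambda>h. frechet_derivative \<phi> (at x) h + frechet_derivative \<psi> (at x) h)) (at x)"
      by (intro has_derivative_add Ck_Suc_has_derivative[OF Suc.prems(1)] Ck_Suc_has_derivative[OF Suc.prems(2)])
  qed (use Suc in simp)
qed (simp add: continuous_on_add)

lemma Ck_mult: "Ck k \<phi> \<Longrightarrow> Ck k \<psi> \<Longrightarrow> Ck k (\<lambda>x. \<phi> x * \<psi> x)"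
proof (induction k arbitrary: \<phi> \<psi>)
  case (Suc k)
  show ?case
  proof (rule Ck_Suc_I)
    fix x show "((\<lambda>x. \<phi> x * \<psi> x) has_derivative
        (\<lambda>h. \<phi> x * frechet_derivative \<psi> (at x) h + frechet_derivative \<phi> (at x) h * \<psi> x)) (at x)"
      by (intro has_derivative_mult Ck_Suc_has_derivative[OF Suc.prems(1)] Ck_Suc_has_derivative[OF Suc.prems(2)])
  next
    fix i :: 'a assume i: "i \<in> Basis"
    then have "Ck k (\<lambda>x. frechet_derivative \<phi> (at x) i)" "Ck k (\<lambda>x. frechet_derivative \<psi> (at x) i)"
      using Suc.prems by auto
    then show "Ck k (\<lambda>x. \<phi> x * frechet_derivative \<psi> (at x) i + frechet_derivative \<phi> (at x) i * \<psi> x)"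
      using Ck_SucD[OF Suc.prems(1)] Ck_SucD[OF Suc.prems(2)] by (intro Ck_add Suc.IH)
  qed
qed (simp add: continuous_on_mult)

lemma Ck_prod: "(\<And>i. i \<in> I \<Longrightarrow> Ck k (\<phi> i)) \<Longrightarrow> Ck k (\<lambda>x. \<Prod>i\<in>I. \<phi> i x)"
  by (induction I rule: infinite_finite_induct) (auto intro: Ck_const Ck_mult)

text \<open>The functions \<open>p(1/t) e\<^bsup>-c/t\<^esup>\<close>, extended by zero, form a class closed under differentiation.\<close>

definition flat_exp :: "real poly \<Rightarrow> real \<Rightarrow> real \<Rightarrow> real" where
  "flat_exp p c t = (if t > 0 then poly p (1 / t) * exp (- c / t) else 0)"

lemma poly_times_exp_tendsto_0:
  fixes c :: real assumes "c > 0"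
  shows "((\<lambda>s. poly p s * exp (- c * s)) \<longlongrightarrow> 0) at_top"
proof -
  have mono: "((\<lambda>s. s ^ k * exp (- c * s)) \<longlongrightarrow> 0) at_top" for k
  proof -
    have "filterlim (\<lambda>s. c * s) at_top at_top"
      using filterlim_tendsto_pos_mult_at_top[OF tendsto_const \<open>c > 0\<close> filterlim_ident] .
    from filterlim_compose[OF tendsto_power_div_exp_0 this]
    have "((\<lambda>s. (1 / c ^ k) * ((c * s) ^ k / exp (c * s))) \<longlongrightarrow> (1 / c ^ k) * 0) at_top"
      by (intro tendsto_intros)
    then show ?thesis using \<open>c > 0\<close> by (simp add: power_mult_distrib exp_minus field_simps)
  qed
  have "((\<lambda>s. \<Sum>k\<le>degree p. coeff p k * (s ^ k * exp (- c * s))) \<longlongrightarrow> (\<Sum>k\<le>degree p. coeff p k * 0)) at_top"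
    by (intro tendsto_intros mono)
  then show ?thesis by (simp add: poly_altdef sum_distrib_right mult.assoc)
qed

lemma flat_exp_tendsto_0:
  assumes "c > 0" shows "((\<lambda>t. flat_exp p c t) \<longlongrightarrow> 0) (at 0)"
proof (rule filterlim_split_at)
  have "((\<lambda>t. 0) \<longlongrightarrow> (0::real)) (at_left 0)" by simp
  then show "(flat_exp p c \<longlongrightarrow> 0) (at_left 0)"
    by (rule Lim_transform_eventually) (auto simp: eventually_at_filter flat_exp_def)
  have "((\<lambda>t. poly p (inverse t) * exp (- c * inverse t)) \<longlongrightarrow> 0) (at_right 0)"
    using filterlim_compose[OF poly_times_exp_tendsto_0[OF assms] filterlim_inverse_at_top_right] .
  then show "(flat_exp p c \<longlongrightarrow> 0) (at_right 0)"
    by (rule Lim_transform_eventually) (auto simp: eventually_at_filter flat_exp_def inverse_eq_divide)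
qed

text \<open>With \<open>s = 1/t\<close>, differentiation in \<open>t\<close> is
  \<open>- s\<^sup>2\<close> times differentiation in \<open>s\<close>, which turns \<open>p\<close>
  into \<open>s\<^sup>2 (c p - p')\<close>. At zero the difference quotient is again of this class,
  with one more factor \<open>s\<close>, and tends to zero.\<close>

lemma flat_exp_has_derivative:
  assumes "c > 0"
  shows "(flat_exp p c has_real_derivative flat_exp ([:0, 0, 1:] * (smult c p - pderiv p)) c t) (at t)"
proof -
  let ?q = "[:0, 0, 1:] * (smult c p - pderiv p)"
  consider "t > 0" | "t < 0" | "t = 0" by linarith
  then show ?thesis
  proof cases
    case 1
    have "((\<lambda>t. poly p (1 / t) * exp (- c / t)) has_real_derivative
        (poly (pderiv p) (1 / t) * (- 1 / t\<^sup>2)) * exp (- c / t) + poly p (1 / t) * (exp (- c / t) * (c / t\<^sup>2))) (at t)"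
      using 1 by (auto intro!: derivative_eq_intros DERIV_chain2[OF poly_DERIV] simp: power2_eq_square)
    also have "(poly (pderiv p) (1 / t) * (- 1 / t\<^sup>2)) * exp (- c / t) + poly p (1 / t) * (exp (- c / t) * (c / t\<^sup>2))
        = flat_exp ?q c t"
      using 1 by (simp add: flat_exp_def field_simps power2_eq_square)
    finally show ?thesis
      by (rule has_field_derivative_transform_within_open[where S = "{0<..}"]) (use 1 in \<open>auto simp: flat_exp_def\<close>)
  next
    case 2
    have "((\<lambda>t. 0) has_real_derivative 0) (at t)" by simp
    then have "(flat_exp p c has_real_derivative 0) (at t)"
      by (rule has_field_derivative_transform_within_open[where S = "{..<0}"]) (use 2 in \<open>auto simp: flat_exp_def\<close>)
    then show ?thesis using 2 by (simp add: flat_exp_def)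
  next
    case 3
    have "(flat_exp ([:0, 1:] * p) c \<longlongrightarrow> 0) (at 0)" using assms by (rule flat_exp_tendsto_0)
    then have "((\<lambda>h. (flat_exp p c (0 + h) - flat_exp p c 0) / h) \<longlongrightarrow> 0) (at 0)"
      by (rule Lim_transform_eventually) (auto simp: flat_exp_def eventually_at_filter)
    then show ?thesis using 3 by (simp add: DERIV_def flat_exp_def)
  qed
qed

lemma Ck_flat_exp:
  fixes i :: "'a::euclidean_space"
  assumes "c > 0"
  shows "Ck k (\<lambda>x. flat_exp p c (s * (x \<bullet> i) + a))"
proof (induction k arbitrary: p)
  case 0
  have "continuous_on UNIV (flat_exp p c)"
    using flat_exp_has_derivative[OF assms] by (intro DERIV_continuous_on) (auto intro: has_field_derivative_at_within)
  then have "continuous_on UNIV (\<lambda>x::'a. flat_exp p c (s * (x \<bullet> i) + a))"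
    by (rule continuous_on_compose2) (auto intro!: continuous_intros)
  then show ?case by simp
next
  case (Suc k)
  let ?q = "[:0, 0, 1:] * (smult c p - pderiv p)"
  show ?case
  proof (rule Ck_Suc_I)
    fix x :: 'a
    have "((\<lambda>x. s * (x \<bullet> i) + a) has_derivative (\<lambda>h. s * (h \<bullet> i))) (at x)"
      by (auto intro!: derivative_eq_intros)
    from has_derivative_compose[OF this flat_exp_has_derivative[OF assms, unfolded has_field_derivative_def]]
    show "((\<lambda>x. flat_exp p c (s * (x \<bullet> i) + a)) has_derivative
        (\<lambda>h. flat_exp ?q c (s * (x \<bullet> i) + a) * (s * (h \<bullet> i)))) (at x)" by simp
  qed (intro Ck_mult Ck_const Suc.IH)
qed

text \<open>Each factor is positive exactly on an open half-space, so the product is positive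
  exactly on \<open>box a b\<close>. The coefficients \<open>1\<close> and \<open>-1\<close> are
  written out to give the arguments the affine shape of \<open>Ck_flat_exp\<close>.\<close>

definition box_bump :: "real \<Rightarrow> 'a::euclidean_space \<Rightarrow> 'a \<Rightarrow> 'a \<Rightarrow> real" where
  "box_bump c a b x = (\<Prod>i\<in>Basis. flat_exp 1 c (1 * (x \<bullet> i) + (- (a \<bullet> i))) * flat_exp 1 c ((-1) * (x \<bullet> i) + b \<bullet> i))"

lemma Ck_box_bump: "c > 0 \<Longrightarrow> Ck k (box_bump c a b)"
  unfolding box_bump_def by (intro Ck_prod Ck_mult Ck_flat_exp)

lemma flat_exp_1: "flat_exp 1 c t = (if t > 0 then exp (- c / t) else 0)"
  by (simp add: flat_exp_def)

lemma box_bump_eq_0: "x \<notin> box a b \<Longrightarrow> box_bump c a b x = 0"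
  by (force simp: box_bump_def flat_exp_1 mem_box)

lemma box_bump_bounds:
  assumes "c > 0" shows "0 \<le> box_bump c a b x" "box_bump c a b x \<le> 1"
proof -
  have f: "0 \<le> flat_exp 1 c t \<and> flat_exp 1 c t \<le> 1" for t using assms by (auto simp: flat_exp_1)
  show "0 \<le> box_bump c a b x" unfolding box_bump_def using f by (intro prod_nonneg) simp
  show "box_bump c a b x \<le> 1" unfolding box_bump_def
    using f by (intro prod_le_1) (auto intro!: mult_le_one mult_nonneg_nonneg)
qed

lemma box_bump_tendsto_indicator:
  "(\<lambda>n. box_bump (1 / Suc n) a b x) \<longlonglongrightarrow> indicator (box a b) x"
proof (cases "x \<in> box a b")
  case True
  have e: "(\<lambda>n. flat_exp 1 (1 / Suc n) t) \<longlonglongrightarrow> 1" if "t > 0" for t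
  proof -
    have "(\<lambda>n. exp (- (1 / real (Suc n)) / t)) \<longlonglongrightarrow> exp (- 0 / t)"
      by (intro tendsto_intros) (use LIMSEQ_inverse_real_of_nat that in \<open>simp_all add: inverse_eq_divide\<close>)
    then show ?thesis using that by (simp add: flat_exp_1)
  qed
  have "(\<lambda>n. box_bump (1 / Suc n) a b x) \<longlonglongrightarrow> (\<Prod>i\<in>(Basis::'a set). 1 * 1)"
    unfolding box_bump_def using True by (intro tendsto_prod tendsto_mult e) (auto simp: mem_box)
  then show ?thesis using True by simp
qed (simp add: box_bump_eq_0)

lemma test_functionsI:
  assumes "\<And>k. Ck k \<phi>" and S: "compact S" "S \<subseteq> \<Omega>" "\<And>x. x \<notin> S \<Longrightarrow> \<phi> x = 0"
  shows "\<phi> \<in> test_functions \<Omega>"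
proof -
  have sub: "{x. \<phi> x \<noteq> 0} \<subseteq> S"
  proof
    fix x assume "x \<in> {x. \<phi> x \<noteq> 0}"
    then show "x \<in> S" using S(3)[of x] by auto
  qed
  then have s: "closure {x. \<phi> x \<noteq> 0} \<subseteq> S" by (rule closure_minimal[OF _ compact_imp_closed[OF S(1)]])
  have "compact (closure {x. \<phi> x \<noteq> 0})"
    unfolding compact_closure by (rule bounded_subset[OF compact_imp_bounded[OF S(1)] sub])
  then show ?thesis using assms(1) s S(2) by (simp add: test_functions_def)
qed

lemma box_bump_test_function:
  assumes "c > 0" "cbox a b \<subseteq> \<Omega>" shows "box_bump c a b \<in> test_functions \<Omega>"
proof (rule test_functionsI[OF Ck_box_bump[OF assms(1)] compact_cbox assms(2)])
  show "box_bump c a b x = 0" if "x \<notin> cbox a b" for x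
    using that box_subset_cbox[of a b] by (intro box_bump_eq_0) blast
qed

lemma test_functions_Ck: "\<phi> \<in> test_functions \<Omega> \<Longrightarrow> Ck k \<phi>"
  by (simp add: test_functions_def)

lemma test_functions_continuous: "\<phi> \<in> test_functions \<Omega> \<Longrightarrow> continuous_on UNIV \<phi>"
  unfolding test_functions_def using Ck.simps(1) by blast

lemma test_functions_support:
  assumes "\<phi> \<in> test_functions \<Omega>"
  obtains S where "compact S" "S \<subseteq> \<Omega>" "\<And>x. x \<notin> S \<Longrightarrow> \<phi> x = 0" "\<And>x i. x \<notin> S \<Longrightarrow> frechet_derivative \<phi> (at x) i = 0"
proof -
  let ?S = "closure {x. \<phi> x \<noteq> 0}"
  have z: "\<phi> x = 0" if "x \<notin> ?S" for x using that closure_subset[of "{x. \<phi> x \<noteq> 0}"] by auto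
  have "frechet_derivative \<phi> (at x) i = 0" if "x \<notin> ?S" for x i
  proof -
    have "((\<lambda>_. 0) has_derivative (\<lambda>_. 0)) (at x)" by simp
    then have "(\<phi> has_derivative (\<lambda>_. 0)) (at x)"
    proof (rule has_derivative_transform_within_open[where s = "- ?S"])
      show "open (- ?S)" by (rule open_Compl[OF closed_closure])
      show "x \<in> - ?S" using that by blast
      show "0 = \<phi> y" if "y \<in> - ?S" for y using z[of y] that by simp
    qed
    then show ?thesis by (simp add: frechet_derivative_eqI)
  qed
  moreover have "compact ?S" "?S \<subseteq> \<Omega>" using assms by (simp_all only: test_functions_def mem_Collect_eq)
  ultimately show thesis using that[of ?S] z by blast
qed

lemma continuous_bounded_on_support:
  fixes f :: "'a::euclidean_space \<Rightarrow> 'b::real_normed_vector"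
  assumes "continuous_on UNIV f" "compact S" "\<And>x. x \<notin> S \<Longrightarrow> f x = 0"
  obtains C where "C > 0" "\<And>x. norm (f x) \<le> C"
proof -
  have "bounded (f ` S)"
    using assms by (intro compact_imp_bounded compact_continuous_image) (auto intro: continuous_on_subset)
  then obtain C where "C > 0" "\<And>x. x \<in> S \<Longrightarrow> norm (f x) \<le> C" unfolding bounded_pos by auto
  then show thesis using that[of C] assms(3) by (metis less_imp_le norm_zero)
qed

lemma continuous_borel_measurable_lebesgue:
  fixes f :: "'a::euclidean_space \<Rightarrow> 'b::euclidean_space"
  shows "continuous_on UNIV f \<Longrightarrow> f \<in> borel_measurable lebesgue"
  by (intro measurable_completion) (simp add: borel_measurable_continuous_onI)

lemma L1_loc_times_continuous:
  fixes g :: "'a::euclidean_space \<Rightarrow> real"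
  assumes g: "g \<in> L1_loc \<Omega>" and \<psi>: "continuous_on UNIV \<psi>"
    and S: "compact S" "S \<subseteq> \<Omega>" "\<And>x. x \<notin> S \<Longrightarrow> \<psi> x = 0"
  shows "set_integrable lebesgue \<Omega> (\<lambda>x. g x * \<psi> x)"
proof -
  obtain C where C: "C > 0" "\<And>x. norm (\<psi> x) \<le> C" using continuous_bounded_on_support[OF \<psi> S(1,3)] by blast
  define G where "G x = indicator S x *\<^sub>R g x" for x
  have i: "integrable lebesgue G" using g S unfolding L1_loc_def set_integrable_def G_def by blast
  note [measurable] = borel_measurable_integrable[OF i] continuous_borel_measurable_lebesgue[OF \<psi>]
  have "integrable lebesgue (\<lambda>x. G x * \<psi> x)"
  proof (rule Bochner_Integration.integrable_bound)
    show "integrable lebesgue (\<lambda>x. C * G x)" using i by simp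
    show "AE x in lebesgue. norm (G x * \<psi> x) \<le> norm (C * G x)"
    proof (rule AE_I2)
      fix x
      have "\<bar>\<psi> x\<bar> * \<bar>G x\<bar> \<le> C * \<bar>G x\<bar>" using C(2)[of x] by (intro mult_right_mono) auto
      then show "norm (G x * \<psi> x) \<le> norm (C * G x)" using C(1) by (simp add: abs_mult mult.commute)
    qed
  qed measurable
  moreover have "G x * \<psi> x = indicator \<Omega> x *\<^sub>R (g x * \<psi> x)" for x
    using S by (auto simp: G_def split: split_indicator)
  ultimately show ?thesis unfolding set_integrable_def by simp
qed

text \<open>Testing against bumps gives vanishing integrals over boxes; Lebesgue differentiation then yields the pointwise statement.\<close>

theorem fundamental_lemma:
  fixes g :: "'a::euclidean_space \<Rightarrow> real"
  assumes \<Omega>: "open \<Omega>" and g: "g \<in> L1_loc \<Omega>"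
    and test: "\<And>\<phi>. \<phi> \<in> test_functions \<Omega> \<Longrightarrow> (LINT x:\<Omega>|lebesgue. g x * \<phi> x) = 0"
  shows "AE x in lebesgue. x \<in> \<Omega> \<longrightarrow> g x = 0"
proof -
  have gi: "set_integrable lebesgue (cbox a b) g" if "cbox a b \<subseteq> \<Omega>" for a b
    using g that unfolding L1_loc_def by auto
  have box0: "integral (cbox a b) g = 0" if ab: "cbox a b \<subseteq> \<Omega>" for a b
  proof -
    define G where "G x = indicator (cbox a b) x *\<^sub>R g x" for x
    define \<beta> where "\<beta> n = box_bump (1 / real (Suc n)) a b" for n
    have i: "integrable lebesgue G" using gi[OF ab] by (simp add: set_integrable_def G_def[abs_def])
    note [measurable] = borel_measurable_integrable[OF i]
    have [measurable]: "\<beta> n \<in> borel_measurable lebesgue" for n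
      using Ck_imp_continuous[OF Ck_box_bump[of "1 / real (Suc n)" 0 a b]]
      by (intro continuous_borel_measurable_lebesgue) (simp add: \<beta>_def)
    have [measurable]: "indicat_real (box a b) \<in> borel_measurable lebesgue"
      by (intro borel_measurable_indicator) simp
    have "(\<lambda>n. \<integral>x. G x * \<beta> n x \<partial>lebesgue) \<longlonglongrightarrow> (\<integral>x. G x * indicator (box a b) x \<partial>lebesgue)"
    proof (rule integral_dominated_convergence)
      show "integrable lebesgue (\<lambda>x. norm (G x))" using i by (rule integrable_norm)
      show "AE x in lebesgue. (\<lambda>n. G x * \<beta> n x) \<longlonglongrightarrow> G x * indicator (box a b) x"
        unfolding \<beta>_def by (intro AE_I2 tendsto_mult tendsto_const box_bump_tendsto_indicator)
      show "AE x in lebesgue. norm (G x * \<beta> n x) \<le> norm (G x)" for n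
      proof (rule AE_I2)
        fix x
        have "\<bar>\<beta> n x\<bar> \<le> 1" using box_bump_bounds[of "1 / real (Suc n)" a b x] by (simp add: \<beta>_def)
        then show "norm (G x * \<beta> n x) \<le> norm (G x)"
          using mult_left_mono[of "\<bar>\<beta> n x\<bar>" 1 "\<bar>G x\<bar>"] by (simp add: abs_mult)
      qed
    qed measurable
    moreover have "(\<integral>x. G x * \<beta> n x \<partial>lebesgue) = 0" for n
    proof -
      have eq: "indicator \<Omega> x *\<^sub>R (g x * \<beta> n x) = G x * \<beta> n x" for x
        using ab box_bump_eq_0[of x a b] box_subset_cbox[of a b]
        by (auto simp: G_def \<beta>_def split: split_indicator)
      have "(LINT x:\<Omega>|lebesgue. g x * \<beta> n x) = 0"
        unfolding \<beta>_def by (intro test box_bump_test_function ab) simp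
      then show ?thesis by (simp only: set_lebesgue_integral_def eq)
    qed
    ultimately have "(\<lambda>n::nat. 0) \<longlonglongrightarrow> (\<integral>x. G x * indicator (box a b) x \<partial>lebesgue)" by simp
    then have "(\<integral>x. G x * indicator (box a b) x \<partial>lebesgue) = 0" by (simp add: LIMSEQ_const_iff)
    moreover have "(\<integral>x. G x * indicator (box a b) x \<partial>lebesgue) = (\<integral>x. G x \<partial>lebesgue)"
    proof (rule integral_cong_AE)
      have "cbox a b - box a b \<in> null_sets lebesgue"
        using negligible_frontier_interval negligible_iff_null_sets by blast
      from AE_not_in[OF this]
      show "AE x in lebesgue. G x * indicator (box a b) x = G x"
        by eventually_elim (auto simp: G_def split: split_indicator)
    qed measurable
    moreover have "(\<integral>x. G x \<partial>lebesgue) = (LINT x:cbox a b|lebesgue. g x)"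
      by (simp add: set_lebesgue_integral_def G_def)
    ultimately show ?thesis using set_lebesgue_integral_eq_integral(2)[OF gi[OF ab]] by simp
  qed
  have AEbox: "AE x in lebesgue. x \<in> cbox a b \<longrightarrow> g x = 0" if ab: "cbox a b \<subseteq> \<Omega>" for a b
  proof -
    define f where "f x = (if x \<in> cbox a b then g x else 0)" for x
    have fi: "f integrable_on cbox c d" for c d
    proof -
      have "g integrable_on cbox a b" using set_lebesgue_integral_eq_integral(1)[OF gi[OF ab]] .
      then have "f integrable_on UNIV" unfolding f_def by (simp only: integrable_restrict_UNIV)
      then show ?thesis by (rule integrable_on_subcbox) simp
    qed
    \<comment> \<open>Lebesgue differentiation along cubes having \<open>x\<close> as their lower
      corner. The averages vanish by \<open>box0\<close>, so the value \<open>f x\<close> must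
      vanish too.\<close>
    obtain N where N: "negligible N" and Nd: "\<And>x e. \<lbrakk>x \<notin> N; 0 < e\<rbrakk> \<Longrightarrow>
        \<exists>d>0. \<forall>h. 0 < h \<and> h < d \<longrightarrow> norm (integral (cbox x (x + h *\<^sub>R One)) f /\<^sub>R h ^ DIM('a) - f x) < e"
      using integrable_ccontinuous_explicit[OF fi] by blast
    have zero: "g x = 0" if x: "x \<in> box a b" "x \<notin> N" for x
    proof (rule ccontr)
      assume "g x \<noteq> 0"
      then have fx: "norm (f x) > 0" using x box_subset_cbox[of a b] by (auto simp: f_def)
      obtain d where d: "d > 0" and dh: "\<And>h. 0 < h \<Longrightarrow> h < d \<Longrightarrow>
          norm (integral (cbox x (x + h *\<^sub>R One)) f /\<^sub>R h ^ DIM('a) - f x) < norm (f x)"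
        using Nd[OF x(2) fx] by blast
      obtain r where r: "r > 0" "ball x r \<subseteq> box a b" using x(1) open_box open_contains_ball by blast
      \<comment> \<open>Small enough for the differentiation bound and for the upper corner
        \<open>x + h *\<^sub>R One\<close> to remain in the box, hence for the whole cube to do
        so.\<close>
      define h where "h = min (d/2) (r / (2 * (1 + norm (One::'a))))"
      have pos: "1 + norm (One::'a) > 0" by (smt (verit) norm_ge_zero)
      have h: "0 < h" "h < d" "h \<le> r / (2 * (1 + norm (One::'a)))" using d r pos by (auto simp: h_def)
      have "x + h *\<^sub>R One \<in> ball x r"
      proof -
        have "h * norm (One::'a) \<le> h * (1 + norm (One::'a))" using h by simp
        also have "\<dots> \<le> r / 2" using h(3) pos by (simp add: field_simps)
        also have "\<dots> < r" using r by simp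
        finally show ?thesis using h by (simp add: dist_norm)
      qed
      then have "x + h *\<^sub>R One \<in> box a b" using r by blast
      then have sub: "cbox x (x + h *\<^sub>R One) \<subseteq> cbox a b"
        using x(1) unfolding mem_box subset_box(1) by (meson less_imp_le)
      have "integral (cbox x (x + h *\<^sub>R One)) f = integral (cbox x (x + h *\<^sub>R One)) g"
        using sub by (intro integral_cong) (auto simp: f_def)
      also have "\<dots> = 0" using sub ab by (intro box0) blast
      finally show False using dh[OF h(1,2)] by simp
    qed
    have "N \<union> (cbox a b - box a b) \<in> null_sets lebesgue"
      using N negligible_frontier_interval negligible_iff_null_sets by blast
    from AE_not_in[OF this] show ?thesis
      by eventually_elim (use zero in auto)
  qed
  obtain \<D> where \<D>: "countable \<D>" "\<D> \<subseteq> Pow \<Omega>" "\<And>X. X \<in> \<D> \<Longrightarrow> \<exists>a b. X = cbox a b" "\<Union>\<D> = \<Omega>"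
    by (rule open_countable_Union_open_cbox[OF \<Omega>]) blast
  have "AE x in lebesgue. \<forall>X\<in>\<D>. x \<in> X \<longrightarrow> g x = 0"
  proof (subst AE_ball_countable[OF \<D>(1)], intro ballI)
    fix X assume X: "X \<in> \<D>"
    then obtain a b where "X = cbox a b" using \<D>(3) by blast
    then show "AE x in lebesgue. x \<in> X \<longrightarrow> g x = 0" using AEbox[of a b] X \<D>(2) by blast
  qed
  then show ?thesis by eventually_elim (use \<D>(4) in blast)
qed

section \<open>Gradients of test functions\<close>

definition grad :: "('a::euclidean_space \<Rightarrow> real) \<Rightarrow> 'a \<Rightarrow> 'a" where
  "grad \<phi> x = (\<Sum>i\<in>Basis. frechet_derivative \<phi> (at x) i *\<^sub>R i)"

lemma grad_inner_Basis: "i \<in> Basis \<Longrightarrow> grad \<phi> x \<bullet> i = frechet_derivative \<phi> (at x) i"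
  by (simp add: grad_def inner_sum_left inner_Basis if_distrib sum.delta cong: if_cong)

lemma test_functions_has_derivative:
  assumes "\<phi> \<in> test_functions \<Omega>" shows "(\<phi> has_derivative (\<lambda>h. grad \<phi> x \<bullet> h)) (at x)"
proof -
  have d: "(\<phi> has_derivative frechet_derivative \<phi> (at x)) (at x)"
    using Ck_Suc_has_derivative[OF test_functions_Ck[OF assms, of "Suc 0"]] .
  then have l: "linear (frechet_derivative \<phi> (at x))" using has_derivative_linear by blast
  have "frechet_derivative \<phi> (at x) h = grad \<phi> x \<bullet> h" for h
  proof -
    have "frechet_derivative \<phi> (at x) h = frechet_derivative \<phi> (at x) (\<Sum>i\<in>Basis. (h \<bullet> i) *\<^sub>R i)"
      by (simp add: euclidean_representation)
    also have "\<dots> = (\<Sum>i\<in>Basis. (h \<bullet> i) * frechet_derivative \<phi> (at x) i)"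
      by (simp add: linear_sum[OF l] linear_scale[OF l])
    also have "\<dots> = grad \<phi> x \<bullet> h"
      by (simp add: grad_def inner_sum_left inner_commute[of h] mult.commute)
    finally show ?thesis .
  qed
  then have "frechet_derivative \<phi> (at x) = (\<lambda>h. grad \<phi> x \<bullet> h)" by (rule ext)
  with d show ?thesis by (simp only:)
qed

lemma continuous_on_partial:
  assumes "\<phi> \<in> test_functions \<Omega>" "i \<in> Basis"
  shows "continuous_on UNIV (\<lambda>x. frechet_derivative \<phi> (at x) i)"
  using test_functions_Ck[OF assms(1), of "Suc 0"] assms(2) by simp

lemma continuous_on_grad: "\<phi> \<in> test_functions \<Omega> \<Longrightarrow> continuous_on UNIV (grad \<phi>)"
  unfolding grad_def by (intro continuous_intros continuous_on_partial)

lemma test_functions_support_grad: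
  assumes "\<phi> \<in> test_functions \<Omega>"
  obtains S where "compact S" "S \<subseteq> \<Omega>" "\<And>x. x \<notin> S \<Longrightarrow> \<phi> x = 0" "\<And>x. x \<notin> S \<Longrightarrow> grad \<phi> x = 0"
proof -
  obtain S where S: "compact S" "S \<subseteq> \<Omega>" "\<And>x. x \<notin> S \<Longrightarrow> \<phi> x = 0" "\<And>x i. x \<notin> S \<Longrightarrow> frechet_derivative \<phi> (at x) i = 0"
    by (rule test_functions_support[OF assms]) iprover
  then have "grad \<phi> x = 0" if "x \<notin> S" for x using that by (simp add: grad_def)
  then show thesis using that S by blast
qed

lemma integrable_indicator_compact: "compact S \<Longrightarrow> integrable lebesgue (indicat_real S)"
  using lmeasurable_compact[of S] by (intro integrable_real_indicator) (auto simp: fmeasurable_def)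

lemma sq_int_indicat:
  assumes "S \<in> lmeasurable" shows "sq_int (indicat_real S)"
proof (rule sq_intI)
  have i: "integrable lebesgue (indicat_real S)"
    using assms by (intro integrable_real_indicator) (auto simp: fmeasurable_def)
  then show "indicat_real S \<in> borel_measurable lebesgue" by (rule borel_measurable_integrable)
  have "(norm (indicat_real S x))\<^sup>2 = indicator S x" for x by (auto split: split_indicator)
  then show "integrable lebesgue (\<lambda>x. (norm (indicat_real S x))\<^sup>2)" using i by (simp only:)
qed

lemma sq_int_continuous_support:
  fixes f :: "'a::euclidean_space \<Rightarrow> 'b::euclidean_space"
  assumes f: "continuous_on UNIV f" and S: "compact S" and z: "\<And>x. x \<notin> S \<Longrightarrow> f x = 0"
  shows "sq_int f"
proof -
  obtain C where C: "C > 0" "\<And>x. norm (f x) \<le> C" using continuous_bounded_on_support[OF f S z] by blast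
  show ?thesis
  proof (rule sq_int_bound[OF sq_int_indicat[OF lmeasurable_compact[OF S]]])
    show "f \<in> borel_measurable lebesgue" using f by (rule continuous_borel_measurable_lebesgue)
    show "AE x in lebesgue. norm (f x) \<le> C * norm (indicat_real S x)"
      using C z by (intro AE_I2) (auto split: split_indicator)
  qed
qed

lemma integrable_continuous_support:
  fixes f :: "'a::euclidean_space \<Rightarrow> 'b::euclidean_space"
  assumes f: "continuous_on UNIV f" and S: "compact S" and z: "\<And>x. x \<notin> S \<Longrightarrow> f x = 0"
  shows "integrable lebesgue f"
proof -
  obtain C where C: "C > 0" "\<And>x. norm (f x) \<le> C" using continuous_bounded_on_support[OF f S z] by blast
  show ?thesis
  proof (rule Bochner_Integration.integrable_bound)
    show "integrable lebesgue (\<lambda>x. C * indicat_real S x)" using integrable_indicator_compact[OF S] by simp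
    show "f \<in> borel_measurable lebesgue" using f by (rule continuous_borel_measurable_lebesgue)
    show "AE x in lebesgue. norm (f x) \<le> norm (C * indicat_real S x)"
      using C z by (intro AE_I2) (auto split: split_indicator)
  qed
qed

lemma sq_int_test: "\<phi> \<in> test_functions \<Omega> \<Longrightarrow> sq_int \<phi>"
  by (rule test_functions_support) (auto intro: sq_int_continuous_support test_functions_continuous)

lemma sq_int_grad: "\<phi> \<in> test_functions \<Omega> \<Longrightarrow> sq_int (grad \<phi>)"
  by (rule test_functions_support_grad) (auto intro: sq_int_continuous_support continuous_on_grad)

lemma sq_int_partial: "\<phi> \<in> test_functions \<Omega> \<Longrightarrow> i \<in> Basis \<Longrightarrow> sq_int (\<lambda>x. frechet_derivative \<phi> (at x) i)"
  by (rule test_functions_support) (auto intro: sq_int_continuous_support continuous_on_partial)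

lemma integrable_test: "\<phi> \<in> test_functions \<Omega> \<Longrightarrow> integrable lebesgue \<phi>"
  by (rule test_functions_support) (auto intro: integrable_continuous_support test_functions_continuous)

lemma integrable_grad: "\<phi> \<in> test_functions \<Omega> \<Longrightarrow> integrable lebesgue (grad \<phi>)"
  by (rule test_functions_support_grad) (auto intro: integrable_continuous_support continuous_on_grad)

section \<open>Difference quotients and integration by parts\<close>

lemma integral_translate:
  fixes f :: "'a::euclidean_space \<Rightarrow> 'b::euclidean_space"
  assumes "continuous_on UNIV f"
  shows "(\<integral>x. f (x + c) \<partial>lebesgue) = (\<integral>x. f x \<partial>lebesgue)"
proof -
  have fb[measurable]: "f \<in> borel_measurable borel" using assms by (rule borel_measurable_continuous_onI)
  have "(\<integral>x. f (x + c) \<partial>lebesgue) = (\<integral>x. f (c + x) \<partial>lborel)"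
    by (simp add: integral_completion add.commute)
  also have "\<dots> = (\<integral>x. f x \<partial>distr lborel borel ((+) c))" by (simp add: integral_distr)
  also have "\<dots> = (\<integral>x. f x \<partial>lebesgue)" by (simp add: lborel_distr_plus integral_completion)
  finally show ?thesis .
qed

lemma test_functions_lipschitz:
  assumes "\<phi> \<in> test_functions \<Omega>"
  obtains C where "C > 0" "\<And>x y. \<bar>\<phi> y - \<phi> x\<bar> \<le> C * norm (y - x)"
proof -
  obtain S where S: "compact S" "S \<subseteq> \<Omega>" "\<And>x. x \<notin> S \<Longrightarrow> \<phi> x = 0" "\<And>x. x \<notin> S \<Longrightarrow> grad \<phi> x = 0"
    by (rule test_functions_support_grad[OF assms]) iprover
  obtain C where C: "C > 0" "\<And>x. norm (grad \<phi> x) \<le> C"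
    using continuous_bounded_on_support[OF continuous_on_grad[OF assms] S(1,4)] by blast
  have "\<bar>\<phi> y - \<phi> x\<bar> \<le> C * norm (y - x)" for x y
  proof -
    have "norm (\<phi> y - \<phi> x) \<le> C * norm (y - x)"
    proof (rule differentiable_bound[where S = UNIV and f' = "\<lambda>x h. grad \<phi> x \<bullet> h"])
      show "onorm ((\<bullet>) (grad \<phi> z)) \<le> C" for z
      proof (rule onorm_le)
        fix h
        have "norm (grad \<phi> z \<bullet> h) \<le> norm (grad \<phi> z) * norm h" by (rule Cauchy_Schwarz_ineq2[folded real_norm_def])
        also have "\<dots> \<le> C * norm h" using C by (intro mult_right_mono) auto
        finally show "norm (grad \<phi> z \<bullet> h) \<le> C * norm h" .
      qed
    qed (use test_functions_has_derivative[OF assms] in auto)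
    then show ?thesis by simp
  qed
  then show thesis using that C(1) by blast
qed

text \<open>The direction \<open>h\<close> is not normalised, so the limit is
  \<open>grad \<phi> x \<bullet> h\<close>; the steps run through a sequence to suit dominated
  convergence.\<close>

definition diff_quot :: "('a::euclidean_space \<Rightarrow> real) \<Rightarrow> 'a \<Rightarrow> nat \<Rightarrow> 'a \<Rightarrow> real" where
  "diff_quot \<phi> h n x = real (Suc n) * (\<phi> (x + h /\<^sub>R real (Suc n)) - \<phi> x)"

lemma continuous_on_diff_quot: "\<phi> \<in> test_functions \<Omega> \<Longrightarrow> continuous_on UNIV (diff_quot \<phi> h n)"
proof -
  assume "\<phi> \<in> test_functions \<Omega>"
  then have c: "continuous_on UNIV \<phi>" by (rule test_functions_continuous)
  have t: "continuous_on UNIV (\<lambda>x. \<phi> (x + h /\<^sub>R real (Suc n)))"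
    by (rule continuous_on_compose2[OF c]) (auto intro!: continuous_intros)
  show ?thesis unfolding diff_quot_def[abs_def]
    by (rule continuous_on_mult_left[OF continuous_on_diff[OF t c]])
qed

lemma diff_quot_tendsto:
  assumes "\<phi> \<in> test_functions \<Omega>" shows "(\<lambda>n. diff_quot \<phi> h n x) \<longlonglongrightarrow> grad \<phi> x \<bullet> h"
proof -
  have "((\<lambda>t. x + t *\<^sub>R h) has_derivative (\<lambda>t. t *\<^sub>R h)) (at 0)" by (auto intro!: derivative_eq_intros)
  moreover have "(\<phi> has_derivative (\<lambda>k. grad \<phi> x \<bullet> k)) (at (x + 0 *\<^sub>R h))"
    using test_functions_has_derivative[OF assms, of x] by simp
  ultimately have "((\<lambda>t. \<phi> (x + t *\<^sub>R h)) has_derivative (\<lambda>t. grad \<phi> x \<bullet> (t *\<^sub>R h))) (at 0)"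
    using has_derivative_compose by blast
  then have "((\<lambda>t. \<phi> (x + t *\<^sub>R h)) has_real_derivative (grad \<phi> x \<bullet> h)) (at 0)"
    by (rule has_derivative_imp_has_field_derivative) (simp add: mult.commute)
  then have "((\<lambda>t. (\<phi> (x + t *\<^sub>R h) - \<phi> x) / t) \<longlongrightarrow> grad \<phi> x \<bullet> h) (at 0)"
    by (simp add: DERIV_def)
  moreover have "filterlim (\<lambda>n. inverse (real (Suc n))) (at 0) sequentially"
    using LIMSEQ_inverse_real_of_nat by (auto simp: filterlim_at intro!: eventuallyI)
  ultimately have "(\<lambda>n. (\<phi> (x + inverse (real (Suc n)) *\<^sub>R h) - \<phi> x) / inverse (real (Suc n))) \<longlonglongrightarrow> grad \<phi> x \<bullet> h"
    by (rule filterlim_compose)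
  then show ?thesis by (simp add: diff_quot_def field_simps)
qed

text \<open>A single integrable majorant for all \<open>n\<close>: the Lipschitz constant controls
  the size, and since no step is longer than \<open>h\<close> the supports stay in one ball.\<close>

lemma diff_quot_bound:
  assumes "\<phi> \<in> test_functions \<Omega>"
  obtains C K where "C > 0" "compact K" "\<And>n x. \<bar>diff_quot \<phi> h n x\<bar> \<le> C * indicator K x"
proof -
  obtain L where L: "L > 0" "\<And>x y. \<bar>\<phi> y - \<phi> x\<bar> \<le> L * norm (y - x)"
    using test_functions_lipschitz[OF assms] by blast
  obtain S where S': "compact S" "S \<subseteq> \<Omega>" "\<And>x. x \<notin> S \<Longrightarrow> \<phi> x = 0" "\<And>x i. x \<notin> S \<Longrightarrow> frechet_derivative \<phi> (at x) i = 0"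
    by (rule test_functions_support[OF assms]) iprover
  note S = S'(1,3)
  obtain R where R: "\<And>x. x \<in> S \<Longrightarrow> norm x \<le> R"
    using compact_imp_bounded[OF S(1)] unfolding bounded_iff by blast
  have step: "norm (h /\<^sub>R real (Suc n)) \<le> norm h" for n
  proof -
    have "inverse (real (Suc n)) * norm h \<le> 1 * norm h"
      by (intro mult_right_mono) (auto simp: inverse_le_1_iff)
    then show ?thesis by simp
  qed
  \<comment> \<open>The summand 1 in \<open>norm h + 1\<close> keeps the constant positive when
    \<open>h\<close> is zero.\<close>
  have "\<bar>diff_quot \<phi> h n x\<bar> \<le> (L * (norm h + 1)) * indicator (cball 0 (R + norm h)) x" for n x
  proof (cases "x \<in> cball 0 (R + norm h)")
    case True
    have "\<bar>diff_quot \<phi> h n x\<bar> \<le> real (Suc n) * (L * norm (h /\<^sub>R real (Suc n)))"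
      using L(2)[of "x + h /\<^sub>R real (Suc n)" x] unfolding diff_quot_def abs_mult by (simp add: mult_left_mono)
    also have "\<dots> = L * norm h" by simp
    also have "\<dots> \<le> L * (norm h + 1)" using L by simp
    finally show ?thesis using True by simp
  next
    case False
    then have n: "norm x > R + norm h" by simp
    have "norm (x + h /\<^sub>R real (Suc n)) > R"
      using norm_triangle_ineq2[of x "- (h /\<^sub>R real (Suc n))"] step[of n] n by simp
    moreover have "norm x > R" using n norm_ge_zero[of h] by linarith
    ultimately have "x \<notin> S" "x + h /\<^sub>R real (Suc n) \<notin> S" using R by (meson not_less)+
    then show ?thesis using S(2) False by (simp add: diff_quot_def)
  qed
  moreover have "L * (norm h + 1) > 0" using L(1) by (simp add: add_nonneg_pos)
  ultimately show thesis using that compact_cball by blast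
qed

text \<open>By translation invariance the difference quotients of a test function have integral zero.\<close>

lemma integral_grad_inner:
  assumes \<phi>: "\<phi> \<in> test_functions \<Omega>" shows "(\<integral>x. grad \<phi> x \<bullet> h \<partial>lebesgue) = 0"
proof -
  obtain C K where CK: "C > 0" "compact K" "\<And>n x. \<bar>diff_quot \<phi> h n x\<bar> \<le> C * indicator K x"
    using diff_quot_bound[OF \<phi>] by blast
  have c: "continuous_on UNIV \<phi>" using \<phi> by (rule test_functions_continuous)
  have lim: "(\<lambda>n. \<integral>x. diff_quot \<phi> h n x \<partial>lebesgue) \<longlonglongrightarrow> (\<integral>x. grad \<phi> x \<bullet> h \<partial>lebesgue)"
  proof (rule integral_dominated_convergence)
    show "(\<lambda>x. grad \<phi> x \<bullet> h) \<in> borel_measurable lebesgue"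
      by (intro continuous_borel_measurable_lebesgue continuous_intros continuous_on_grad[OF \<phi>])
    show "diff_quot \<phi> h n \<in> borel_measurable lebesgue" for n
      by (intro continuous_borel_measurable_lebesgue continuous_on_diff_quot[OF \<phi>])
    show "integrable lebesgue (\<lambda>x. C * indicator K x)" using integrable_indicator_compact[OF CK(2)] by simp
  qed (use CK(3) diff_quot_tendsto[OF \<phi>] in auto)
  have "(\<integral>x. diff_quot \<phi> h n x \<partial>lebesgue) = 0" for n
  proof -
    let ?h = "h /\<^sub>R real (Suc n)"
    have s: "integrable lebesgue (\<lambda>x. \<phi> (x + ?h))"
    proof -
      obtain S where S': "compact S" "S \<subseteq> \<Omega>" "\<And>x. x \<notin> S \<Longrightarrow> \<phi> x = 0" "\<And>x i. x \<notin> S \<Longrightarrow> frechet_derivative \<phi> (at x) i = 0"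
        by (rule test_functions_support[OF \<phi>]) iprover
      note S = S'(1,3)
      show ?thesis
      proof (rule integrable_continuous_support)
        show "continuous_on UNIV (\<lambda>x. \<phi> (x + ?h))" by (rule continuous_on_compose2[OF c]) (auto intro!: continuous_intros)
        show "compact ((\<lambda>x. x - ?h) ` S)" by (intro compact_continuous_image continuous_intros S(1))
        show "\<phi> (x + ?h) = 0" if "x \<notin> (\<lambda>x. x - ?h) ` S" for x
          by (rule S(2)) (use that in \<open>force simp: image_iff\<close>)
      qed
    qed
    have "(\<integral>x. diff_quot \<phi> h n x \<partial>lebesgue) = real (Suc n) * ((\<integral>x. \<phi> (x + ?h) \<partial>lebesgue) - (\<integral>x. \<phi> x \<partial>lebesgue))"
      unfolding diff_quot_def by (subst integral_mult_right_zero, subst Bochner_Integration.integral_diff) (use s integrable_test[OF \<phi>] in auto)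
    then show ?thesis by (simp add: integral_translate[OF c])
  qed
  then show ?thesis using lim by (simp add: LIMSEQ_const_iff)
qed

lemma test_functions_mult:
  assumes "\<phi> \<in> test_functions \<Omega>" "\<psi> \<in> test_functions \<Omega>" shows "(\<lambda>x. \<phi> x * \<psi> x) \<in> test_functions \<Omega>"
proof -
  obtain S where S: "compact S" "S \<subseteq> \<Omega>" "\<And>x. x \<notin> S \<Longrightarrow> \<phi> x = 0" "\<And>x i. x \<notin> S \<Longrightarrow> frechet_derivative \<phi> (at x) i = 0"
    by (rule test_functions_support[OF assms(1)]) iprover
  show ?thesis
    by (rule test_functionsI[OF Ck_mult[OF assms[THEN test_functions_Ck]] S(1,2)]) (simp add: S(3))
qed

lemma test_functions_add:
  assumes "\<phi> \<in> test_functions \<Omega>" "\<psi> \<in> test_functions \<Omega>" shows "(\<lambda>x. \<phi> x + \<psi> x) \<in> test_functions \<Omega>"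
proof -
  obtain S where S: "compact S" "S \<subseteq> \<Omega>" "\<And>x. x \<notin> S \<Longrightarrow> \<phi> x = 0" "\<And>x i. x \<notin> S \<Longrightarrow> frechet_derivative \<phi> (at x) i = 0"
    by (rule test_functions_support[OF assms(1)]) iprover
  obtain T where T: "compact T" "T \<subseteq> \<Omega>" "\<And>x. x \<notin> T \<Longrightarrow> \<psi> x = 0" "\<And>x i. x \<notin> T \<Longrightarrow> frechet_derivative \<psi> (at x) i = 0"
    by (rule test_functions_support[OF assms(2)]) iprover
  show ?thesis
  proof (rule test_functionsI[OF Ck_add[OF assms[THEN test_functions_Ck]] compact_Un[OF S(1) T(1)]])
    show "S \<union> T \<subseteq> \<Omega>" using S(2) T(2) by blast
    show "\<phi> x + \<psi> x = 0" if "x \<notin> S \<union> T" for x using that by (simp add: S(3) T(3))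
  qed
qed

lemma test_functions_const:
  assumes "\<phi> \<in> test_functions \<Omega>" shows "(\<lambda>x. c * \<phi> x) \<in> test_functions \<Omega>"
proof -
  obtain S where S: "compact S" "S \<subseteq> \<Omega>" "\<And>x. x \<notin> S \<Longrightarrow> \<phi> x = 0" "\<And>x i. x \<notin> S \<Longrightarrow> frechet_derivative \<phi> (at x) i = 0"
    by (rule test_functions_support[OF assms]) iprover
  show ?thesis
    by (rule test_functionsI[OF Ck_mult[OF Ck_const test_functions_Ck[OF assms]] S(1,2)]) (simp add: S(3))
qed

lemma zero_test_function: "(\<lambda>_. 0) \<in> test_functions \<Omega>"
  by (simp add: test_functions_def Ck_const)

lemma set_integral_eq_integral_support:
  fixes f :: "'a::euclidean_space \<Rightarrow> real"
  assumes "\<And>x. x \<notin> S \<Longrightarrow> f x = 0" shows "(LINT x:S|lebesgue. f x) = (\<integral>x. f x \<partial>lebesgue)"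
  unfolding set_lebesgue_integral_def using assms by (intro Bochner_Integration.integral_cong) (auto split: split_indicator)

lemma integrable_imp_L1_loc: "integrable lebesgue f \<Longrightarrow> f \<in> L1_loc \<Omega>"
  unfolding L1_loc_def set_integrable_def
  using integrable_mult_indicator[of _ lebesgue f] lmeasurable_compact by (auto simp: fmeasurableD)

text \<open>Integration by parts is the vanishing integral of the gradient of the product of two
  test functions.\<close>

lemma has_weak_gradient_test:
  assumes \<phi>: "\<phi> \<in> test_functions \<Omega>" shows "has_weak_gradient \<Omega> \<phi> (grad \<phi>)"
  unfolding has_weak_gradient_def
proof (intro conjI ballI integrable_imp_L1_loc integrable_test[OF \<phi>] integrable_grad[OF \<phi>])
  fix \<psi> i assume \<psi>: "\<psi> \<in> test_functions \<Omega>" and i: "i \<in> (Basis :: 'a set)"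
  let ?P = "\<lambda>x. \<phi> x * \<psi> x"
  have P: "?P \<in> test_functions \<Omega>" using \<phi> \<psi> by (rule test_functions_mult)
  obtain S where S: "compact S" "S \<subseteq> \<Omega>" "\<And>x. x \<notin> S \<Longrightarrow> \<phi> x = 0" "\<And>x. x \<notin> S \<Longrightarrow> grad \<phi> x = 0"
    by (rule test_functions_support_grad[OF \<phi>]) iprover
  have S': "\<phi> x = 0" "grad \<phi> x = 0" if "x \<notin> \<Omega>" for x using that S by blast+
  have "grad ?P x \<bullet> i = \<phi> x * frechet_derivative \<psi> (at x) i + grad \<phi> x \<bullet> i * \<psi> x" for x
  proof -
    have "(?P has_derivative (\<lambda>h. \<phi> x * (grad \<psi> x \<bullet> h) + grad \<phi> x \<bullet> h * \<psi> x)) (at x)"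
      by (intro has_derivative_mult test_functions_has_derivative[OF \<phi>] test_functions_has_derivative[OF \<psi>])
    from frechet_derivative_eqI[OF this] show ?thesis using i by (simp add: grad_inner_Basis)
  qed
  moreover have i1: "integrable lebesgue (\<lambda>x. \<phi> x * frechet_derivative \<psi> (at x) i)"
    using S by (intro integrable_continuous_support[OF _ S(1)] continuous_intros
        test_functions_continuous[OF \<phi>] continuous_on_partial[OF \<psi> i]) auto
  moreover have i2: "integrable lebesgue (\<lambda>x. grad \<phi> x \<bullet> i * \<psi> x)"
    using S by (intro integrable_continuous_support[OF _ S(1)] continuous_intros
        test_functions_continuous[OF \<psi>] continuous_on_grad[OF \<phi>]) auto
  ultimately have "(\<integral>x. \<phi> x * frechet_derivative \<psi> (at x) i \<partial>lebesgue) + (\<integral>x. grad \<phi> x \<bullet> i * \<psi> x \<partial>lebesgue) = 0"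
    using integral_grad_inner[OF P, of i] by (simp add: Bochner_Integration.integral_add)
  then show "(LINT x:\<Omega>|lebesgue. \<phi> x * frechet_derivative \<psi> (at x) i) = - (LINT x:\<Omega>|lebesgue. grad \<phi> x \<bullet> i * \<psi> x)"
    using S' by (subst (1 2) set_integral_eq_integral_support) auto
qed

section \<open>Weak gradients and the graph embedding of Sobolev spaces\<close>

lemma L1_loc_add: "f \<in> L1_loc \<Omega> \<Longrightarrow> g \<in> L1_loc \<Omega> \<Longrightarrow> (\<lambda>x. f x + g x) \<in> L1_loc \<Omega>"
  unfolding L1_loc_def by (auto intro: set_integral_add)

lemma L1_loc_scaleR: "f \<in> L1_loc \<Omega> \<Longrightarrow> (\<lambda>x. c *\<^sub>R f x) \<in> L1_loc \<Omega>"
  unfolding L1_loc_def by (auto intro: set_integrable_scaleR_right)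

lemma L1_loc_inner:
  assumes "f \<in> L1_loc \<Omega>" shows "(\<lambda>x. f x \<bullet> i) \<in> L1_loc \<Omega>"
proof -
  have "set_integrable lebesgue C (\<lambda>x. f x \<bullet> i)" if "compact C" "C \<subseteq> \<Omega>" for C
  proof -
    have "integrable lebesgue (\<lambda>x. (indicator C x *\<^sub>R f x) \<bullet> i)"
      using assms that unfolding L1_loc_def set_integrable_def by (intro integrable_inner_left) blast
    then show ?thesis by (simp add: set_integrable_def)
  qed
  then show ?thesis by (simp add: L1_loc_def)
qed

lemma set_integrable_times_test:
  assumes "g \<in> L1_loc \<Omega>" "\<phi> \<in> test_functions \<Omega>" shows "set_integrable lebesgue \<Omega> (\<lambda>x. g x * \<phi> x)"
proof -
  obtain S where S: "compact S" "S \<subseteq> \<Omega>" "\<And>x. x \<notin> S \<Longrightarrow> \<phi> x = 0" "\<And>x i. x \<notin> S \<Longrightarrow> frechet_derivative \<phi> (at x) i = 0"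
    by (rule test_functions_support[OF assms(2)]) iprover
  show ?thesis by (rule L1_loc_times_continuous[OF assms(1) test_functions_continuous[OF assms(2)] S(1-3)])
qed

lemma set_integrable_times_partial:
  assumes "g \<in> L1_loc \<Omega>" "\<phi> \<in> test_functions \<Omega>" "i \<in> Basis"
  shows "set_integrable lebesgue \<Omega> (\<lambda>x. g x * frechet_derivative \<phi> (at x) i)"
proof -
  obtain S where S: "compact S" "S \<subseteq> \<Omega>" "\<And>x. x \<notin> S \<Longrightarrow> \<phi> x = 0" "\<And>x i. x \<notin> S \<Longrightarrow> frechet_derivative \<phi> (at x) i = 0"
    by (rule test_functions_support[OF assms(2)]) iprover
  show ?thesis by (rule L1_loc_times_continuous[OF assms(1) continuous_on_partial[OF assms(2,3)] S(1,2) S(4)])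
qed

text \<open>The fundamental lemma is applied to each component of the difference. All statements
  about the \<open>SOME\<close> in \<open>weak_gradient\<close> rest on this.\<close>

lemma weak_gradient_unique_AE:
  assumes \<Omega>: "open \<Omega>" and g: "has_weak_gradient \<Omega> u g" and g': "has_weak_gradient \<Omega> u g'"
  shows "AE x in lebesgue. x \<in> \<Omega> \<longrightarrow> g x = g' x"
proof -
  have L: "g \<in> L1_loc \<Omega>" "g' \<in> L1_loc \<Omega>" using g g' by (auto simp: has_weak_gradient_def)
  have "AE x in lebesgue. x \<in> \<Omega> \<longrightarrow> g x \<bullet> i - g' x \<bullet> i = 0" if i: "i \<in> Basis" for i
  proof (rule fundamental_lemma[OF \<Omega>])
    have "(\<lambda>x. g x \<bullet> i + (-1) *\<^sub>R (g' x \<bullet> i)) \<in> L1_loc \<Omega>"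
      by (intro L1_loc_add L1_loc_scaleR L1_loc_inner L)
    then show "(\<lambda>x. g x \<bullet> i - g' x \<bullet> i) \<in> L1_loc \<Omega>" by simp
    fix \<phi> assume \<phi>: "\<phi> \<in> test_functions \<Omega>"
    have "(LINT x:\<Omega>|lebesgue. (g x \<bullet> i - g' x \<bullet> i) * \<phi> x) =
        (LINT x:\<Omega>|lebesgue. g x \<bullet> i * \<phi> x) - (LINT x:\<Omega>|lebesgue. g' x \<bullet> i * \<phi> x)"
      unfolding left_diff_distrib by (intro set_integral_diff(2) set_integrable_times_test L1_loc_inner L \<phi>)
    also have "\<dots> = 0"
      using g g' \<phi> i by (simp add: has_weak_gradient_def)
    finally show "(LINT x:\<Omega>|lebesgue. (g x \<bullet> i - g' x \<bullet> i) * \<phi> x) = 0" .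
  qed
  then have "AE x in lebesgue. \<forall>i\<in>Basis. x \<in> \<Omega> \<longrightarrow> g x \<bullet> i - g' x \<bullet> i = 0"
    by (intro AE_finite_allI) auto
  then show ?thesis by eventually_elim (auto intro: euclidean_eqI)
qed

lemma has_weak_gradient_add:
  assumes u: "has_weak_gradient \<Omega> u g" and v: "has_weak_gradient \<Omega> v k"
  shows "has_weak_gradient \<Omega> (\<lambda>x. u x + v x) (\<lambda>x. g x + k x)"
proof -
  have L: "u \<in> L1_loc \<Omega>" "v \<in> L1_loc \<Omega>" "g \<in> L1_loc \<Omega>" "k \<in> L1_loc \<Omega>" using u v by (auto simp: has_weak_gradient_def)
  show ?thesis unfolding has_weak_gradient_def
  proof (intro conjI ballI L1_loc_add L)
    fix \<phi> i assume \<phi>: "\<phi> \<in> test_functions \<Omega>" and i: "i \<in> (Basis :: 'a set)"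
    have "(LINT x:\<Omega>|lebesgue. (u x + v x) * frechet_derivative \<phi> (at x) i) =
        (LINT x:\<Omega>|lebesgue. u x * frechet_derivative \<phi> (at x) i) + (LINT x:\<Omega>|lebesgue. v x * frechet_derivative \<phi> (at x) i)"
      unfolding distrib_right by (intro set_integral_add(2) set_integrable_times_partial L \<phi> i)
    also have "\<dots> = - ((LINT x:\<Omega>|lebesgue. g x \<bullet> i * \<phi> x) + (LINT x:\<Omega>|lebesgue. k x \<bullet> i * \<phi> x))"
      using u v \<phi> i by (simp add: has_weak_gradient_def)
    also have "\<dots> = - (LINT x:\<Omega>|lebesgue. (g x + k x) \<bullet> i * \<phi> x)"
      unfolding inner_add_left distrib_right
      by (subst set_integral_add(2)) (intro set_integrable_times_test L1_loc_inner L \<phi> refl)+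
    finally show "(LINT x:\<Omega>|lebesgue. (u x + v x) * frechet_derivative \<phi> (at x) i) =
      - (LINT x:\<Omega>|lebesgue. (g x + k x) \<bullet> i * \<phi> x)" .
  qed
qed

lemma has_weak_gradient_scale:
  assumes u: "has_weak_gradient \<Omega> u g"
  shows "has_weak_gradient \<Omega> (\<lambda>x. c * u x) (\<lambda>x. c *\<^sub>R g x)"
proof -
  have L: "u \<in> L1_loc \<Omega>" "g \<in> L1_loc \<Omega>" using u by (auto simp: has_weak_gradient_def)
  show ?thesis unfolding has_weak_gradient_def
  proof (intro conjI ballI L1_loc_scaleR L)
    show "(\<lambda>x. c * u x) \<in> L1_loc \<Omega>" using L1_loc_scaleR[OF L(1), of c] by simp
    fix \<phi> i assume \<phi>: "\<phi> \<in> test_functions \<Omega>" and i: "i \<in> (Basis :: 'a set)"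
    have "(LINT x:\<Omega>|lebesgue. c * u x * frechet_derivative \<phi> (at x) i) =
        c * (LINT x:\<Omega>|lebesgue. u x * frechet_derivative \<phi> (at x) i)"
      unfolding mult.assoc by (rule set_integral_mult_right)
    also have "\<dots> = c * - (LINT x:\<Omega>|lebesgue. g x \<bullet> i * \<phi> x)"
      using u \<phi> i by (simp add: has_weak_gradient_def)
    also have "\<dots> = - (LINT x:\<Omega>|lebesgue. c *\<^sub>R g x \<bullet> i * \<phi> x)"
      by (simp add: mult.assoc set_integral_mult_right)
    finally show "(LINT x:\<Omega>|lebesgue. c * u x * frechet_derivative \<phi> (at x) i) =
        - (LINT x:\<Omega>|lebesgue. c *\<^sub>R g x \<bullet> i * \<phi> x)" .
  qed
qed

definition zero_ext :: "'a set \<Rightarrow> ('a \<Rightarrow> 'b::real_vector) \<Rightarrow> 'a \<Rightarrow> 'b" where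
  "zero_ext \<Omega> f x = indicator \<Omega> x *\<^sub>R f x"

lemma L2_iff_sq_int: "f \<in> L2 \<Omega> \<longleftrightarrow> sq_int (zero_ext \<Omega> f)"
proof -
  have "(norm (zero_ext \<Omega> f x))\<^sup>2 = indicator \<Omega> x *\<^sub>R (norm (f x))\<^sup>2" for x
    by (auto simp: zero_ext_def split: split_indicator)
  moreover have "zero_ext \<Omega> f = (\<lambda>x. indicator \<Omega> x *\<^sub>R f x)" by (simp add: zero_ext_def fun_eq_iff)
  ultimately show ?thesis
    by (simp add: L2_def sq_int_def set_borel_measurable_def set_integrable_def)
qed

lemma zero_ext_support: "(\<And>x. x \<notin> \<Omega> \<Longrightarrow> f x = 0) \<Longrightarrow> zero_ext \<Omega> f = f"
  by (auto simp: zero_ext_def fun_eq_iff split: split_indicator)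

lemma zero_ext_add: "zero_ext \<Omega> (\<lambda>x. f x + g x) = (\<lambda>x. zero_ext \<Omega> f x + zero_ext \<Omega> g x)"
  by (simp add: zero_ext_def fun_eq_iff scaleR_add_right)

lemma zero_ext_scaleR: "zero_ext \<Omega> (\<lambda>x. c *\<^sub>R f x) = (\<lambda>x. c *\<^sub>R zero_ext \<Omega> f x)"
  by (simp add: zero_ext_def fun_eq_iff mult.commute)

lemma sq_int_imp_L1_loc:
  assumes f: "sq_int f" shows "f \<in> L1_loc \<Omega>"
proof -
  have "set_integrable lebesgue C f" if C: "compact C" for C
    unfolding set_integrable_def
  proof (rule Bochner_Integration.integrable_bound)
    show "integrable lebesgue (\<lambda>x. indicat_real C x + (norm (f x))\<^sup>2)"
      by (intro Bochner_Integration.integrable_add integrable_indicator_compact C sq_int_integrable f)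
    show "(\<lambda>x. indicat_real C x *\<^sub>R f x) \<in> borel_measurable lebesgue"
      using borel_measurable_integrable[OF integrable_indicator_compact[OF C]] sq_int_measurable[OF f]
      by (rule borel_measurable_scaleR)
    show "AE x in lebesgue. norm (indicat_real C x *\<^sub>R f x) \<le> norm (indicat_real C x + (norm (f x))\<^sup>2)"
    proof (rule AE_I2)
      fix x
      have "norm (f x) \<le> 1 + (norm (f x))\<^sup>2"
      proof -
        have "2 * norm (f x) \<le> (norm (f x))\<^sup>2 + 1" using sum_squares_bound[of "norm (f x)" 1] by simp
        then show ?thesis using norm_ge_zero[of "f x"] by linarith
      qed
      then show "norm (indicat_real C x *\<^sub>R f x) \<le> norm (indicat_real C x + (norm (f x))\<^sup>2)"
        by (auto split: split_indicator)
    qed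
  qed
  then show ?thesis by (simp add: L1_loc_def)
qed

text \<open>Lebesgue measure is complete, so whatever happens on the exceptional null set is
  measurable. The chosen \<open>weak_gradient\<close> inherits measurability in this way from a
  square-integrable gradient.\<close>

lemma measurable_lebesgue_AE_eq:
  fixes f g :: "'a::euclidean_space \<Rightarrow> 'b::topological_space"
  assumes g: "g \<in> borel_measurable lebesgue" and ae: "AE x in lebesgue. f x = g x"
  shows "f \<in> borel_measurable lebesgue"
proof -
  obtain N where N: "{x \<in> space lebesgue. \<not> f x = g x} \<subseteq> N" "emeasure lebesgue N = 0" "N \<in> sets lebesgue"
    using ae by (rule AE_E)
  then have neg: "negligible N" by (auto simp: negligible_iff_null_sets null_sets_def)
  show ?thesis
  proof (rule measurableI)
    fix A :: "'b set" assume A: "A \<in> sets borel"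
    have "f -` A \<inter> space lebesgue = (g -` A \<inter> space lebesgue - N) \<union> (f -` A \<inter> N)"
      using N(1) by auto
    moreover have "f -` A \<inter> N \<in> sets lebesgue"
      using negligible_subset[OF neg, of "f -` A \<inter> N"] by (auto simp: negligible_iff_null_sets)
    ultimately show "f -` A \<inter> space lebesgue \<in> sets lebesgue"
      using measurable_sets[OF g A] N(3) by (metis sets.Diff sets.Un)
  qed simp
qed

text \<open>Membership in \<open>H1\<close> supplies some square-integrable gradient, not
  necessarily the chosen one; almost everywhere uniqueness transfers the integrability.\<close>

lemma H1_weak_gradient:
  assumes \<Omega>: "open \<Omega>" and u: "u \<in> H1 \<Omega>"
  shows "has_weak_gradient \<Omega> u (weak_gradient \<Omega> u)" "sq_int (zero_ext \<Omega> u)" "sq_int (zero_ext \<Omega> (weak_gradient \<Omega> u))"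
proof -
  obtain g where g: "g \<in> L2 \<Omega>" "has_weak_gradient \<Omega> u g" using u unfolding H1_def by blast
  show w: "has_weak_gradient \<Omega> u (weak_gradient \<Omega> u)" unfolding weak_gradient_def using g(2) by (rule someI[of "has_weak_gradient \<Omega> u"])
  show "sq_int (zero_ext \<Omega> u)" using u by (simp add: H1_def L2_iff_sq_int)
  have ae: "AE x in lebesgue. zero_ext \<Omega> (weak_gradient \<Omega> u) x = zero_ext \<Omega> g x"
    using weak_gradient_unique_AE[OF \<Omega> w g(2)] by eventually_elim (auto simp: zero_ext_def split: split_indicator)
  have gs: "sq_int (zero_ext \<Omega> g)" using g(1) by (simp add: L2_iff_sq_int)
  show "sq_int (zero_ext \<Omega> (weak_gradient \<Omega> u))"
  proof (rule sq_int_bound[OF gs])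
    show "zero_ext \<Omega> (weak_gradient \<Omega> u) \<in> borel_measurable lebesgue"
      by (rule measurable_lebesgue_AE_eq[OF sq_int_measurable[OF gs] ae])
    show "AE x in lebesgue. norm (zero_ext \<Omega> (weak_gradient \<Omega> u) x) \<le> 1 * norm (zero_ext \<Omega> g x)"
      using ae by eventually_elim simp
  qed
qed

text \<open>The product norm of this pair is \<open>H1_norm\<close>, so approximation by test
  functions in \<open>H10\<close> becomes topological closure of their image
  (\<open>H10_iff\<close>).\<close>

definition sobolev_pair :: "'a::euclidean_space set \<Rightarrow> ('a \<Rightarrow> real) \<Rightarrow> ('a, real) l2 \<times> ('a, 'a) l2" where
  "sobolev_pair \<Omega> u = (to_l2 (zero_ext \<Omega> u), to_l2 (zero_ext \<Omega> (weak_gradient \<Omega> u)))"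

lemma sobolev_pair_eqI:
  assumes \<Omega>: "open \<Omega>" and u: "sq_int (zero_ext \<Omega> u)" and g: "sq_int (zero_ext \<Omega> g)" and w: "has_weak_gradient \<Omega> u g"
  shows "u \<in> H1 \<Omega>" "sobolev_pair \<Omega> u = (to_l2 (zero_ext \<Omega> u), to_l2 (zero_ext \<Omega> g))"
proof -
  show H: "u \<in> H1 \<Omega>" using u g w by (auto simp: H1_def L2_iff_sq_int)
  have "AE x in lebesgue. zero_ext \<Omega> (weak_gradient \<Omega> u) x = zero_ext \<Omega> g x"
    using weak_gradient_unique_AE[OF \<Omega> H1_weak_gradient(1)[OF \<Omega> H] w]
    by eventually_elim (auto simp: zero_ext_def split: split_indicator)
  then show "sobolev_pair \<Omega> u = (to_l2 (zero_ext \<Omega> u), to_l2 (zero_ext \<Omega> g))"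
    unfolding sobolev_pair_def using g H1_weak_gradient(3)[OF \<Omega> H] by (simp add: to_l2_eq_iff)
qed

lemma sobolev_pair_add:
  assumes \<Omega>: "open \<Omega>" and u: "u \<in> H1 \<Omega>" and v: "v \<in> H1 \<Omega>"
  shows "(\<lambda>x. u x + v x) \<in> H1 \<Omega>" "sobolev_pair \<Omega> (\<lambda>x. u x + v x) = sobolev_pair \<Omega> u + sobolev_pair \<Omega> v"
proof -
  note U = H1_weak_gradient[OF \<Omega> u] and V = H1_weak_gradient[OF \<Omega> v]
  have "sq_int (zero_ext \<Omega> (\<lambda>x. u x + v x))" "sq_int (zero_ext \<Omega> (\<lambda>x. weak_gradient \<Omega> u x + weak_gradient \<Omega> v x))"
    using U V by (simp_all add: zero_ext_add sq_int_add)
  note * = sobolev_pair_eqI[OF \<Omega> this has_weak_gradient_add[OF U(1) V(1)]]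
  show "(\<lambda>x. u x + v x) \<in> H1 \<Omega>" by (rule *)
  show "sobolev_pair \<Omega> (\<lambda>x. u x + v x) = sobolev_pair \<Omega> u + sobolev_pair \<Omega> v"
    using *(2) U V by (simp add: sobolev_pair_def zero_ext_add plus_to_l2)
qed

lemma sobolev_pair_scale:
  assumes \<Omega>: "open \<Omega>" and u: "u \<in> H1 \<Omega>"
  shows "(\<lambda>x. c * u x) \<in> H1 \<Omega>" "sobolev_pair \<Omega> (\<lambda>x. c * u x) = c *\<^sub>R sobolev_pair \<Omega> u"
proof -
  note U = H1_weak_gradient[OF \<Omega> u]
  have z: "zero_ext \<Omega> (\<lambda>x. c * u x) = (\<lambda>x. c *\<^sub>R zero_ext \<Omega> u x)" using zero_ext_scaleR[of \<Omega> c u] by simp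
  have "sq_int (zero_ext \<Omega> (\<lambda>x. c * u x))" "sq_int (zero_ext \<Omega> (\<lambda>x. c *\<^sub>R weak_gradient \<Omega> u x))"
    unfolding z zero_ext_scaleR by (intro sq_int_scaleR U)+
  note * = sobolev_pair_eqI[OF \<Omega> this has_weak_gradient_scale[OF U(1)]]
  show "(\<lambda>x. c * u x) \<in> H1 \<Omega>" by (rule *)
  show "sobolev_pair \<Omega> (\<lambda>x. c * u x) = c *\<^sub>R sobolev_pair \<Omega> u"
    using *(2) U unfolding z zero_ext_scaleR by (simp add: sobolev_pair_def scaleR_to_l2)
qed

lemma sobolev_pair_diff:
  assumes \<Omega>: "open \<Omega>" and u: "u \<in> H1 \<Omega>" and v: "v \<in> H1 \<Omega>"
  shows "u - v \<in> H1 \<Omega>" "sobolev_pair \<Omega> (u - v) = sobolev_pair \<Omega> u - sobolev_pair \<Omega> v"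
proof -
  have e: "u - v = (\<lambda>x. u x + (-1) * v x)" by (simp add: fun_eq_iff)
  note s = sobolev_pair_scale[OF \<Omega> v, of "-1"]
  show "u - v \<in> H1 \<Omega>" unfolding e by (rule sobolev_pair_add(1)[OF \<Omega> u s(1)])
  show "sobolev_pair \<Omega> (u - v) = sobolev_pair \<Omega> u - sobolev_pair \<Omega> v"
    unfolding e sobolev_pair_add(2)[OF \<Omega> u s(1)] s(2) by simp
qed

lemma zero_ext_test:
  assumes "\<phi> \<in> test_functions \<Omega>" shows "zero_ext \<Omega> \<phi> = \<phi>" "zero_ext \<Omega> (grad \<phi>) = grad \<phi>"
proof -
  obtain S where S: "compact S" "S \<subseteq> \<Omega>" "\<And>x. x \<notin> S \<Longrightarrow> \<phi> x = 0" "\<And>x. x \<notin> S \<Longrightarrow> grad \<phi> x = 0"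
    by (rule test_functions_support_grad[OF assms]) iprover
  show "zero_ext \<Omega> \<phi> = \<phi>" "zero_ext \<Omega> (grad \<phi>) = grad \<phi>"
    using S by (intro zero_ext_support; blast)+
qed

lemma sobolev_pair_test:
  assumes \<Omega>: "open \<Omega>" and \<phi>: "\<phi> \<in> test_functions \<Omega>"
  shows "\<phi> \<in> H1 \<Omega>" "sobolev_pair \<Omega> \<phi> = (to_l2 \<phi>, to_l2 (grad \<phi>))"
  using sobolev_pair_eqI[OF \<Omega> _ _ has_weak_gradient_test[OF \<phi>]] zero_ext_test[OF \<phi>] sq_int_test[OF \<phi>] sq_int_grad[OF \<phi>]
  by simp_all

lemma H1_norm_eq_norm_sobolev_pair:
  assumes \<Omega>: "open \<Omega>" and u: "u \<in> H1 \<Omega>" shows "H1_norm \<Omega> u = norm (sobolev_pair \<Omega> u)"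
proof -
  note U = H1_weak_gradient[OF \<Omega> u]
  have e: "(norm (zero_ext \<Omega> f x))\<^sup>2 = indicator \<Omega> x *\<^sub>R (norm (f x))\<^sup>2" for x and f :: "'a \<Rightarrow> 'c::real_normed_vector"
    by (auto simp: zero_ext_def split: split_indicator)
  show ?thesis
    unfolding H1_norm_def sobolev_pair_def norm_Pair norm_to_l2_sq[OF U(2)] norm_to_l2_sq[OF U(3)] e
    by (simp add: set_lebesgue_integral_def)
qed

lemma H10_iff:
  assumes \<Omega>: "open \<Omega>"
  shows "u \<in> H10 \<Omega> \<longleftrightarrow> u \<in> H1 \<Omega> \<and> sobolev_pair \<Omega> u \<in> closure (sobolev_pair \<Omega> ` test_functions \<Omega>)"
proof -
  have "H1_norm \<Omega> (u - \<phi>) = dist (sobolev_pair \<Omega> \<phi>) (sobolev_pair \<Omega> u)" if "u \<in> H1 \<Omega>" "\<phi> \<in> test_functions \<Omega>" for \<phi>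
    using sobolev_pair_diff[OF \<Omega> that(1) sobolev_pair_test(1)[OF \<Omega> that(2)]]
    by (simp add: H1_norm_eq_norm_sobolev_pair[OF \<Omega>] dist_norm norm_minus_commute)
  then show ?thesis by (auto simp: H10_def closure_approachable)
qed

lemma open_sets_lebesgue: "open (S :: 'a::euclidean_space set) \<Longrightarrow> S \<in> sets lebesgue"
  by (simp add: borel_open)

text \<open>The right-hand side consists of equations between continuous functions of
  \<open>(U, G)\<close>: invariance under restriction, and one pair of inner products for each test
  function and coordinate. Closedness of the image can be read off from them.\<close>

lemma sobolev_pair_H1_iff:
  fixes \<Omega> :: "'a::euclidean_space set"
  assumes \<Omega>: "open \<Omega>"
  shows "(U, G) \<in> sobolev_pair \<Omega> ` H1 \<Omega> \<longleftrightarrow> restrict_l2 \<Omega> U = U \<and> restrict_l2 \<Omega> G = G \<and>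
     (\<forall>\<phi>\<in>test_functions \<Omega>. \<forall>i\<in>Basis. U \<bullet> to_l2 (\<lambda>x. frechet_derivative \<phi> (at x) i) = - (G \<bullet> to_l2 (\<lambda>x. \<phi> x *\<^sub>R i)))"
    (is "?L \<longleftrightarrow> ?R")
proof -
  note \<Omega>s = open_sets_lebesgue[OF \<Omega>]
  have inner_u: "to_l2 (zero_ext \<Omega> u) \<bullet> to_l2 (\<lambda>x. frechet_derivative \<phi> (at x) i) = (LINT x:\<Omega>|lebesgue. u x * frechet_derivative \<phi> (at x) i)"
    if "sq_int (zero_ext \<Omega> u)" "\<phi> \<in> test_functions \<Omega>" "i \<in> Basis" for u \<phi> i
    using that by (simp add: inner_to_l2 sq_int_partial[OF that(2)] zero_ext_def set_lebesgue_integral_def mult.assoc)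
  have sq_\<phi>: "sq_int (\<lambda>x. \<phi> x *\<^sub>R i)" if "\<phi> \<in> test_functions \<Omega>" for \<phi> and i :: 'a
    using sq_int_measurable[OF sq_int_test[OF that]]
    by (intro sq_int_bound[OF sq_int_test[OF that], of _ "norm i"]) auto
  have inner_g: "to_l2 (zero_ext \<Omega> g) \<bullet> to_l2 (\<lambda>x. \<phi> x *\<^sub>R i) = (LINT x:\<Omega>|lebesgue. g x \<bullet> i * \<phi> x)"
    if "sq_int (zero_ext \<Omega> g)" "\<phi> \<in> test_functions \<Omega>" for g :: "'a \<Rightarrow> 'a" and \<phi> i
    unfolding inner_to_l2[OF that(1) sq_\<phi>[OF that(2)]]
    by (simp add: zero_ext_def set_lebesgue_integral_def ac_simps)
  show ?thesis
  proof
    assume ?L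
    then obtain u where u: "u \<in> H1 \<Omega>" and UG: "U = to_l2 (zero_ext \<Omega> u)" "G = to_l2 (zero_ext \<Omega> (weak_gradient \<Omega> u))"
      by (auto simp: sobolev_pair_def)
    note H = H1_weak_gradient[OF \<Omega> u]
    have r: "(\<lambda>x. indicator \<Omega> x *\<^sub>R zero_ext \<Omega> f x) = zero_ext \<Omega> f" for f :: "'a \<Rightarrow> 'c::real_vector"
      by (auto simp: fun_eq_iff zero_ext_def split: split_indicator)
    show ?R
    proof (intro conjI ballI)
      show "restrict_l2 \<Omega> U = U" unfolding UG by (simp only: restrict_to_l2[OF H(2) \<Omega>s] r)
      show "restrict_l2 \<Omega> G = G" unfolding UG by (simp only: restrict_to_l2[OF H(3) \<Omega>s] r)
      fix \<phi> and i :: 'a assume \<phi>: "\<phi> \<in> test_functions \<Omega>" and i: "i \<in> Basis"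
      show "U \<bullet> to_l2 (\<lambda>x. frechet_derivative \<phi> (at x) i) = - (G \<bullet> to_l2 (\<lambda>x. \<phi> x *\<^sub>R i))"
        unfolding UG inner_u[OF H(2) \<phi> i] inner_g[OF H(3) \<phi>] using H(1) \<phi> i by (simp add: has_weak_gradient_def)
    qed
  next
    assume R: ?R
    \<comment> \<open>A representative may be nonzero on a null set outside \<open>\<Omega>\<close>;
      the two restriction equations identify the class of its zero extension with the given
      one.\<close>
    let ?u = "rep_l2 U" and ?g = "rep_l2 G"
    have zu: "zero_ext \<Omega> ?u = (\<lambda>x. indicator \<Omega> x *\<^sub>R ?u x)" and zg: "zero_ext \<Omega> ?g = (\<lambda>x. indicator \<Omega> x *\<^sub>R ?g x)"
      by (auto simp: fun_eq_iff zero_ext_def)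
    have u: "sq_int (zero_ext \<Omega> ?u)" and g: "sq_int (zero_ext \<Omega> ?g)"
      unfolding zu zg by (intro sq_int_indicator \<Omega>s sq_int_rep_l2)+
    have U: "to_l2 (zero_ext \<Omega> ?u) = U" and G: "to_l2 (zero_ext \<Omega> ?g) = G"
      unfolding zu zg using R by (simp_all add: mult_l2_def)
    have w: "has_weak_gradient \<Omega> ?u ?g"
      unfolding has_weak_gradient_def
    proof (intro conjI ballI sq_int_imp_L1_loc sq_int_rep_l2)
      fix \<phi> and i :: 'a assume \<phi>: "\<phi> \<in> test_functions \<Omega>" and i: "i \<in> Basis"
      then show "(LINT x:\<Omega>|lebesgue. ?u x * frechet_derivative \<phi> (at x) i) = - (LINT x:\<Omega>|lebesgue. ?g x \<bullet> i * \<phi> x)"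
        unfolding inner_u[OF u \<phi> i, symmetric] inner_g[OF g \<phi>, symmetric] U G using R by blast
    qed
    have "(U, G) = sobolev_pair \<Omega> ?u" unfolding sobolev_pair_eqI(2)[OF \<Omega> u g w] U G ..
    then show ?L using sobolev_pair_eqI(1)[OF \<Omega> u g w] by (rule image_eqI)
  qed
qed

lemma closed_sobolev_pair_H1:
  assumes \<Omega>: "open \<Omega>" shows "closed (sobolev_pair \<Omega> ` H1 \<Omega>)"
proof -
  note b1 = bounded_linear_restrict_l2[OF open_sets_lebesgue[OF \<Omega>], where 'b = real]
  note b2 = bounded_linear_restrict_l2[OF open_sets_lebesgue[OF \<Omega>], where 'b = 'a]
  have "sobolev_pair \<Omega> ` H1 \<Omega> = {z. restrict_l2 \<Omega> (fst z) = fst z} \<inter> {z. restrict_l2 \<Omega> (snd z) = snd z} \<inter>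
     (\<Inter>\<phi>\<in>test_functions \<Omega>. \<Inter>i\<in>Basis. {z. fst z \<bullet> to_l2 (\<lambda>x. frechet_derivative \<phi> (at x) i) = - (snd z \<bullet> to_l2 (\<lambda>x. \<phi> x *\<^sub>R i))})"
    (is "_ = ?S")
  proof (rule set_eqI)
    fix z :: "('a, real) l2 \<times> ('a, 'a) l2"
    show "z \<in> sobolev_pair \<Omega> ` H1 \<Omega> \<longleftrightarrow> z \<in> ?S"
      using sobolev_pair_H1_iff[OF \<Omega>, of "fst z" "snd z"]
      by (simp only: prod.collapse Int_iff INT_iff mem_Collect_eq conj_assoc Ball_def)
  qed
  also have "closed ?S"
    by (intro closed_Int closed_INT ballI closed_Collect_eq continuous_intros
        bounded_linear.continuous_on[OF b1] bounded_linear.continuous_on[OF b2])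
  finally show ?thesis .
qed

lemma subspace_closure:
  fixes S :: "'v::real_normed_vector set"
  assumes S: "subspace S" shows "subspace (closure S)"
proof (rule subspaceI)
  show "0 \<in> closure S" using subspace_0[OF S] closure_subset by blast
  fix x y c assume x: "x \<in> closure S" and y: "y \<in> closure S"
  obtain X where X: "\<And>n. X n \<in> S" "X \<longlonglongrightarrow> x" using x closure_sequential by metis
  obtain Y where Y: "\<And>n. Y n \<in> S" "Y \<longlonglongrightarrow> y" using y closure_sequential by metis
  show "x + y \<in> closure S"
    unfolding closure_sequential using subspace_add[OF S X(1) Y(1)] tendsto_add[OF X(2) Y(2)]
    by (intro exI[of _ "\<lambda>n. X n + Y n"]) simp
next
  fix c x assume x: "x \<in> closure S"
  obtain X where X: "\<And>n. X n \<in> S" "X \<longlonglongrightarrow> x" using x closure_sequential by metis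
  show "c *\<^sub>R x \<in> closure S"
    unfolding closure_sequential using subspace_scale[OF S X(1)] tendsto_scaleR[OF tendsto_const X(2)]
    by (intro exI[of _ "\<lambda>n. c *\<^sub>R X n"]) simp
qed

lemma subspace_sobolev_pair_test:
  assumes \<Omega>: "open \<Omega>" shows "subspace (sobolev_pair \<Omega> ` test_functions \<Omega>)"
proof (rule subspaceI)
  note T = sobolev_pair_test[OF \<Omega>]
  show "0 \<in> sobolev_pair \<Omega> ` test_functions \<Omega>"
    using sobolev_pair_scale(2)[OF \<Omega> T(1)[OF zero_test_function], of 0] zero_test_function[of \<Omega>]
    by (metis image_eqI mult_zero_left scaleR_zero_left)
  fix x y assume "x \<in> sobolev_pair \<Omega> ` test_functions \<Omega>" "y \<in> sobolev_pair \<Omega> ` test_functions \<Omega>"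
  then obtain \<phi> \<psi> where p: "\<phi> \<in> test_functions \<Omega>" "\<psi> \<in> test_functions \<Omega>" "x = sobolev_pair \<Omega> \<phi>" "y = sobolev_pair \<Omega> \<psi>" by blast
  then have "x + y = sobolev_pair \<Omega> (\<lambda>x. \<phi> x + \<psi> x)" using sobolev_pair_add(2)[OF \<Omega> T(1) T(1)] by simp
  then show "x + y \<in> sobolev_pair \<Omega> ` test_functions \<Omega>" using test_functions_add[OF p(1,2)] by (rule image_eqI)
next
  note T = sobolev_pair_test[OF \<Omega>]
  fix c x assume "x \<in> sobolev_pair \<Omega> ` test_functions \<Omega>"
  then obtain \<phi> where p: "\<phi> \<in> test_functions \<Omega>" "x = sobolev_pair \<Omega> \<phi>" by blast
  then have "c *\<^sub>R x = sobolev_pair \<Omega> (\<lambda>x. c * \<phi> x)" using sobolev_pair_scale(2)[OF \<Omega> T(1)] by simp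
  then show "c *\<^sub>R x \<in> sobolev_pair \<Omega> ` test_functions \<Omega>" using test_functions_const[OF p(1)] by (rule image_eqI)
qed

lemma H10_add: "open \<Omega> \<Longrightarrow> u \<in> H10 \<Omega> \<Longrightarrow> v \<in> H10 \<Omega> \<Longrightarrow> (\<lambda>x. u x + v x) \<in> H10 \<Omega>"
  by (simp add: H10_iff sobolev_pair_add subspace_add[OF subspace_closure[OF subspace_sobolev_pair_test]])

lemma H10_scale: "open \<Omega> \<Longrightarrow> u \<in> H10 \<Omega> \<Longrightarrow> (\<lambda>x. c * u x) \<in> H10 \<Omega>"
  by (simp add: H10_iff sobolev_pair_scale subspace_scale[OF subspace_closure[OF subspace_sobolev_pair_test]])

lemma zero_H10: "open \<Omega> \<Longrightarrow> (\<lambda>_. 0) \<in> H10 \<Omega>"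
  using subsetD[OF closure_subset imageI[OF zero_test_function[of \<Omega>], of "sobolev_pair \<Omega>"]]
  by (simp add: H10_iff sobolev_pair_test(1) zero_test_function)

section \<open>Restriction to elements and the bubble space\<close>

text \<open>Test functions on \<open>K\<close> are test functions on \<open>\<Omega>\<close>, so the
  gradient on \<open>\<Omega>\<close> also serves on \<open>K\<close>. Restriction thereby becomes
  multiplication by an indicator in both components.\<close>

lemma H1_restrict:
  assumes \<Omega>: "open \<Omega>" and K: "open K" "K \<subseteq> \<Omega>" and u: "u \<in> H1 \<Omega>"
  shows "u \<in> H1 K"
    "sobolev_pair K u = (restrict_l2 K (fst (sobolev_pair \<Omega> u)), restrict_l2 K (snd (sobolev_pair \<Omega> u)))"
proof -
  note H = H1_weak_gradient[OF \<Omega> u] and Ks = open_sets_lebesgue[OF K(1)]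
  have z: "(\<lambda>x. indicator K x *\<^sub>R zero_ext \<Omega> f x) = zero_ext K f" for f :: "'a \<Rightarrow> 'c::real_vector"
    using K(2) by (auto simp: fun_eq_iff zero_ext_def split: split_indicator)
  have s: "sq_int (zero_ext K u)" "sq_int (zero_ext K (weak_gradient \<Omega> u))"
    using sq_int_indicator[OF H(2) Ks] sq_int_indicator[OF H(3) Ks] by (simp_all only: z)
  have w: "has_weak_gradient K u (weak_gradient \<Omega> u)"
    unfolding has_weak_gradient_def
  proof (intro conjI ballI)
    show "u \<in> L1_loc K" "weak_gradient \<Omega> u \<in> L1_loc K"
      using H(1) K(2) unfolding has_weak_gradient_def L1_loc_def by blast+
    fix \<phi> i assume \<phi>: "\<phi> \<in> test_functions K" and i: "i \<in> (Basis :: 'a set)"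
    obtain S where S: "compact S" "S \<subseteq> K" "\<And>x. x \<notin> S \<Longrightarrow> \<phi> x = 0" "\<And>x i. x \<notin> S \<Longrightarrow> frechet_derivative \<phi> (at x) i = 0"
      by (rule test_functions_support[OF \<phi>]) iprover
    have \<phi>': "\<phi> \<in> test_functions \<Omega>" using \<phi> K(2) unfolding test_functions_def by blast
    have e: "(LINT x:K|lebesgue. f x) = (LINT x:\<Omega>|lebesgue. f x)" if "\<And>x. x \<notin> S \<Longrightarrow> f x = 0" for f :: "'a \<Rightarrow> real"
      using that S(2) K(2) by (subst (1 2) set_integral_eq_integral_support) auto
    show "(LINT x:K|lebesgue. u x * frechet_derivative \<phi> (at x) i) = - (LINT x:K|lebesgue. weak_gradient \<Omega> u x \<bullet> i * \<phi> x)"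
      using S \<phi>' i H(1) by (subst (1 2) e) (auto simp: has_weak_gradient_def)
  qed
  show "u \<in> H1 K" by (rule sobolev_pair_eqI[OF K(1) s w])
  show "sobolev_pair K u = (restrict_l2 K (fst (sobolev_pair \<Omega> u)), restrict_l2 K (snd (sobolev_pair \<Omega> u)))"
    unfolding sobolev_pair_eqI(2)[OF K(1) s w]
    by (simp only: sobolev_pair_def fst_conv snd_conv restrict_to_l2[OF H(2) Ks] restrict_to_l2[OF H(3) Ks] z)
qed

lemma sobolev_pair_H10_eq:
  "open \<Omega> \<Longrightarrow> sobolev_pair \<Omega> ` H10 \<Omega> = sobolev_pair \<Omega> ` H1 \<Omega> \<inter> closure (sobolev_pair \<Omega> ` test_functions \<Omega>)"
  by (auto simp: H10_iff)

lemma closed_sobolev_pair_H10: "open \<Omega> \<Longrightarrow> closed (sobolev_pair \<Omega> ` H10 \<Omega>)"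
  by (simp add: sobolev_pair_H10_eq closed_Int closed_sobolev_pair_H1)

text \<open>An element of \<open>H1 \<Omega>\<close> is automatically in \<open>H1 K\<close>, so
  \<open>H10 K\<close> adds only a closure condition on its restriction: a preimage of a closed set
  under a continuous map.\<close>

lemma sobolev_pair_bubble_eq:
  fixes \<Omega> :: "(real^2) set"
  assumes \<Omega>: "open \<Omega>" and \<T>: "\<And>K. K \<in> \<T> \<Longrightarrow> open K \<and> K \<subseteq> \<Omega>"
  shows "sobolev_pair \<Omega> ` bubble_space \<Omega> \<T> = sobolev_pair \<Omega> ` H10 \<Omega> \<inter>
    (\<Inter>K\<in>\<T>. {z. (restrict_l2 K (fst z), restrict_l2 K (snd z)) \<in> closure (sobolev_pair K ` test_functions K)})"
    (is "_ = _ \<inter> ?R")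
proof -
  have "v \<in> H10 K \<longleftrightarrow> (restrict_l2 K (fst (sobolev_pair \<Omega> v)), restrict_l2 K (snd (sobolev_pair \<Omega> v)))
      \<in> closure (sobolev_pair K ` test_functions K)" if "v \<in> H10 \<Omega>" "K \<in> \<T>" for v K
  proof -
    have K: "open K" "K \<subseteq> \<Omega>" and v: "v \<in> H1 \<Omega>" using that \<T> \<Omega> by (auto simp: H10_def)
    show ?thesis using H1_restrict[OF \<Omega> K v] by (simp add: H10_iff[OF K(1)])
  qed
  then show ?thesis unfolding bubble_space_def by auto
qed

lemma closed_sobolev_pair_bubble:
  fixes \<Omega> :: "(real^2) set"
  assumes \<Omega>: "open \<Omega>" and \<T>: "\<And>K. K \<in> \<T> \<Longrightarrow> open K \<and> K \<subseteq> \<Omega>"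
  shows "closed (sobolev_pair \<Omega> ` bubble_space \<Omega> \<T>)"
proof (subst sobolev_pair_bubble_eq[OF \<Omega> \<T>], assumption, intro closed_Int closed_INT ballI closed_sobolev_pair_H10 \<Omega>)
  fix K assume "K \<in> \<T>"
  then have "open K" using \<T> by simp
  then have Ks: "K \<in> sets lebesgue" by (rule open_sets_lebesgue)
  have c: "continuous_on UNIV (\<lambda>z::(real^2, real) l2 \<times> (real^2, real^2) l2. (restrict_l2 K (fst z), restrict_l2 K (snd z)))"
    by (intro continuous_on_Pair continuous_on_fst continuous_on_snd continuous_on_id
        bounded_linear.continuous_on[OF bounded_linear_restrict_l2[OF Ks]])
  show "closed {z. (restrict_l2 K (fst z), restrict_l2 K (snd z)) \<in> closure (sobolev_pair K ` test_functions K)}"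
    using closed_vimage[OF closed_closure c] unfolding vimage_def .
qed

lemma bubble_space_add:
  fixes \<Omega> :: "(real^2) set"
  assumes \<Omega>: "open \<Omega>" and \<T>: "\<And>K. K \<in> \<T> \<Longrightarrow> open K \<and> K \<subseteq> \<Omega>"
    and "u \<in> bubble_space \<Omega> \<T>" "v \<in> bubble_space \<Omega> \<T>"
  shows "(\<lambda>x. u x + v x) \<in> bubble_space \<Omega> \<T>"
  using assms by (auto simp: bubble_space_def intro: H10_add)

lemma bubble_space_scale:
  fixes \<Omega> :: "(real^2) set"
  assumes \<Omega>: "open \<Omega>" and \<T>: "\<And>K. K \<in> \<T> \<Longrightarrow> open K \<and> K \<subseteq> \<Omega>" and "u \<in> bubble_space \<Omega> \<T>"
  shows "(\<lambda>x. c * u x) \<in> bubble_space \<Omega> \<T>"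
  using assms by (auto simp: bubble_space_def intro: H10_scale)

section \<open>Translation estimates, the Poincare inequality and Rellich compactness\<close>

text \<open>Translation moves supports out of \<open>\<Omega>\<close>, so
  \<open>test_functions \<Omega>\<close> is not stable under it. This class is, and it is also
  closed under differences.\<close>

definition cc_support :: "('a::euclidean_space \<Rightarrow> 'b::euclidean_space) \<Rightarrow> bool" where
  "cc_support f \<longleftrightarrow> continuous_on UNIV f \<and> (\<exists>S. compact S \<and> (\<forall>x. x \<notin> S \<longrightarrow> f x = 0))"

lemma cc_support_sq_int: "cc_support f \<Longrightarrow> sq_int f"
  unfolding cc_support_def using sq_int_continuous_support by blast

lemma cc_support_test: "\<phi> \<in> test_functions \<Omega> \<Longrightarrow> cc_support \<phi>"
proof -
  assume \<phi>: "\<phi> \<in> test_functions \<Omega>"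
  obtain S where S: "compact S" "S \<subseteq> \<Omega>" "\<And>x. x \<notin> S \<Longrightarrow> \<phi> x = 0" "\<And>x i. x \<notin> S \<Longrightarrow> frechet_derivative \<phi> (at x) i = 0"
    by (rule test_functions_support[OF \<phi>]) iprover
  show ?thesis unfolding cc_support_def
    using test_functions_continuous[OF \<phi>] S(1,3) by (intro conjI exI[of _ S]) simp_all
qed

lemma cc_support_translate:
  assumes "cc_support f" shows "cc_support (\<lambda>x. f (x + c))"
proof -
  obtain S where f: "continuous_on UNIV f" and S: "compact S" "\<forall>x. x \<notin> S \<longrightarrow> f x = 0"
    using assms unfolding cc_support_def by blast
  have "continuous_on UNIV (\<lambda>x. f (x + c))" by (rule continuous_on_compose2[OF f]) (auto intro!: continuous_intros)
  moreover have "compact ((\<lambda>x. x - c) ` S)" by (intro compact_continuous_image continuous_intros S(1))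
  moreover have "f (x + c) = 0" if "x \<notin> (\<lambda>x. x - c) ` S" for x
  proof -
    have "x + c \<notin> S" using that by (metis add_diff_cancel_right' image_eqI)
    then show ?thesis using S(2) by simp
  qed
  ultimately show ?thesis unfolding cc_support_def by (intro conjI exI[of _ "(\<lambda>x. x - c) ` S"]) simp_all
qed

lemma cc_support_diff:
  assumes "cc_support f" "cc_support g" shows "cc_support (\<lambda>x. f x - g x)"
proof -
  obtain S where f: "continuous_on UNIV f" and S: "compact S" "\<forall>x. x \<notin> S \<longrightarrow> f x = 0"
    using assms(1) unfolding cc_support_def by blast
  obtain T where g: "continuous_on UNIV g" and T: "compact T" "\<forall>x. x \<notin> T \<longrightarrow> g x = 0"
    using assms(2) unfolding cc_support_def by blast
  show ?thesis unfolding cc_support_def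
    using S T by (intro conjI exI[of _ "S \<union> T"] continuous_on_diff f g compact_Un) auto
qed

lemma norm_to_l2_translate:
  assumes "cc_support f" shows "norm (to_l2 (\<lambda>x. f (x + c))) = norm (to_l2 f)"
proof -
  have f: "continuous_on UNIV f" using assms unfolding cc_support_def by blast
  have "continuous_on UNIV (\<lambda>x. (norm (f x))\<^sup>2)" by (intro continuous_intros f)
  from integral_translate[OF this]
  have "(norm (to_l2 (\<lambda>x. f (x + c))))\<^sup>2 = (norm (to_l2 f))\<^sup>2"
    by (simp add: norm_to_l2_sq cc_support_sq_int cc_support_translate assms)
  then show ?thesis by simp
qed

text \<open>The long shift telescopes into \<open>n\<close> increments, each a translate of the
  first and hence of the same norm.\<close>

lemma norm_translate_multiple:
  fixes f :: "'a::euclidean_space \<Rightarrow> 'b::euclidean_space"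
  assumes f: "cc_support f"
  shows "norm (to_l2 (\<lambda>x. f (x + real n *\<^sub>R h) - f x)) \<le> real n * norm (to_l2 (\<lambda>x. f (x + h) - f x))"
proof (induction n)
  case 0
  have "to_l2 (\<lambda>x::'a. 0::'b) = 0" by (simp add: zero_l2.abs_eq)
  then show ?case by simp
next
  case (Suc n)
  let ?d = "\<lambda>x. f (x + h) - f x"
  have d: "cc_support ?d" by (intro cc_support_diff cc_support_translate f)
  have "(\<lambda>x. f (x + real (Suc n) *\<^sub>R h) - f x) =
      (\<lambda>x. ?d (x + real n *\<^sub>R h) + (f (x + real n *\<^sub>R h) - f x))"
    by (simp add: fun_eq_iff algebra_simps)
  then have "to_l2 (\<lambda>x. f (x + real (Suc n) *\<^sub>R h) - f x) =
      to_l2 (\<lambda>x. ?d (x + real n *\<^sub>R h)) + to_l2 (\<lambda>x. f (x + real n *\<^sub>R h) - f x)"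
    by (simp only:) (intro plus_to_l2[symmetric] cc_support_sq_int cc_support_diff cc_support_translate f d)
  then have "norm (to_l2 (\<lambda>x. f (x + real (Suc n) *\<^sub>R h) - f x)) \<le>
      norm (to_l2 (\<lambda>x. ?d (x + real n *\<^sub>R h))) + norm (to_l2 (\<lambda>x. f (x + real n *\<^sub>R h) - f x))"
    by (simp only: norm_triangle_ineq)
  also have "\<dots> \<le> norm (to_l2 ?d) + real n * norm (to_l2 ?d)"
    using Suc.IH norm_to_l2_translate[OF d, of "real n *\<^sub>R h"] by simp
  finally show ?case by (simp add: algebra_simps)
qed

text \<open>Subdividing a translation into \<open>n\<close> steps bounds it by difference quotients, which converge to the directional derivative.\<close>

lemma translation_estimate:
  assumes \<phi>: "\<phi> \<in> test_functions \<Omega>"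
  shows "norm (to_l2 (\<lambda>x. \<phi> (x + h) - \<phi> x)) \<le> norm h * norm (to_l2 (grad \<phi>))"
proof -
  let ?q = "diff_quot \<phi> h"
  obtain C K where C: "C > 0" and K: "compact K" and q: "\<And>n x. \<bar>?q n x\<bar> \<le> C * indicator K x"
    using diff_quot_bound[OF \<phi>] by blast
  have cc: "cc_support \<phi>" using \<phi> by (rule cc_support_test)
  have qe: "?q n = (\<lambda>x. real (Suc n) *\<^sub>R (\<phi> (x + h /\<^sub>R real (Suc n)) - \<phi> x))" for n
    by (simp add: diff_quot_def fun_eq_iff)
  have qs: "sq_int (?q n)" for n
    unfolding qe by (intro sq_int_scaleR cc_support_sq_int cc_support_diff cc_support_translate cc)
  have step: "norm (to_l2 (\<lambda>x. \<phi> (x + h) - \<phi> x)) \<le> norm (to_l2 (?q n))" for n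
  proof -
    have "norm (to_l2 (\<lambda>x. \<phi> (x + h) - \<phi> x)) \<le> real (Suc n) * norm (to_l2 (\<lambda>x. \<phi> (x + h /\<^sub>R real (Suc n)) - \<phi> x))"
      using norm_translate_multiple[OF cc, of "Suc n" "h /\<^sub>R real (Suc n)"] by simp
    also have "\<dots> = norm (to_l2 (?q n))"
      unfolding qe by (subst scaleR_to_l2[symmetric]) (intro cc_support_sq_int cc_support_diff cc_support_translate cc, simp)
    finally show ?thesis .
  qed
  have cs: "\<bar>grad \<phi> x \<bullet> h\<bar> \<le> norm h * norm (grad \<phi> x)" for x
    using Cauchy_Schwarz_ineq2[of "grad \<phi> x" h] by (simp add: mult.commute)
  have gs: "sq_int (\<lambda>x. grad \<phi> x \<bullet> h)"
  proof (rule sq_int_bound[OF sq_int_grad[OF \<phi>]])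
    show "(\<lambda>x. grad \<phi> x \<bullet> h) \<in> borel_measurable lebesgue"
      by (intro continuous_borel_measurable_lebesgue continuous_intros continuous_on_grad[OF \<phi>])
    show "AE x in lebesgue. norm (grad \<phi> x \<bullet> h) \<le> norm h * norm (grad \<phi> x)"
      using cs by (intro AE_I2) simp
  qed
  have "(\<lambda>n. \<integral>x. (norm (?q n x))\<^sup>2 \<partial>lebesgue) \<longlonglongrightarrow> (\<integral>x. (norm (grad \<phi> x \<bullet> h))\<^sup>2 \<partial>lebesgue)"
  proof (rule integral_dominated_convergence)
    show "(\<lambda>x. (norm (grad \<phi> x \<bullet> h))\<^sup>2) \<in> borel_measurable lebesgue"
      using borel_measurable_integrable[OF sq_int_integrable[OF gs]] .
    show "(\<lambda>x. (norm (?q n x))\<^sup>2) \<in> borel_measurable lebesgue" for n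
      using borel_measurable_integrable[OF sq_int_integrable[OF qs]] .
    show "integrable lebesgue (\<lambda>x. C\<^sup>2 * indicator K x)" using integrable_indicator_compact[OF K] by simp
    show "AE x in lebesgue. (\<lambda>n. (norm (?q n x))\<^sup>2) \<longlonglongrightarrow> (norm (grad \<phi> x \<bullet> h))\<^sup>2"
      by (intro AE_I2 tendsto_intros diff_quot_tendsto[OF \<phi>])
    show "AE x in lebesgue. norm ((norm (?q n x))\<^sup>2) \<le> C\<^sup>2 * indicator K x" for n
    proof (rule AE_I2)
      fix x
      have "\<bar>?q n x\<bar>\<^sup>2 \<le> (C * indicator K x)\<^sup>2" using q[of n x] by (intro power_mono) auto
      then show "norm ((norm (?q n x))\<^sup>2) \<le> C\<^sup>2 * indicator K x"
        by (auto simp: power_mult_distrib split: split_indicator)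
    qed
  qed
  then have lim: "(\<lambda>n. (norm (to_l2 (?q n)))\<^sup>2) \<longlonglongrightarrow> (norm (to_l2 (\<lambda>x. grad \<phi> x \<bullet> h)))\<^sup>2"
    by (simp add: norm_to_l2_sq qs gs)
  have "(norm (to_l2 (\<lambda>x. \<phi> (x + h) - \<phi> x)))\<^sup>2 \<le> (norm (to_l2 (\<lambda>x. grad \<phi> x \<bullet> h)))\<^sup>2"
    by (rule LIMSEQ_le_const[OF lim]) (use step in \<open>auto intro: power_mono\<close>)
  then have "norm (to_l2 (\<lambda>x. \<phi> (x + h) - \<phi> x)) \<le> norm (to_l2 (\<lambda>x. grad \<phi> x \<bullet> h))"
    by (rule power2_le_imp_le) simp
  also have "\<dots> \<le> norm (to_l2 (\<lambda>x. norm h *\<^sub>R grad \<phi> x))"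
    using cs by (intro norm_to_l2_le gs sq_int_scaleR sq_int_grad[OF \<phi>] AE_I2) simp
  also have "\<dots> = norm h * norm (to_l2 (grad \<phi>))"
    by (simp add: scaleR_to_l2[symmetric] sq_int_grad[OF \<phi>])
  finally show ?thesis .
qed

text \<open>A translation by more than the diameter of \<open>\<Omega>\<close> makes the supports disjoint.\<close>

lemma poincare_test:
  fixes \<Omega> :: "'a::euclidean_space set"
  assumes "bounded \<Omega>"
  obtains C where "C > 0" "\<And>\<phi>. \<phi> \<in> test_functions \<Omega> \<Longrightarrow> norm (to_l2 \<phi>) \<le> C * norm (to_l2 (grad \<phi>))"
proof -
  obtain R where R: "R > 0" "\<And>x. x \<in> \<Omega> \<Longrightarrow> norm x \<le> R" using assms unfolding bounded_pos by blast
  obtain e :: 'a where e: "e \<in> Basis" using nonempty_Basis by blast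
  \<comment> \<open>Longer than the diameter of the ball of radius \<open>R\<close> that contains
    \<open>\<Omega>\<close>.\<close>
  define h where "h = (2 * R + 1) *\<^sub>R e"
  have h: "norm h = 2 * R + 1" using R e by (simp add: h_def)
  have "norm (to_l2 \<phi>) \<le> norm h * norm (to_l2 (grad \<phi>))" if \<phi>: "\<phi> \<in> test_functions \<Omega>" for \<phi>
  proof -
    have cc: "cc_support \<phi>" "cc_support (\<lambda>x. \<phi> (x + h))" using \<phi> by (auto intro: cc_support_translate cc_support_test)
    note sq = cc_support_sq_int[OF cc(1)] cc_support_sq_int[OF cc(2)]
    have z: "\<phi> x = 0" if "norm x > R" for x
    proof -
      have "x \<notin> \<Omega>" using R(2) that by (meson not_less)
      then show ?thesis using fun_cong[OF zero_ext_test(1)[OF \<phi>], of x] by (simp add: zero_ext_def)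
    qed
    have z0: "\<phi> (x + h) \<bullet> \<phi> x = 0" for x
    proof (cases "norm x > R")
      case False
      have "norm (x + h) \<ge> norm h - norm x" using norm_triangle_ineq2[of h "- x"] by (simp add: add.commute)
      then have "norm (x + h) > R" using False h R(1) by linarith
      then show ?thesis using z by simp
    qed (simp add: z)
    have orth: "to_l2 (\<lambda>x. \<phi> (x + h)) \<bullet> to_l2 \<phi> = 0"
      by (simp only: inner_to_l2[OF sq(2,1)] z0 integral_zero)
    \<comment> \<open>Disjoint supports make the function and its translate orthogonal, so by
      Pythagoras the difference is at least as large as either of them.\<close>
    have "(norm (to_l2 \<phi>))\<^sup>2 \<le> (norm (to_l2 (\<lambda>x. \<phi> (x + h))))\<^sup>2 + (norm (to_l2 \<phi>))\<^sup>2" by simp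
    also have "\<dots> = (norm (to_l2 (\<lambda>x. \<phi> (x + h)) - to_l2 \<phi>))\<^sup>2"
      by (simp add: power2_norm_eq_inner inner_diff_left inner_diff_right orth inner_commute[of "to_l2 \<phi>" "to_l2 (\<lambda>x. \<phi> (x + h))"])
    finally have "norm (to_l2 \<phi>) \<le> norm (to_l2 (\<lambda>x. \<phi> (x + h)) - to_l2 \<phi>)" by (rule power2_le_imp_le) simp
    also have "\<dots> \<le> norm h * norm (to_l2 (grad \<phi>))"
      using translation_estimate[OF \<phi>, of h] by (simp add: minus_to_l2 sq)
    finally show ?thesis .
  qed
  moreover have "norm h > 0" using h R by simp
  ultimately show thesis using that by blast
qed

section \<open>Cell averages on a grid and compactness\<close>

text \<open>Half-open cubes of a grid of width \<open>d\<close>: every point lies in exactly one of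
  them, so step functions can be evaluated pointwise rather than up to null sets.\<close>

definition cell :: "real \<Rightarrow> ('a::euclidean_space \<Rightarrow> int) \<Rightarrow> 'a set" where
  "cell d k = {x. \<forall>i\<in>Basis. d * of_int (k i) \<le> x \<bullet> i \<and> x \<bullet> i < d * (of_int (k i) + 1)}"

lemma cell_borel: "cell d k \<in> sets borel"
proof -
  have "cell d k = (\<Inter>i\<in>Basis. {x. d * of_int (k i) \<le> x \<bullet> i} \<inter> {x. x \<bullet> i < d * (of_int (k i) + 1)})"
    by (auto simp: cell_def)
  also have "\<dots> \<in> sets borel"
    by (intro sets.finite_INT sets.Int borel_closed borel_open closed_Collect_le open_Collect_less continuous_intros) auto
  finally show ?thesis .
qed

lemma box_subset_cell: "box (\<Sum>i\<in>Basis. (d * of_int (k i)) *\<^sub>R i) (\<Sum>i\<in>Basis. (d * (of_int (k i) + 1)) *\<^sub>R i) \<subseteq> cell d k"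
  by (auto simp: cell_def mem_box less_imp_le)

lemma cell_subset_cbox: "cell d k \<subseteq> cbox (\<Sum>i\<in>Basis. (d * of_int (k i)) *\<^sub>R i) (\<Sum>i\<in>Basis. (d * (of_int (k i) + 1)) *\<^sub>R i)"
  by (auto simp: cell_def mem_box less_imp_le)

lemma cell_lmeasurable: "cell d k \<in> lmeasurable"
  by (rule bounded_set_imp_lmeasurable) (use bounded_subset[OF bounded_cbox cell_subset_cbox] cell_borel[of d k] in auto)

lemma measure_cell_ge:
  fixes k :: "'a::euclidean_space \<Rightarrow> int"
  assumes "d > 0" shows "d ^ DIM('a) \<le> measure lebesgue (cell d k)"
proof -
  let ?a = "\<Sum>i\<in>Basis. (d * of_int (k i)) *\<^sub>R i" and ?b = "\<Sum>i\<in>Basis. (d * (of_int (k i) + 1)) *\<^sub>R (i::'a)"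
  have "measure lebesgue (box ?a ?b) = (\<Prod>i\<in>(Basis::'a set). (?b - ?a) \<bullet> i)"
    using assms by (subst measure_completion) (auto intro!: measure_lborel_box mult_left_mono)
  also have "\<dots> = (\<Prod>i\<in>(Basis::'a set). d)"
  proof (rule prod.cong[OF refl])
    fix i :: 'a assume "i \<in> Basis"
    then have "(?b - ?a) \<bullet> i = d * (of_int (k i) + 1) - d * of_int (k i)" by (simp add: inner_diff_left)
    then show "(?b - ?a) \<bullet> i = d" by (simp add: distrib_left)
  qed
  also have "\<dots> = d ^ DIM('a)" by simp
  finally have "d ^ DIM('a) = measure lebesgue (box ?a ?b)" by simp
  also have "\<dots> \<le> measure lebesgue (cell d k)"
    by (intro measure_mono_fmeasurable box_subset_cell cell_lmeasurable) simp
  finally show ?thesis .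
qed

lemma cell_unique:
  assumes d: "d > 0" and x: "x \<in> cell d k" "x \<in> cell d l" and i: "i \<in> Basis"
  shows "k i = l i"
proof -
  have "of_int (k i) \<le> x \<bullet> i / d" "x \<bullet> i / d < of_int (k i) + 1" "of_int (l i) \<le> x \<bullet> i / d" "x \<bullet> i / d < of_int (l i) + 1"
    using x i d by (auto simp: cell_def field_simps)
  then have "\<lfloor>x \<bullet> i / d\<rfloor> = k i" "\<lfloor>x \<bullet> i / d\<rfloor> = l i" by (simp_all add: floor_eq_iff)
  then show ?thesis by simp
qed

text \<open>The index takes floors of coordinates. Extensional index functions make the family
  finite and let an index be determined by its values on \<open>Basis\<close>.\<close>

lemma cell_cover:
  fixes x :: "'a::euclidean_space"
  assumes d: "d > 0" and x: "norm x \<le> R" and N: "R / d < of_int N"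
  shows "\<exists>k \<in> Basis \<rightarrow>\<^sub>E {-N..N}. x \<in> cell d k"
proof
  let ?k = "restrict (\<lambda>i. \<lfloor>x \<bullet> i / d\<rfloor>) Basis"
  have "\<lfloor>x \<bullet> i / d\<rfloor> \<in> {-N..N}" if i: "i \<in> Basis" for i
  proof -
    have "\<bar>x \<bullet> i\<bar> \<le> R" using Basis_le_norm[OF i, of x] x by linarith
    then have "\<bar>x \<bullet> i\<bar> / d \<le> R / d" using d by (intro divide_right_mono) auto
    then have "\<bar>x \<bullet> i / d\<bar> < of_int N" using N d by (simp add: abs_divide)
    then have "x \<bullet> i / d < of_int N" "- of_int N < x \<bullet> i / d" by (simp_all only: abs_less_iff) linarith
    then show ?thesis by (simp add: floor_le_iff le_floor_iff)
  qed
  then show "?k \<in> Basis \<rightarrow>\<^sub>E {-N..N}" by auto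
  show "x \<in> cell d ?k"
    unfolding cell_def
  proof (intro CollectI ballI conjI)
    fix i :: 'a assume i: "i \<in> Basis"
    define m where "m = \<lfloor>x \<bullet> i / d\<rfloor>"
    have "of_int m \<le> x \<bullet> i / d" "x \<bullet> i / d < of_int m + 1" unfolding m_def by linarith+
    then have "of_int m * d \<le> x \<bullet> i" "x \<bullet> i < (of_int m + 1) * d"
      by (simp_all only: pos_le_divide_eq[OF d] pos_divide_less_eq[OF d])
    then show "d * of_int (?k i) \<le> x \<bullet> i" "x \<bullet> i < d * (of_int (?k i) + 1)"
      using i by (simp_all add: m_def[symmetric] mult.commute)
  qed
qed

text \<open>Cauchy-Schwarz for \<open>indicator Q y * (c - \<phi> y)\<close> against the indicator
  of \<open>Q\<close>. The constant \<open>c\<close> will be the value of \<open>\<phi>\<close> at a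
  point of the cell.\<close>

lemma jensen_average:
  fixes \<phi> :: "'a::euclidean_space \<Rightarrow> real"
  assumes \<phi>: "continuous_on UNIV \<phi>" and Q: "bounded Q" "Q \<in> sets lebesgue" and m: "measure lebesgue Q > 0"
  shows "(c - (\<integral>y. indicator Q y * \<phi> y \<partial>lebesgue) / measure lebesgue Q)\<^sup>2 \<le> (\<integral>y. indicator Q y * (c - \<phi> y)\<^sup>2 \<partial>lebesgue) / measure lebesgue Q"
    and "integrable lebesgue (\<lambda>y. indicator Q y * (c - \<phi> y)\<^sup>2)"
proof -
  let ?m = "measure lebesgue Q"
  have Ql: "Q \<in> lmeasurable" using Q by (rule bounded_set_imp_lmeasurable)
  have iQ: "integrable lebesgue (indicat_real Q)"
    using Ql by (intro integrable_real_indicator) (auto simp: fmeasurable_def)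
  have Qm: "indicat_real Q \<in> borel_measurable lebesgue" using Q(2) by (rule borel_measurable_indicator)
  have sQ: "sq_int (indicat_real Q)" using Ql by (rule sq_int_indicat)
  have \<phi>m: "\<phi> \<in> borel_measurable lebesgue" using \<phi> by (rule continuous_borel_measurable_lebesgue)
  have "compact (closure Q)" using Q(1) by (simp add: compact_closure)
  then have "bounded (\<phi> ` closure Q)"
    using \<phi> by (intro compact_imp_bounded compact_continuous_image) (auto intro: continuous_on_subset)
  then obtain M where M: "M > 0" "\<And>y. y \<in> closure Q \<Longrightarrow> \<bar>\<phi> y\<bar> \<le> M" unfolding bounded_pos by auto
  have MQ: "\<bar>\<phi> y\<bar> \<le> M" if "y \<in> Q" for y using M(2) closure_subset that by blast
  have s: "sq_int (\<lambda>y. indicator Q y * (c' - \<phi> y))" for c'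
  proof (rule sq_int_bound[OF sQ])
    show "(\<lambda>y. indicator Q y * (c' - \<phi> y)) \<in> borel_measurable lebesgue"
      by (intro borel_measurable_times Qm borel_measurable_diff borel_measurable_const \<phi>m)
    have "\<bar>c' - \<phi> y\<bar> \<le> \<bar>c'\<bar> + M" if "y \<in> Q" for y using MQ[OF that] by linarith
    then show "AE y in lebesgue. norm (indicator Q y * (c' - \<phi> y)) \<le> (\<bar>c'\<bar> + M) * norm (indicat_real Q y)"
      by (intro AE_I2) (auto split: split_indicator)
  qed
  let ?u = "to_l2 (\<lambda>y. indicator Q y * (c - \<phi> y))" and ?v = "to_l2 (indicat_real Q)"
  have i\<phi>: "integrable lebesgue (\<lambda>y. indicator Q y * \<phi> y)"
  proof -
    have "indicator Q y * (0 - \<phi> y) * indicator Q y = - (indicator Q y * \<phi> y)" for y by (auto split: split_indicator)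
    then have "integrable lebesgue (\<lambda>y. - (indicator Q y * \<phi> y))"
      using sq_int_inner[OF s[of 0] sQ] by (simp only: inner_real_def)
    from Bochner_Integration.integrable_minus[OF this] show ?thesis by simp
  qed
  have "?u \<bullet> ?v = (\<integral>y. c * indicator Q y - indicator Q y * \<phi> y \<partial>lebesgue)"
    unfolding inner_to_l2[OF s sQ] by (intro Bochner_Integration.integral_cong refl) (auto split: split_indicator)
  also have "\<dots> = c * ?m - (\<integral>y. indicator Q y * \<phi> y \<partial>lebesgue)"
    using iQ i\<phi> Q(2) by (subst Bochner_Integration.integral_diff) auto
  finally have uv: "?u \<bullet> ?v = ?m * (c - (\<integral>y. indicator Q y * \<phi> y \<partial>lebesgue) / ?m)"
    using m by (simp add: algebra_simps)
  have u: "(norm ?u)\<^sup>2 = (\<integral>y. indicator Q y * (c - \<phi> y)\<^sup>2 \<partial>lebesgue)"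
    unfolding norm_to_l2_sq[OF s] by (intro Bochner_Integration.integral_cong refl) (auto split: split_indicator)
  have v: "(norm ?v)\<^sup>2 = ?m"
  proof -
    have "(norm ?v)\<^sup>2 = (\<integral>y. indicat_real Q y \<partial>lebesgue)"
      unfolding norm_to_l2_sq[OF sQ] by (intro Bochner_Integration.integral_cong refl) (auto split: split_indicator)
    then show ?thesis using Q(2) by simp
  qed
  have "(?u \<bullet> ?v)\<^sup>2 \<le> (norm ?u)\<^sup>2 * (norm ?v)\<^sup>2"
    using Cauchy_Schwarz_ineq[of ?u ?v] by (simp add: power2_norm_eq_inner)
  then have "?m\<^sup>2 * (c - (\<integral>y. indicator Q y * \<phi> y \<partial>lebesgue) / ?m)\<^sup>2 \<le> (\<integral>y. indicator Q y * (c - \<phi> y)\<^sup>2 \<partial>lebesgue) * ?m"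
    unfolding uv u v by (simp add: power_mult_distrib)
  moreover have "A \<le> I / n" if "n\<^sup>2 * A \<le> I * n" "n > 0" for A I n :: real
  proof -
    have "n * (n * A) \<le> n * I" using that(1) by (simp add: power2_eq_square mult.assoc mult.commute[of n I])
    then have "n * A \<le> I" using that(2) by simp
    then show ?thesis using that(2) by (simp add: pos_le_divide_eq mult.commute)
  qed
  ultimately show "(c - (\<integral>y. indicator Q y * \<phi> y \<partial>lebesgue) / ?m)\<^sup>2 \<le> (\<integral>y. indicator Q y * (c - \<phi> y)\<^sup>2 \<partial>lebesgue) / ?m"
    using m by blast
  have "(norm (indicator Q y * (c - \<phi> y)))\<^sup>2 = indicator Q y * (c - \<phi> y)\<^sup>2" for y by (auto split: split_indicator)
  then show "integrable lebesgue (\<lambda>y. indicator Q y * (c - \<phi> y)\<^sup>2)"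
    using sq_int_integrable[OF s[of c]] by (simp only:)
qed

text \<open>By Jensen the squared deviation from the cell average at \<open>x\<close> is at most the
  mean of \<open>(\<phi> x - \<phi> y)\<^sup>2\<close> over the cell. Writing
  \<open>y = x + h\<close> and letting \<open>h\<close> range over a whole cube makes the domain of
  \<open>h\<close> independent of \<open>x\<close>; after exchanging the integrals,
  \<open>translation_estimate\<close> applies for each \<open>h\<close>. The cube has volume
  \<open>(2 * d) ^ DIM('a)\<close>, which against the cell volume leaves the factor
  \<open>2 ^ DIM('a)\<close>.\<close>

lemma cell_average_estimate:
  fixes \<Omega> :: "'a::euclidean_space set"
  assumes \<phi>: "\<phi> \<in> test_functions \<Omega>" and \<Omega>: "\<And>x. x \<in> \<Omega> \<Longrightarrow> norm x \<le> R"
    and d: "d > 0" and N: "R / d < of_int N"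
  defines "e \<equiv> \<lambda>k. to_l2 (indicat_real (cell d k :: 'a set))"
  defines "J \<equiv> Basis \<rightarrow>\<^sub>E {-N..N}"
  shows "norm (to_l2 \<phi> - (\<Sum>k\<in>J. (to_l2 \<phi> \<bullet> e k / measure lebesgue (cell d k)) *\<^sub>R e k))
    \<le> sqrt (2 ^ DIM('a)) * (real DIM('a) * d) * norm (to_l2 (grad \<phi>))"
proof -
  let ?n = "DIM('a)"
  define m where "m k = measure lebesgue (cell d k :: 'a set)" for k
  define A where "A k = (\<integral>y. indicator (cell d k) y * \<phi> y \<partial>lebesgue) / m k" for k
  define G where "G = norm (to_l2 (grad \<phi>))"
  have m: "d ^ ?n \<le> m k" "0 < m k" for k
    using measure_cell_ge[OF d, of k] d by (auto simp: m_def intro: less_le_trans[of _ "d ^ ?n"])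
  have c: "continuous_on UNIV \<phi>" using \<phi> by (rule test_functions_continuous)
  have \<phi>b[measurable]: "\<phi> \<in> borel_measurable borel" using c by (rule borel_measurable_continuous_onI)
  have cl: "cell d k \<in> sets lebesgue" "bounded (cell d k)" for k :: "'a \<Rightarrow> int"
    using cell_lmeasurable[of d k] bounded_subset[OF bounded_cbox cell_subset_cbox] by (auto simp: fmeasurableD)
  have sc: "sq_int (indicat_real (cell d k))" for k :: "'a \<Rightarrow> int"
    using cell_lmeasurable by (rule sq_int_indicat)
  have Ae: "to_l2 \<phi> \<bullet> e k / m k = A k" for k
    unfolding e_def A_def by (simp add: inner_to_l2 sq_int_test[OF \<phi>] sc mult.commute)
  have fin: "finite J" unfolding J_def by (intro finite_PiE) auto
  define P where "P x = (\<Sum>k\<in>J. A k *\<^sub>R indicat_real (cell d k) x)" for x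
  have Ps': "(\<Sum>k\<in>J. to_l2 (\<lambda>x. A k *\<^sub>R indicat_real (cell d k) x)) = to_l2 P \<and> sq_int P"
    unfolding P_def[abs_def] by (rule sum_to_l2) (rule sq_int_scaleR[OF sc])
  then have Ps: "sq_int P" by simp
  have Pe: "(\<Sum>k\<in>J. A k *\<^sub>R e k) = to_l2 P"
    using Ps' unfolding e_def scaleR_to_l2[OF sc] by simp
  \<comment> \<open>Differences of two points of one cell lie in this cube. Their length is bounded
    through the l1 norm, whence the factor \<open>DIM('a) * d\<close>.\<close>
  define B where "B = cbox (- (d *\<^sub>R One)) (d *\<^sub>R One :: 'a)"
  have B[measurable]: "B \<in> sets borel" by (simp add: B_def)
  have Bmem: "h \<in> B \<longleftrightarrow> (\<forall>i\<in>Basis. \<bar>h \<bullet> i\<bar> \<le> d)" for h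
    unfolding B_def mem_box by (auto simp: abs_le_iff)
  have Bnorm: "norm h \<le> real ?n * d" if "h \<in> B" for h
  proof -
    have "norm h \<le> (\<Sum>i\<in>Basis. \<bar>h \<bullet> i\<bar>)" by (rule norm_le_l1)
    also have "\<dots> \<le> (\<Sum>i\<in>(Basis::'a set). d)" using that Bmem by (intro sum_mono) auto
    finally show ?thesis by simp
  qed
  have emB: "emeasure lborel B = ennreal ((2 * d) ^ ?n)"
  proof -
    have "emeasure lborel B = ennreal (\<Prod>i\<in>(Basis::'a set). (d *\<^sub>R One - - (d *\<^sub>R One)) \<bullet> i)"
      unfolding B_def using d by (intro emeasure_lborel_cbox) simp
    also have "(\<Prod>i\<in>(Basis::'a set). (d *\<^sub>R One - - (d *\<^sub>R One)) \<bullet> i) = (\<Prod>i\<in>(Basis::'a set). 2 * d)"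
      by (intro prod.cong refl) (simp add: inner_add_left)
    finally show ?thesis by simp
  qed
  define F where "F = (\<lambda>(x, h). indicator B h * ennreal ((\<phi> (x + h) - \<phi> x)\<^sup>2))"
  have Fm[measurable]: "F \<in> borel_measurable (lborel \<Otimes>\<^sub>M lborel)"
    unfolding F_def by measurable
  have pw: "ennreal ((\<phi> x - P x)\<^sup>2) \<le> ennreal (1 / d ^ ?n) * (\<integral>\<^sup>+h. F (x, h) \<partial>lborel)" for x
  proof (cases "\<exists>k\<in>J. x \<in> cell d k")
    \<comment> \<open>The listed cells cover \<open>\<Omega>\<close>, so here \<open>x\<close> is
      outside it and both \<open>\<phi>\<close> and \<open>P\<close> vanish.\<close>
    case False
    then have "P x = 0" unfolding P_def by (intro sum.neutral) auto
    moreover have "x \<notin> \<Omega>" using cell_cover[OF d \<Omega> N] False unfolding J_def by blast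
    then have "\<phi> x = 0" using fun_cong[OF zero_ext_test(1)[OF \<phi>], of x] by (simp add: zero_ext_def)
    ultimately show ?thesis by simp
  next
    case True
    then obtain k where k: "k \<in> J" "x \<in> cell d k" by blast
    have uniq: "l = k" if "l \<in> J" "x \<in> cell d l" for l
      using that(1) k(1) unfolding J_def by (rule PiE_ext) (rule cell_unique[OF d that(2) k(2)])
    have "P x = (\<Sum>l\<in>J. if l = k then A k else 0)"
      unfolding P_def
    proof (rule sum.cong[OF refl])
      fix l assume l: "l \<in> J"
      show "A l *\<^sub>R indicat_real (cell d l) x = (if l = k then A k else 0)"
      proof (cases "x \<in> cell d l")
        case True
        then show ?thesis using uniq[OF l] by simp
      next
        case False
        moreover from this k(2) have "l \<noteq> k" by blast
        ultimately show ?thesis by simp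
      qed
    qed
    then have Px: "P x = A k" using k(1) fin by simp
    define I where "I = (\<integral>y. indicator (cell d k) y * (\<phi> x - \<phi> y)\<^sup>2 \<partial>lebesgue)"
    have I0: "I \<ge> 0" unfolding I_def by (intro Bochner_Integration.integral_nonneg) simp
    note J = jensen_average[OF c cl(2) cl(1) m(2)[of k, unfolded m_def], where c = "\<phi> x"]
    have "(\<phi> x - P x)\<^sup>2 \<le> I / m k" using J(1) unfolding Px A_def m_def I_def .
    also have "\<dots> \<le> I / d ^ ?n" using m[of k] I0 d by (intro divide_left_mono) auto
    finally have "ennreal ((\<phi> x - P x)\<^sup>2) \<le> ennreal (1 / d ^ ?n) * ennreal I"
      using I0 d by (subst ennreal_mult[symmetric]) (auto intro: ennreal_leI)
    also have "ennreal I = (\<integral>\<^sup>+y. ennreal (indicator (cell d k) y * (\<phi> x - \<phi> y)\<^sup>2) \<partial>lborel)"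
      unfolding I_def using J(2) by (subst nn_integral_eq_integral[symmetric]) (auto simp: nn_integral_completion)
    also have "\<dots> \<le> (\<integral>\<^sup>+y. F (x, y - x) \<partial>lborel)"
    proof (rule nn_integral_mono)
      fix y
      have "y - x \<in> B" if y: "y \<in> cell d k"
      proof -
        have "\<bar>(y - x) \<bullet> i\<bar> \<le> d" if i: "i \<in> Basis" for i
        proof -
          have "d * of_int (k i) \<le> x \<bullet> i" "x \<bullet> i < d * of_int (k i) + d" "d * of_int (k i) \<le> y \<bullet> i" "y \<bullet> i < d * of_int (k i) + d"
            using y k(2) i by (auto simp: cell_def distrib_left)
          then show ?thesis by (simp add: inner_diff_left abs_le_iff)
        qed
        then show ?thesis by (simp add: Bmem)
      qed
      then show "ennreal (indicator (cell d k) y * (\<phi> x - \<phi> y)\<^sup>2) \<le> F (x, y - x)"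
        by (auto simp: F_def power2_commute split: split_indicator)
    qed
    also have "\<dots> = (\<integral>\<^sup>+y. F (x, y - x) \<partial>distr lborel borel ((+) x))" by (simp add: lborel_distr_plus)
    also have "\<dots> = (\<integral>\<^sup>+h. F (x, h) \<partial>lborel)" by (subst nn_integral_distr) auto
    finally show ?thesis by (simp add: mult_left_mono)
  qed
  have inner: "(\<integral>\<^sup>+x. F (x, h) \<partial>lborel) \<le> indicator B h * ennreal ((real ?n * d * G)\<^sup>2)" for h
  proof (cases "h \<in> B")
    case True
    have cc: "cc_support (\<lambda>x. \<phi> (x + h) - \<phi> x)"
      by (intro cc_support_diff cc_support_translate cc_support_test[OF \<phi>])
    note sq = cc_support_sq_int[OF cc]
    have "(\<integral>\<^sup>+x. F (x, h) \<partial>lborel) = (\<integral>\<^sup>+x. ennreal ((norm (\<phi> (x + h) - \<phi> x))\<^sup>2) \<partial>lebesgue)"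
      using True by (simp add: F_def nn_integral_completion)
    also have "\<dots> = ennreal ((norm (to_l2 (\<lambda>x. \<phi> (x + h) - \<phi> x)))\<^sup>2)"
      unfolding norm_to_l2_sq[OF sq] by (intro nn_integral_eq_integral sq_int_integrable[OF sq]) simp
    also have "\<dots> \<le> ennreal ((real ?n * d * G)\<^sup>2)"
    proof (intro ennreal_leI power_mono)
      have "norm (to_l2 (\<lambda>x. \<phi> (x + h) - \<phi> x)) \<le> norm h * G" unfolding G_def by (rule translation_estimate[OF \<phi>])
      also have "\<dots> \<le> real ?n * d * G" using Bnorm[OF True] by (intro mult_right_mono) (auto simp: G_def)
      finally show "norm (to_l2 (\<lambda>x. \<phi> (x + h) - \<phi> x)) \<le> real ?n * d * G" .
    qed simp
    finally show ?thesis using True by simp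
  qed (simp add: F_def)
  have gs: "sq_int (\<lambda>x. \<phi> x - P x)" by (intro sq_int_diff sq_int_test[OF \<phi>] Ps)
  have "ennreal ((norm (to_l2 (\<lambda>x. \<phi> x - P x)))\<^sup>2) = (\<integral>\<^sup>+x. ennreal ((norm (\<phi> x - P x))\<^sup>2) \<partial>lebesgue)"
    unfolding norm_to_l2_sq[OF gs] by (intro nn_integral_eq_integral[symmetric] sq_int_integrable[OF gs]) simp
  also have "\<dots> = (\<integral>\<^sup>+x. ennreal ((\<phi> x - P x)\<^sup>2) \<partial>lborel)" by (simp add: nn_integral_completion)
  also have "\<dots> \<le> (\<integral>\<^sup>+x. ennreal (1 / d ^ ?n) * (\<integral>\<^sup>+h. F (x, h) \<partial>lborel) \<partial>lborel)" by (intro nn_integral_mono pw)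
  also have "\<dots> = ennreal (1 / d ^ ?n) * (\<integral>\<^sup>+x. (\<integral>\<^sup>+h. F (x, h) \<partial>lborel) \<partial>lborel)" by (intro nn_integral_cmult) measurable
  also have "(\<integral>\<^sup>+x. (\<integral>\<^sup>+h. F (x, h) \<partial>lborel) \<partial>lborel) = (\<integral>\<^sup>+h. (\<integral>\<^sup>+x. F (x, h) \<partial>lborel) \<partial>lborel)"
    using lborel_pair.Fubini'[of "\<lambda>x h. F (x, h)"] Fm by (simp add: case_prod_eta)
  also have "\<dots> \<le> (\<integral>\<^sup>+h. indicator B h * ennreal ((real ?n * d * G)\<^sup>2) \<partial>lborel)" by (intro nn_integral_mono inner)
  also have "\<dots> = ennreal ((2 * d) ^ ?n) * ennreal ((real ?n * d * G)\<^sup>2)"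
    by (simp add: nn_integral_multc emB)
  also have "ennreal (1 / d ^ ?n) * (ennreal ((2 * d) ^ ?n) * ennreal ((real ?n * d * G)\<^sup>2)) = ennreal (2 ^ ?n * (real ?n * d * G)\<^sup>2)"
    using d by (simp add: ennreal_mult[symmetric] power_mult_distrib)
  finally have "ennreal ((norm (to_l2 (\<lambda>x. \<phi> x - P x)))\<^sup>2) \<le> ennreal (2 ^ ?n * (real ?n * d * G)\<^sup>2)"
    by (simp add: mult_left_mono)
  then have "(norm (to_l2 (\<lambda>x. \<phi> x - P x)))\<^sup>2 \<le> 2 ^ ?n * (real ?n * d * G)\<^sup>2" by (subst (asm) ennreal_le_iff) auto
  also have "\<dots> = (sqrt (2 ^ ?n) * (real ?n * d) * G)\<^sup>2" by (simp add: power_mult_distrib)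
  finally have "norm (to_l2 (\<lambda>x. \<phi> x - P x)) \<le> sqrt (2 ^ ?n) * (real ?n * d) * G"
    by (rule power2_le_imp_le) (use d in \<open>auto simp: G_def\<close>)
  moreover have "to_l2 \<phi> - (\<Sum>k\<in>J. (to_l2 \<phi> \<bullet> e k / measure lebesgue (cell d k)) *\<^sub>R e k) = to_l2 (\<lambda>x. \<phi> x - P x)"
    unfolding m_def[symmetric] Ae Pe by (rule minus_to_l2[OF sq_int_test[OF \<phi>] Ps])
  ultimately show ?thesis unfolding G_def by simp
qed

text \<open>Compact nets replace finite ones because the approximants arise as a compact set of
  combinations with bounded coefficients; a finite net of that set then finishes the
  argument.\<close>

lemma compact_closure_if_compact_nets:
  fixes S :: "'v::{real_normed_vector, complete_space} set"
  assumes "\<And>e. e > 0 \<Longrightarrow> \<exists>C. compact C \<and> (\<forall>x\<in>S. \<exists>y\<in>C. dist x y \<le> e)"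
  shows "compact (closure S)"
  unfolding compact_eq_totally_bounded
proof (intro conjI allI impI)
  show "complete (closure S)" by (simp add: complete_eq_closed)
  fix e :: real assume e: "e > 0"
  then obtain C where C: "compact C" "\<forall>x\<in>S. \<exists>y\<in>C. dist x y \<le> e / 4" using assms[of "e/4"] by auto
  obtain k where k: "finite k" "C \<subseteq> (\<Union>x\<in>k. ball x (e/4))"
    using C(1)[unfolded compact_eq_totally_bounded, THEN conjunct2, rule_format, of "e/4"] e by auto
  have "closure S \<subseteq> (\<Union>x\<in>k. ball x e)"
  proof
    fix x assume "x \<in> closure S"
    then obtain s where s: "s \<in> S" "dist s x < e/4" using e unfolding closure_approachable by (meson zero_less_divide_iff zero_less_numeral)
    obtain y where y: "y \<in> C" "dist s y \<le> e/4" using C(2) s(1) by blast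
    obtain z where z: "z \<in> k" "dist z y < e/4" using k(2) y(1) by auto
    have "dist z x \<le> dist z y + dist s y + dist s x" by metric
    then have "dist z x < e" using s y z e by linarith
    then show "x \<in> (\<Union>x\<in>k. ball x e)" using z(1) by auto
  qed
  then show "\<exists>k. finite k \<and> closure S \<subseteq> (\<Union>x\<in>k. ball x e)" using k(1) by blast
qed

text \<open>Averages on a fine grid approximate all the functions uniformly. They lie in the span of
  finitely many indicators, with coefficients bounded by Cauchy-Schwarz.\<close>

lemma rellich_test:
  fixes \<Omega> :: "'a::euclidean_space set"
  assumes "bounded \<Omega>"
  shows "compact (closure {to_l2 \<phi> |\<phi>. \<phi> \<in> test_functions \<Omega> \<and> norm (to_l2 \<phi>) \<le> r \<and> norm (to_l2 (grad \<phi>)) \<le> r})"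
    (is "compact (closure ?S)")
proof (rule compact_closure_if_compact_nets)
  fix \<epsilon> :: real assume \<epsilon>: "\<epsilon> > 0"
  obtain R where R: "\<And>x. x \<in> \<Omega> \<Longrightarrow> norm x \<le> R" using assms unfolding bounded_iff by blast
  \<comment> \<open>With \<open>d = \<epsilon> / c\<close> the error in
    \<open>cell_average_estimate\<close> is at most \<open>\<epsilon>\<close>;
    \<open>\<bar>r\<bar> + 1\<close> keeps \<open>c\<close> positive for every
    \<open>r\<close>.\<close>
  define c where "c = sqrt (2 ^ DIM('a)) * real DIM('a) * (\<bar>r\<bar> + 1)"
  have c: "c > 0" unfolding c_def by (intro mult_pos_pos) auto
  define d where "d = \<epsilon> / c"
  have d: "d > 0" using c \<epsilon> by (simp add: d_def)
  obtain N :: int where N: "R / d < of_int N" using ex_less_of_int by blast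
  define J where "J = (Basis :: 'a set) \<rightarrow>\<^sub>E {-N..N}"
  have J: "finite J" unfolding J_def by (intro finite_PiE) auto
  define m where "m k = measure lebesgue (cell d k :: 'a set)" for k
  have m: "0 < m k" for k
    using measure_cell_ge[OF d, of k] d by (auto simp: m_def intro: less_le_trans[of _ "d ^ DIM('a)"])
  define e where "e k = to_l2 (indicat_real (cell d k :: 'a set))" for k
  \<comment> \<open>A sum instead of a maximum of the coefficient bounds, so that one
    \<open>M\<close> dominates each of them.\<close>
  define M where "M = (\<Sum>k\<in>J. \<bar>r\<bar> * norm (e k) / m k)"
  define C where "C = {(\<Sum>k\<in>J. a k *\<^sub>R e k) |a. \<forall>k\<in>J. \<bar>a k\<bar> \<le> M}"
  have "compact C" unfolding C_def by (rule compact_box_combinations[OF J])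
  moreover have "\<exists>y\<in>C. dist x y \<le> \<epsilon>" if "x \<in> ?S" for x
  proof -
    obtain \<phi> where x: "x = to_l2 \<phi>" and \<phi>: "\<phi> \<in> test_functions \<Omega>" and nr: "norm (to_l2 \<phi>) \<le> r" "norm (to_l2 (grad \<phi>)) \<le> r"
      using \<open>x \<in> ?S\<close> by blast
    define a where "a k = to_l2 \<phi> \<bullet> e k / m k" for k
    have "\<bar>a k\<bar> \<le> M" if k: "k \<in> J" for k
    proof -
      have "\<bar>to_l2 \<phi> \<bullet> e k\<bar> \<le> norm (to_l2 \<phi>) * norm (e k)" by (rule Cauchy_Schwarz_ineq2)
      also have "\<dots> \<le> \<bar>r\<bar> * norm (e k)" using nr(1) by (intro mult_right_mono) auto
      finally have "\<bar>a k\<bar> \<le> \<bar>r\<bar> * norm (e k) / m k"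
        using m[of k] by (simp add: a_def abs_divide divide_right_mono)
      also have "\<dots> \<le> M" unfolding M_def using k J m by (intro member_le_sum) (auto intro!: divide_nonneg_pos)
      finally show ?thesis .
    qed
    then have "(\<Sum>k\<in>J. a k *\<^sub>R e k) \<in> C" unfolding C_def by blast
    moreover have "dist x (\<Sum>k\<in>J. a k *\<^sub>R e k) \<le> \<epsilon>"
    proof -
      have "dist x (\<Sum>k\<in>J. a k *\<^sub>R e k) \<le> sqrt (2 ^ DIM('a)) * (real DIM('a) * d) * norm (to_l2 (grad \<phi>))"
        using cell_average_estimate[OF \<phi> R d N] unfolding dist_norm x a_def e_def m_def J_def .
      also have "\<dots> \<le> sqrt (2 ^ DIM('a)) * (real DIM('a) * d) * (\<bar>r\<bar> + 1)"
        using nr(2) d by (intro mult_left_mono) auto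
      also have "\<dots> = d * c" by (simp add: c_def ac_simps)
      also have "\<dots> = \<epsilon>" using c by (simp add: d_def)
      finally show ?thesis .
    qed
    ultimately show ?thesis by blast
  qed
  ultimately show "\<exists>C. compact C \<and> (\<forall>x\<in>?S. \<exists>y\<in>C. dist x y \<le> \<epsilon>)" by blast
qed

theorem rellich:
  fixes \<Omega> :: "'a::euclidean_space set"
  assumes \<Omega>: "open \<Omega>" "bounded \<Omega>"
  shows "\<exists>K. compact K \<and> fst ` {z \<in> sobolev_pair \<Omega> ` H10 \<Omega>. norm z \<le> r} \<subseteq> K"
proof (intro exI conjI)
  \<comment> \<open>An element of norm at most \<open>r\<close> is approximated by test functions
    within distance 1, which accounts for \<open>r + 1\<close>.\<close>
  let ?S = "{to_l2 \<phi> |\<phi>. \<phi> \<in> test_functions \<Omega> \<and> norm (to_l2 \<phi>) \<le> r + 1 \<and> norm (to_l2 (grad \<phi>)) \<le> r + 1}"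
  show "compact (closure ?S)" by (rule rellich_test[OF \<Omega>(2)])
  show "fst ` {z \<in> sobolev_pair \<Omega> ` H10 \<Omega>. norm z \<le> r} \<subseteq> closure ?S"
  proof
    fix y assume "y \<in> fst ` {z \<in> sobolev_pair \<Omega> ` H10 \<Omega>. norm z \<le> r}"
    then obtain z where z: "y = fst z" "z \<in> sobolev_pair \<Omega> ` H10 \<Omega>" "norm z \<le> r" by blast
    then have zc: "z \<in> closure (sobolev_pair \<Omega> ` test_functions \<Omega>)" using sobolev_pair_H10_eq[OF \<Omega>(1)] by blast
    show "y \<in> closure ?S"
      unfolding closure_approachable
    proof (intro allI impI)
      fix \<epsilon> :: real assume \<epsilon>: "\<epsilon> > 0"
      then obtain \<phi> where \<phi>: "\<phi> \<in> test_functions \<Omega>" "dist (sobolev_pair \<Omega> \<phi>) z < min \<epsilon> 1"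
        using zc[unfolded closure_approachable, rule_format, of "min \<epsilon> 1"] by auto
      have p: "sobolev_pair \<Omega> \<phi> = (to_l2 \<phi>, to_l2 (grad \<phi>))" by (rule sobolev_pair_test(2)[OF \<Omega>(1) \<phi>(1)])
      have "norm (sobolev_pair \<Omega> \<phi>) \<le> norm z + dist (sobolev_pair \<Omega> \<phi>) z"
        unfolding dist_norm using norm_triangle_sub by (simp add: norm_triangle_sub)
      then have "norm (sobolev_pair \<Omega> \<phi>) \<le> r + 1" using z(3) \<phi>(2) by linarith
      then have "norm (to_l2 \<phi>) \<le> r + 1" "norm (to_l2 (grad \<phi>)) \<le> r + 1"
        using norm_fst_le[of "to_l2 \<phi>" "to_l2 (grad \<phi>)"] norm_snd_le[of "to_l2 (grad \<phi>)" "to_l2 \<phi>"]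
        unfolding p by linarith+
      then have "to_l2 \<phi> \<in> ?S" using \<phi>(1) by blast
      moreover have "dist (to_l2 \<phi>) y < \<epsilon>"
        using dist_fst_le[of "sobolev_pair \<Omega> \<phi>" z] \<phi>(2) unfolding p z(1) by simp
      ultimately show "\<exists>s\<in>?S. dist s y < \<epsilon>" by blast
    qed
  qed
qed

text \<open>The inequality is a closed condition on pairs, so it passes from test functions to the
  closure of their image.\<close>

theorem poincare:
  fixes \<Omega> :: "'a::euclidean_space set"
  assumes \<Omega>: "open \<Omega>" "bounded \<Omega>"
  obtains C where "C > 0" "\<And>z. z \<in> sobolev_pair \<Omega> ` H10 \<Omega> \<Longrightarrow> norm (fst z) \<le> C * norm (snd z)"
proof -
  obtain C where C: "C > 0" "\<And>\<phi>. \<phi> \<in> test_functions \<Omega> \<Longrightarrow> norm (to_l2 \<phi>) \<le> C * norm (to_l2 (grad \<phi>))"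
    using poincare_test[OF \<Omega>(2)] by blast
  have cl: "closed {z :: ('a, real) l2 \<times> ('a, 'a) l2. norm (fst z) \<le> C * norm (snd z)}"
    by (intro closed_Collect_le continuous_intros)
  have "closure (sobolev_pair \<Omega> ` test_functions \<Omega>) \<subseteq> {z. norm (fst z) \<le> C * norm (snd z)}"
  proof (rule closure_minimal[OF _ cl], rule subsetI)
    fix z assume "z \<in> sobolev_pair \<Omega> ` test_functions \<Omega>"
    then obtain \<phi> where "\<phi> \<in> test_functions \<Omega>" "z = sobolev_pair \<Omega> \<phi>" by blast
    then show "z \<in> {z. norm (fst z) \<le> C * norm (snd z)}" using C(2) by (simp add: sobolev_pair_test(2)[OF \<Omega>(1)])
  qed
  then have "norm (fst z) \<le> C * norm (snd z)" if "z \<in> sobolev_pair \<Omega> ` H10 \<Omega>" for z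
    using that unfolding sobolev_pair_H10_eq[OF \<Omega>(1)] by blast
  with C(1) show thesis using that by blast
qed

section \<open>The residual-free bubble space as a closed subspace\<close>

lemma subspace_sobolev_pair_image:
  assumes \<Omega>: "open \<Omega>" and V: "V \<subseteq> H1 \<Omega>" and z: "(\<lambda>_. 0) \<in> V"
    and add: "\<And>u v. u \<in> V \<Longrightarrow> v \<in> V \<Longrightarrow> (\<lambda>x. u x + v x) \<in> V"
    and sc: "\<And>c u. u \<in> V \<Longrightarrow> (\<lambda>x. c * u x) \<in> V"
  shows "subspace (sobolev_pair \<Omega> ` V)"
proof (rule subspaceI)
  have "(\<lambda>_. 0) \<in> H1 \<Omega>" using V z by blast
  from sobolev_pair_scale(2)[OF \<Omega> this, of 0] have "sobolev_pair \<Omega> (\<lambda>_. 0) = 0" by simp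
  then show "0 \<in> sobolev_pair \<Omega> ` V" using z by (metis image_eqI)
next
  fix x y assume "x \<in> sobolev_pair \<Omega> ` V" "y \<in> sobolev_pair \<Omega> ` V"
  then obtain u v where uv: "u \<in> V" "v \<in> V" "x = sobolev_pair \<Omega> u" "y = sobolev_pair \<Omega> v" by blast
  then have "u \<in> H1 \<Omega>" "v \<in> H1 \<Omega>" using V by blast+
  from sobolev_pair_add(2)[OF \<Omega> this] have "x + y = sobolev_pair \<Omega> (\<lambda>x. u x + v x)" using uv by simp
  then show "x + y \<in> sobolev_pair \<Omega> ` V" using add[OF uv(1,2)] by (rule image_eqI)
next
  fix c x assume "x \<in> sobolev_pair \<Omega> ` V"
  then obtain u where u: "u \<in> V" "x = sobolev_pair \<Omega> u" by blast
  then have "u \<in> H1 \<Omega>" using V by blast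
  from sobolev_pair_scale(2)[OF \<Omega> this, of c] have "c *\<^sub>R x = sobolev_pair \<Omega> (\<lambda>x. c * u x)" using u by simp
  then show "c *\<^sub>R x \<in> sobolev_pair \<Omega> ` V" using sc[OF u(1)] by (rule image_eqI)
qed

text \<open>The finite spanning set in \<open>finite_element_space_def\<close> need not lie in
  \<open>V\<close>, and \<open>sobolev_pair\<close> is meaningful only on \<open>H1\<close>. A
  maximal independent subset of \<open>V\<close> replaces it, finite by the exchange
  argument.\<close>

lemma sobolev_pair_finite_element_span:
  fixes \<Omega> :: "(real^2) set"
  assumes \<Omega>: "open \<Omega>" and V: "finite_element_space \<Omega> \<T> V"
  obtains F where "finite F" "sobolev_pair \<Omega> ` V = span F"
proof -
  have VH: "V \<subseteq> H1 \<Omega>" and sub: "fun_space.subspace V" and "\<exists>B. finite B \<and> V \<subseteq> fun_space.span B"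
    using V unfolding finite_element_space_def H10_def by blast+
  then obtain B where B: "finite B" "V \<subseteq> fun_space.span B" by blast
  obtain B' where B': "B' \<subseteq> V" "fun_space.independent B'" "V \<subseteq> fun_space.span B'"
    using fun_space.maximal_independent_subset[of V] by blast
  have "B' \<subseteq> fun_space.span B" using B'(1) B(2) by (rule order_trans)
  then have fin: "finite B'" using fun_space.independent_span_bound[OF B(1) B'(2)] by blast
  have add: "(\<lambda>x. u x + v x) \<in> V" if "u \<in> V" "v \<in> V" for u v
    using fun_space.subspace_add[OF sub that] by (simp add: plus_fun_def)
  have sc: "(\<lambda>x. c * u x) \<in> V" if "u \<in> V" for c u using fun_space.subspace_scale[OF sub that, of c] .
  have z: "(\<lambda>_. 0) \<in> V" using fun_space.subspace_0[OF sub] by (simp add: zero_fun_def)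
  let ?F = "sobolev_pair \<Omega> ` B'"
  have "sobolev_pair \<Omega> ` V \<subseteq> span ?F"
  proof -
    \<comment> \<open>Linearity of \<open>sobolev_pair\<close> is available on
      \<open>H1 \<Omega>\<close> only, so the span is captured inside this subspace of
      \<open>V\<close>.\<close>
    let ?W = "{v \<in> V. sobolev_pair \<Omega> v \<in> span ?F}"
    have "fun_space.subspace ?W"
    proof (rule fun_space.subspaceI)
      have "sobolev_pair \<Omega> (\<lambda>x. 0 * 0) = 0 *\<^sub>R sobolev_pair \<Omega> (\<lambda>_. 0)"
        using VH z by (intro sobolev_pair_scale(2)[OF \<Omega>]) blast
      then show "0 \<in> ?W" using z by (simp add: zero_fun_def span_zero)
    next
      fix u v assume uv: "u \<in> ?W" "v \<in> ?W"
      then have "u \<in> H1 \<Omega>" "v \<in> H1 \<Omega>" using VH by blast+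
      from sobolev_pair_add(2)[OF \<Omega> this] show "u + v \<in> ?W"
        using uv add by (simp add: plus_fun_def span_add)
    next
      fix c u assume u: "u \<in> ?W"
      then have "u \<in> H1 \<Omega>" using VH by blast
      from sobolev_pair_scale(2)[OF \<Omega> this, of c] show "(\<lambda>x. c * u x) \<in> ?W"
        using u sc by (simp add: span_scale)
    qed
    moreover have "B' \<subseteq> ?W" using B'(1) by (auto intro: span_base)
    ultimately have "fun_space.span B' \<subseteq> ?W" by (intro fun_space.span_minimal)
    then show ?thesis using B'(3) by blast
  qed
  moreover have "span ?F \<subseteq> sobolev_pair \<Omega> ` V"
    using B'(1) by (intro span_minimal image_mono subspace_sobolev_pair_image[OF \<Omega> VH z add sc])
  ultimately show thesis using that[of ?F] fin by blast
qed

text \<open>In the graph space the sum is the closed bubble image plus a finite-dimensional span,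
  the situation of \<open>closed_subspace_plus_span\<close>.\<close>

lemma closed_subspace_residual_free_bubble:
  fixes \<Omega> :: "(real^2) set"
  assumes \<Omega>: "open \<Omega>" and \<T>: "\<And>K. K \<in> \<T> \<Longrightarrow> open K \<and> K \<subseteq> \<Omega>"
    and Vh: "finite_element_space \<Omega> \<T> Vh"
  shows "closed (sobolev_pair \<Omega> ` (Vh + bubble_space \<Omega> \<T>))" "subspace (sobolev_pair \<Omega> ` (Vh + bubble_space \<Omega> \<T>))"
    "Vh + bubble_space \<Omega> \<T> \<subseteq> H10 \<Omega>"
proof -
  let ?Vb = "bubble_space \<Omega> \<T>"
  have VhH: "Vh \<subseteq> H10 \<Omega>" using Vh by (simp add: finite_element_space_def)
  have VbH: "?Vb \<subseteq> H10 \<Omega>" by (auto simp: bubble_space_def)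
  have HH: "H10 \<Omega> \<subseteq> H1 \<Omega>" by (auto simp: H10_def)
  obtain F where F: "finite F" "sobolev_pair \<Omega> ` Vh = span F"
    by (rule sobolev_pair_finite_element_span[OF \<Omega> Vh])
  have z: "(\<lambda>_. 0) \<in> ?Vb" using \<Omega> \<T> zero_H10 by (auto simp: bubble_space_def)
  have Vb: "subspace (sobolev_pair \<Omega> ` ?Vb)" "closed (sobolev_pair \<Omega> ` ?Vb)"
  proof -
    show "subspace (sobolev_pair \<Omega> ` ?Vb)"
      using VbH HH by (intro subspace_sobolev_pair_image[OF \<Omega> _ z] bubble_space_add[OF \<Omega> \<T>] bubble_space_scale[OF \<Omega> \<T>]) auto
    show "closed (sobolev_pair \<Omega> ` ?Vb)" by (rule closed_sobolev_pair_bubble[OF \<Omega> \<T>])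
  qed
  have eq: "sobolev_pair \<Omega> ` (Vh + ?Vb) = {s + t |s t. s \<in> sobolev_pair \<Omega> ` ?Vb \<and> t \<in> span F}"
  proof -
    have add: "sobolev_pair \<Omega> (u + v) = sobolev_pair \<Omega> v + sobolev_pair \<Omega> u" if "u \<in> Vh" "v \<in> ?Vb" for u v
    proof -
      have "u \<in> H1 \<Omega>" "v \<in> H1 \<Omega>" using that VhH VbH HH by blast+
      from sobolev_pair_add(2)[OF \<Omega> this] show ?thesis by (simp add: plus_fun_def add.commute)
    qed
    show ?thesis
    proof (intro equalityI subsetI)
      fix y assume "y \<in> sobolev_pair \<Omega> ` (Vh + ?Vb)"
      then obtain u v where "u \<in> Vh" "v \<in> ?Vb" "y = sobolev_pair \<Omega> (u + v)" by (auto simp: set_plus_def)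
      then show "y \<in> {s + t |s t. s \<in> sobolev_pair \<Omega> ` ?Vb \<and> t \<in> span F}" unfolding F(2)[symmetric] using add by blast
    next
      fix y assume "y \<in> {s + t |s t. s \<in> sobolev_pair \<Omega> ` ?Vb \<and> t \<in> span F}"
      then obtain u v where uv: "u \<in> Vh" "v \<in> ?Vb" "y = sobolev_pair \<Omega> v + sobolev_pair \<Omega> u"
        unfolding F(2)[symmetric] by blast
      then have "y = sobolev_pair \<Omega> (u + v)" using add by simp
      then show "y \<in> sobolev_pair \<Omega> ` (Vh + ?Vb)" using set_plus_intro[OF uv(1,2)] by (rule image_eqI)
    qed
  qed
  show "closed (sobolev_pair \<Omega> ` (Vh + ?Vb))" unfolding eq by (rule closed_subspace_plus_span[OF F(1) Vb])
  show "subspace (sobolev_pair \<Omega> ` (Vh + ?Vb))" unfolding eq by (rule subspace_sums[OF Vb(1) subspace_span])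
  show "Vh + ?Vb \<subseteq> H10 \<Omega>"
  proof
    fix y assume "y \<in> Vh + ?Vb"
    then obtain u v where "u \<in> Vh" "v \<in> ?Vb" "y = u + v" by (auto simp: set_plus_def)
    then show "y \<in> H10 \<Omega>" using H10_add[OF \<Omega>, of u v] VhH VbH by (auto simp: plus_fun_def)
  qed
qed

section \<open>The quasilinear form\<close>

text \<open>The set where the essential bound fails is open and null, hence empty. The bound must
  hold everywhere, since \<open>b\<close> is composed with functions whose values may stay in a null
  set.\<close>

lemma continuous_Linf_bounded:
  fixes b :: "'a::euclidean_space \<Rightarrow> real"
  assumes c: "continuous_on UNIV b" and b: "b \<in> Linf UNIV"
  obtains C where "\<And>t. \<bar>b t\<bar> \<le> C"
proof -
  obtain C where C: "AE t in lebesgue. \<bar>b t\<bar> \<le> C" using b by (auto simp: Linf_def)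
  have "open {t. C < \<bar>b t\<bar>}" by (intro open_Collect_less continuous_intros c)
  moreover have "negligible {t. C < \<bar>b t\<bar>}"
  proof -
    obtain N where N: "{t \<in> space lebesgue. \<not> \<bar>b t\<bar> \<le> C} \<subseteq> N" "emeasure lebesgue N = 0" "N \<in> sets lebesgue"
      using C by (rule AE_E)
    then have "negligible N" by (auto simp: negligible_iff_null_sets null_sets_def)
    then show ?thesis by (rule negligible_subset) (use N(1) in auto)
  qed
  ultimately have "{t. C < \<bar>b t\<bar>} = {}" using open_not_negligible by blast
  then show thesis using that[of C] by (auto simp: not_less)
qed

text \<open>Almost everywhere convergence of the coefficients is enough because \<open>g\<close> is
  fixed: a multiple of its square is the integrable majorant.\<close>

lemma mult_l2_composition_tendsto:
  fixes g :: "('a::euclidean_space, 'b::euclidean_space) l2"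
  assumes a: "a \<in> borel_measurable lebesgue" "AE x in lebesgue. \<bar>a x\<bar> \<le> A"
    and b: "continuous_on UNIV b" "\<And>t. \<bar>b t\<bar> \<le> \<beta>" and w: "w' \<longlonglongrightarrow> w"
  shows "(\<lambda>n. mult_l2 (\<lambda>x. a x * b (rep_l2 (w' n) x)) g) \<longlonglongrightarrow> mult_l2 (\<lambda>x. a x * b (rep_l2 w x :: real)) g"
proof -
  define \<kappa> where "\<kappa> w x = a x * b (rep_l2 w x)" for w x
  have bm: "b \<in> borel_measurable borel" using b(1) by (rule borel_measurable_continuous_onI)
  have \<kappa>m: "\<kappa> w \<in> borel_measurable lebesgue" for w
    unfolding \<kappa>_def[abs_def]
    by (intro borel_measurable_times a(1) measurable_compose[OF sq_int_measurable[OF sq_int_rep_l2] bm])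
  \<comment> \<open>The quantifier over \<open>w\<close> stands inside: the exceptional null set is
    that of \<open>a\<close> alone.\<close>
  have \<kappa>b: "AE x in lebesgue. \<forall>w. \<bar>\<kappa> w x\<bar> \<le> A * \<beta>"
    using a(2)
  proof eventually_elim
    case (elim x)
    then show ?case unfolding \<kappa>_def abs_mult using b(2) by (intro allI mult_mono) auto
  qed
  have \<kappa>b': "AE x in lebesgue. \<bar>\<kappa> w x\<bar> \<le> A * \<beta>" for w using \<kappa>b by eventually_elim blast
  let ?T = "\<lambda>w. mult_l2 (\<kappa> w) g"
  let ?d = "\<lambda>v x. (norm ((\<kappa> v x - \<kappa> w x) *\<^sub>R rep_l2 g x))\<^sup>2"
  have sq: "sq_int (\<lambda>x. \<kappa> v x *\<^sub>R rep_l2 g x)" for v by (rule sq_int_mult[OF sq_int_rep_l2 \<kappa>m \<kappa>b'])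
  have dist: "(dist (?T v) (?T w))\<^sup>2 = (\<integral>x. ?d v x \<partial>lebesgue)" for v
    unfolding dist_norm mult_l2_def minus_to_l2[OF sq sq] norm_to_l2_sq[OF sq_int_diff[OF sq sq]]
    by (simp add: scaleR_diff_left)
  have sub: "(\<lambda>n. dist (?T (v n)) (?T w)) \<longlonglongrightarrow> 0"
    if v: "AE x in lebesgue. (\<lambda>n. rep_l2 (v n) x) \<longlonglongrightarrow> rep_l2 w x" for v :: "nat \<Rightarrow> ('a, real) l2"
  proof -
    have "(\<lambda>n. \<integral>x. ?d (v n) x \<partial>lebesgue) \<longlonglongrightarrow> (\<integral>x. 0 \<partial>(lebesgue :: 'a measure))"
    proof (rule integral_dominated_convergence)
      have "sq_int (\<lambda>x. (\<kappa> v x - \<kappa> w x) *\<^sub>R rep_l2 g x)" for v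
        using sq_int_diff[OF sq sq, of v w] by (simp add: scaleR_diff_left)
      then show "?d (v n) \<in> borel_measurable lebesgue" for n
        by (intro borel_measurable_integrable sq_int_integrable)
      show "integrable lebesgue (\<lambda>x. (2 * (A * \<beta>))\<^sup>2 * (norm (rep_l2 g x))\<^sup>2)"
        using sq_int_integrable[OF sq_int_rep_l2[of g]] by simp
      show "AE x in lebesgue. (\<lambda>n. ?d (v n) x) \<longlonglongrightarrow> 0"
        using v
      proof eventually_elim
        case (elim x)
        have "(\<lambda>n. b (rep_l2 (v n) x)) \<longlonglongrightarrow> b (rep_l2 w x)"
          using b(1) elim by (intro continuous_on_tendsto_compose[OF b(1)]) auto
        then have "(\<lambda>n. ?d (v n) x) \<longlonglongrightarrow> (norm ((\<kappa> w x - \<kappa> w x) *\<^sub>R rep_l2 g x))\<^sup>2"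
          unfolding \<kappa>_def by (intro tendsto_intros)
        then show ?case by simp
      qed
      show "AE x in lebesgue. norm (?d (v n) x) \<le> (2 * (A * \<beta>))\<^sup>2 * (norm (rep_l2 g x))\<^sup>2" for n
        using \<kappa>b
      proof eventually_elim
        case (elim x)
        have "\<bar>\<kappa> (v n) x - \<kappa> w x\<bar> \<le> 2 * (A * \<beta>)" using elim[rule_format, of "v n"] elim[rule_format, of w] by linarith
        then have "\<bar>\<kappa> (v n) x - \<kappa> w x\<bar>\<^sup>2 \<le> (2 * (A * \<beta>))\<^sup>2" by (intro power_mono) auto
        then show ?case by (simp add: power_mult_distrib mult_right_mono)
      qed
    qed simp
    then have "(\<lambda>n. (dist (?T (v n)) (?T w))\<^sup>2) \<longlonglongrightarrow> 0" by (simp add: dist)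
    then have "(\<lambda>n. sqrt ((dist (?T (v n)) (?T w))\<^sup>2)) \<longlonglongrightarrow> sqrt 0" by (rule tendsto_real_sqrt)
    then show ?thesis by simp
  qed
  have "(\<lambda>n. ?T (w' n)) \<longlonglongrightarrow> ?T w"
  proof (rule ccontr)
    \<comment> \<open>A subsequence staying at distance \<open>e\<close> would have a further
      subsequence converging almost everywhere, contradicting \<open>sub\<close>.\<close>
    assume "\<not> ?thesis"
    then obtain e where e: "e > 0" "\<not> eventually (\<lambda>n. dist (?T (w' n)) (?T w) < e) sequentially"
      unfolding tendsto_iff by blast
    obtain r :: "nat \<Rightarrow> nat" where r: "strict_mono r" "\<forall>n. \<not> dist (?T (w' (r n))) (?T w) < e"
      using not_eventually_sequentiallyD[OF e(2)] by blast
    have "(\<lambda>n. w' (r n)) \<longlonglongrightarrow> w" using LIMSEQ_subseq_LIMSEQ[OF w r(1)] by (simp add: o_def)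
    then obtain s :: "nat \<Rightarrow> nat" where s: "strict_mono s" "AE x in lebesgue. (\<lambda>n. rep_l2 (w' (r (s n))) x) \<longlonglongrightarrow> rep_l2 w x"
      by (rule l2_tendsto_AE_subseq) iprover
    from order_tendstoD(2)[OF sub[OF s(2)] e(1)] obtain n where "dist (?T (w' (r (s n)))) (?T w) < e"
      by (auto simp: eventually_sequentially)
    then show False using r(2) by blast
  qed
  then show ?thesis by (simp only: \<kappa>_def[abs_def])
qed

text \<open>\<open>quasilinear_existence\<close> is applied in the graph space: the form acts on the
  gradient components, the load on the function components, and the projection \<open>fst\<close>
  provides the compact map.\<close>

theorem quasilinear_sobolev_existence:
  fixes \<Omega> :: "'a::euclidean_space set" and b :: "real \<Rightarrow> real"
  assumes \<Omega>: "open \<Omega>" "bounded \<Omega>"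
    and \<alpha>: "set_borel_measurable lebesgue \<Omega> \<alpha>" "0 < \<alpha>0" "AE x in lebesgue. x \<in> \<Omega> \<longrightarrow> \<alpha>0 \<le> \<alpha> x \<and> \<alpha> x \<le> \<alpha>1"
    and b: "continuous_on UNIV b" "0 < b0" "\<And>t. b0 \<le> b t" "\<And>t. \<bar>b t\<bar> \<le> \<beta>"
    and f: "f \<in> L2 \<Omega>"
    and V: "V \<subseteq> H10 \<Omega>" "closed (sobolev_pair \<Omega> ` V)" "subspace (sobolev_pair \<Omega> ` V)"
  shows "\<exists>u\<in>V. \<forall>v\<in>V.
    (LINT x:\<Omega>|lebesgue. \<alpha> x * b (u x) * (weak_gradient \<Omega> u x \<bullet> weak_gradient \<Omega> v x)) = (LINT x:\<Omega>|lebesgue. f x * v x)"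
proof -
  let ?M = "sobolev_pair \<Omega> ` V"
  \<comment> \<open>Integrals in \<open>l2\<close> run over the whole space. Extension by
    \<open>\<alpha>0\<close> keeps the lower bound everywhere, while the zero-extended gradients
    remove the added part from the final integral.\<close>
  define a where "a x = indicator \<Omega> x *\<^sub>R \<alpha> x + indicator (- \<Omega>) x *\<^sub>R \<alpha>0" for x
  have \<Omega>s: "\<Omega> \<in> sets lebesgue" by (rule open_sets_lebesgue[OF \<Omega>(1)])
  have a_meas: "a \<in> borel_measurable lebesgue"
  proof -
    have "(\<lambda>x. indicat_real (- \<Omega>) x *\<^sub>R \<alpha>0) \<in> borel_measurable lebesgue"
      by (intro borel_measurable_scaleR borel_measurable_indicator borel_measurable_const)
        (use sets.compl_sets[OF \<Omega>s] in \<open>simp add: Compl_eq_Diff_UNIV\<close>)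
    then show ?thesis unfolding a_def[abs_def]
      using \<alpha>(1) unfolding set_borel_measurable_def by (intro borel_measurable_add)
  qed
  define A where "A = \<bar>\<alpha>0\<bar> + \<bar>\<alpha>1\<bar>"
  have a_bd: "AE x in lebesgue. \<alpha>0 \<le> a x \<and> \<bar>a x\<bar> \<le> A"
    using \<alpha>(3)
  proof eventually_elim
    case (elim x)
    then show ?case using \<alpha>(2) by (cases "x \<in> \<Omega>") (auto simp: a_def A_def)
  qed
  have a_A: "AE x in lebesgue. \<bar>a x\<bar> \<le> A" using a_bd by eventually_elim simp
  define \<kappa> where "\<kappa> w x = a x * b (rep_l2 w x)" for w :: "('a, real) l2" and x
  have bm: "b \<in> borel_measurable borel" using b(1) by (rule borel_measurable_continuous_onI)
  have \<kappa>m: "\<kappa> w \<in> borel_measurable lebesgue" for w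
    unfolding \<kappa>_def[abs_def]
    by (intro borel_measurable_times a_meas measurable_compose[OF sq_int_measurable[OF sq_int_rep_l2] bm])
  have \<kappa>bd: "AE x in lebesgue. \<alpha>0 * b0 \<le> \<kappa> w x \<and> \<bar>\<kappa> w x\<bar> \<le> A * \<beta>" for w
    using a_bd
  proof eventually_elim
    case (elim x)
    have "\<bar>\<kappa> w x\<bar> \<le> A * \<beta>" unfolding \<kappa>_def abs_mult using elim b(4) by (intro mult_mono) auto
    moreover have "\<alpha>0 * b0 \<le> \<kappa> w x" unfolding \<kappa>_def using elim b(2) b(3) \<alpha>(2) by (intro mult_mono) auto
    ultimately show ?case by simp
  qed
  have \<kappa>b: "AE x in lebesgue. \<bar>\<kappa> w x\<bar> \<le> A * \<beta>" for w using \<kappa>bd[of w] by eventually_elim simp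
  define B where "B w z z' = mult_l2 (\<kappa> w) (snd z) \<bullet> snd z'" for w and z z' :: "('a, real) l2 \<times> ('a, 'a) l2"
  define l where "l z = to_l2 (zero_ext \<Omega> f) \<bullet> fst z" for z :: "('a, real) l2 \<times> ('a, 'a) l2"
  have fs: "sq_int (zero_ext \<Omega> f)" using f by (simp add: L2_iff_sq_int)
  obtain C where C: "C > 0" "\<And>z. z \<in> sobolev_pair \<Omega> ` H10 \<Omega> \<Longrightarrow> norm (fst z) \<le> C * norm (snd z)"
    using poincare[OF \<Omega>] by blast
  have MH: "?M \<subseteq> sobolev_pair \<Omega> ` H10 \<Omega>" using V(1) by (rule image_mono)
  obtain z where z: "z \<in> ?M" "\<forall>v\<in>?M. B (fst z) z v = l v"
  \<comment> \<open>The coefficient is at least \<open>\<alpha>0 * b0\<close>; the Poincare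
    inequality bounds the squared pair norm by \<open>C\<^sup>2 + 1\<close> times the squared
    gradient norm.\<close>
  proof (rule quasilinear_existence[of ?M B "\<alpha>0 * b0 / (C\<^sup>2 + 1)" l fst])
    show "bounded_bilinear (B w)" for w
      unfolding B_def[abs_def]
      by (rule bounded_bilinear.comp[OF bounded_bilinear_inner
            bounded_linear_compose[OF bounded_linear_mult_l2[OF \<kappa>m \<kappa>b] bounded_linear_snd] bounded_linear_snd])
    show "B w u v = B w v u" for w u v
      unfolding B_def inner_mult_l2[OF \<kappa>m \<kappa>b] by (simp add: inner_commute)
    have "C\<^sup>2 + 1 > 0" by (simp add: add_nonneg_pos)
    then show "\<alpha>0 * b0 / (C\<^sup>2 + 1) > 0" using \<alpha>(2) b(2) by simp
    show "\<alpha>0 * b0 / (C\<^sup>2 + 1) * (norm v)\<^sup>2 \<le> B w v v" if v: "v \<in> ?M" for w v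
    proof -
      have "norm (fst v) \<le> C * norm (snd v)" using C(2) v MH by blast
      then have "(norm (fst v))\<^sup>2 \<le> (C * norm (snd v))\<^sup>2" by (intro power_mono) auto
      then have "(norm v)\<^sup>2 \<le> (C\<^sup>2 + 1) * (norm (snd v))\<^sup>2"
        by (simp add: norm_prod_def power_mult_distrib distrib_right)
      then have "\<alpha>0 * b0 / (C\<^sup>2 + 1) * (norm v)\<^sup>2 \<le> \<alpha>0 * b0 / (C\<^sup>2 + 1) * ((C\<^sup>2 + 1) * (norm (snd v))\<^sup>2)"
        using \<open>\<alpha>0 * b0 / (C\<^sup>2 + 1) > 0\<close> by (intro mult_left_mono) auto
      also have "\<dots> = \<alpha>0 * b0 * (norm (snd v))\<^sup>2" using \<open>C\<^sup>2 + 1 > 0\<close> by simp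
      also have "\<dots> = (\<integral>x. \<alpha>0 * b0 * (norm (rep_l2 (snd v) x))\<^sup>2 \<partial>lebesgue)"
        using norm_to_l2_sq[OF sq_int_rep_l2[of "snd v"]] by simp
      also have "\<dots> \<le> (\<integral>x. \<kappa> w x * (rep_l2 (snd v) x \<bullet> rep_l2 (snd v) x) \<partial>lebesgue)"
      proof (rule integral_mono_AE)
        show "integrable lebesgue (\<lambda>x. \<alpha>0 * b0 * (norm (rep_l2 (snd v) x))\<^sup>2)"
          using sq_int_integrable[OF sq_int_rep_l2[of "snd v"]] by simp
        show "integrable lebesgue (\<lambda>x. \<kappa> w x * (rep_l2 (snd v) x \<bullet> rep_l2 (snd v) x))"
          using sq_int_inner[OF sq_int_mult[OF sq_int_rep_l2[of "snd v"] \<kappa>m \<kappa>b] sq_int_rep_l2[of "snd v"]] by simp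
        show "AE x in lebesgue. \<alpha>0 * b0 * (norm (rep_l2 (snd v) x))\<^sup>2 \<le> \<kappa> w x * (rep_l2 (snd v) x \<bullet> rep_l2 (snd v) x)"
          using \<kappa>bd[of w] by eventually_elim (auto simp: power2_norm_eq_inner intro: mult_right_mono)
      qed
      also have "\<dots> = B w v v" unfolding B_def inner_mult_l2[OF \<kappa>m \<kappa>b] ..
      finally show ?thesis .
    qed
    show "bounded_linear l" unfolding l_def[abs_def]
      by (rule bounded_linear_compose[OF bounded_linear_inner_right bounded_linear_fst])
    show "\<exists>K. compact K \<and> fst ` {v \<in> ?M. norm v \<le> R} \<subseteq> K" for R
    proof -
      obtain K where "compact K" "fst ` {z \<in> sobolev_pair \<Omega> ` H10 \<Omega>. norm z \<le> R} \<subseteq> K" using rellich[OF \<Omega>, of R] by blast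
      moreover have "fst ` {v \<in> ?M. norm v \<le> R} \<subseteq> fst ` {z \<in> sobolev_pair \<Omega> ` H10 \<Omega>. norm z \<le> R}"
        using MH by (intro image_mono) blast
      ultimately show ?thesis by (intro exI[of _ K]) auto
    qed
    show "\<exists>e. e \<longlonglongrightarrow> 0 \<and> (\<forall>n. \<forall>v\<in>?M. \<bar>B (w' n) u v - B w u v\<bar> \<le> e n * norm v)" if w: "w' \<longlonglongrightarrow> w" for w w' u
    proof (intro exI[of _ "\<lambda>n. norm (mult_l2 (\<kappa> (w' n)) (snd u) - mult_l2 (\<kappa> w) (snd u))"] conjI allI ballI)
      have "(\<lambda>n. mult_l2 (\<kappa> (w' n)) (snd u)) \<longlonglongrightarrow> mult_l2 (\<kappa> w) (snd u)"
        unfolding \<kappa>_def[abs_def] by (rule mult_l2_composition_tendsto[OF a_meas a_A b(1) b(4) w])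
      then show "(\<lambda>n. norm (mult_l2 (\<kappa> (w' n)) (snd u) - mult_l2 (\<kappa> w) (snd u))) \<longlonglongrightarrow> 0"
        by (simp add: LIM_zero tendsto_norm_zero)
      fix n and v :: "('a, real) l2 \<times> ('a, 'a) l2"
      have "\<bar>B (w' n) u v - B w u v\<bar> = \<bar>(mult_l2 (\<kappa> (w' n)) (snd u) - mult_l2 (\<kappa> w) (snd u)) \<bullet> snd v\<bar>"
        by (simp add: B_def inner_diff_left)
      also have "\<dots> \<le> norm (mult_l2 (\<kappa> (w' n)) (snd u) - mult_l2 (\<kappa> w) (snd u)) * norm (snd v)" by (rule Cauchy_Schwarz_ineq2)
      also have "\<dots> \<le> norm (mult_l2 (\<kappa> (w' n)) (snd u) - mult_l2 (\<kappa> w) (snd u)) * norm v"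
        using norm_snd_le[of "snd v" "fst v"] by (intro mult_left_mono) auto
      finally show "\<bar>B (w' n) u v - B w u v\<bar> \<le> norm (mult_l2 (\<kappa> (w' n)) (snd u) - mult_l2 (\<kappa> w) (snd u)) * norm v" .
    qed
  qed (use V bounded_linear_fst in auto)
  then obtain u where u: "u \<in> V" "z = sobolev_pair \<Omega> u" by blast
  have "(LINT x:\<Omega>|lebesgue. \<alpha> x * b (u x) * (weak_gradient \<Omega> u x \<bullet> weak_gradient \<Omega> v x)) = (LINT x:\<Omega>|lebesgue. f x * v x)"
    if v: "v \<in> V" for v
  proof -
    have uH: "u \<in> H1 \<Omega>" and vH: "v \<in> H1 \<Omega>" using u(1) v V(1) by (auto simp: H10_def)
    note U = H1_weak_gradient[OF \<Omega>(1) uH] and W = H1_weak_gradient[OF \<Omega>(1) vH]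
    let ?G = "zero_ext \<Omega> (weak_gradient \<Omega> u)" and ?K = "zero_ext \<Omega> (weak_gradient \<Omega> v)"
    let ?c = "\<lambda>x. a x * b (zero_ext \<Omega> u x)"
    have cm: "?c \<in> borel_measurable lebesgue"
      by (intro borel_measurable_times a_meas measurable_compose[OF sq_int_measurable[OF U(2)] bm])
    have cb: "AE x in lebesgue. \<bar>?c x\<bar> \<le> A * \<beta>"
      using a_A by eventually_elim (auto simp: abs_mult intro!: mult_mono b(4))
    have "B (fst z) z (sobolev_pair \<Omega> v) = to_l2 (\<lambda>x. \<kappa> (fst z) x *\<^sub>R ?G x) \<bullet> to_l2 ?K"
      by (simp add: B_def u(2) sobolev_pair_def mult_to_l2[OF U(3) \<kappa>m \<kappa>b])
    also have "to_l2 (\<lambda>x. \<kappa> (fst z) x *\<^sub>R ?G x) = to_l2 (\<lambda>x. ?c x *\<^sub>R ?G x)"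
    proof (subst to_l2_eq_iff[OF sq_int_mult[OF U(3) \<kappa>m \<kappa>b] sq_int_mult[OF U(3) cm cb]])
      show "AE x in lebesgue. \<kappa> (fst z) x *\<^sub>R ?G x = ?c x *\<^sub>R ?G x"
        using AE_rep_l2_to_l2[OF U(2)] by eventually_elim (simp add: \<kappa>_def u(2) sobolev_pair_def)
    qed
    also have "to_l2 (\<lambda>x. ?c x *\<^sub>R ?G x) \<bullet> to_l2 ?K = (\<integral>x. (?c x *\<^sub>R ?G x) \<bullet> ?K x \<partial>lebesgue)"
      by (rule inner_to_l2[OF sq_int_mult[OF U(3) cm cb] W(3)])
    also have "\<dots> = (LINT x:\<Omega>|lebesgue. \<alpha> x * b (u x) * (weak_gradient \<Omega> u x \<bullet> weak_gradient \<Omega> v x))"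
      unfolding set_lebesgue_integral_def
      by (intro Bochner_Integration.integral_cong refl) (auto simp: zero_ext_def a_def split: split_indicator)
    finally have lhs: "B (fst z) z (sobolev_pair \<Omega> v) =
        (LINT x:\<Omega>|lebesgue. \<alpha> x * b (u x) * (weak_gradient \<Omega> u x \<bullet> weak_gradient \<Omega> v x))" .
    have "l (sobolev_pair \<Omega> v) = (\<integral>x. zero_ext \<Omega> f x \<bullet> zero_ext \<Omega> v x \<partial>lebesgue)"
      unfolding l_def sobolev_pair_def fst_conv by (rule inner_to_l2[OF fs W(2)])
    also have "\<dots> = (LINT x:\<Omega>|lebesgue. f x * v x)"
      unfolding set_lebesgue_integral_def
      by (intro Bochner_Integration.integral_cong refl) (auto simp: zero_ext_def split: split_indicator)
    finally have rhs: "l (sobolev_pair \<Omega> v) = (LINT x:\<Omega>|lebesgue. f x * v x)" .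
    show ?thesis using z(2) v unfolding lhs[symmetric] rhs[symmetric] by blast
  qed
  with u(1) show ?thesis by blast
qed

theorem mainTheorem2:
  fixes \<Omega> :: "(real^2) set"
    and \<alpha> :: "real^2 \<Rightarrow> real" and \<alpha>0 \<alpha>1 :: real
    and b :: "real \<Rightarrow> real" and b0 :: real
    and f :: "real^2 \<Rightarrow> real"
    and h :: real and \<T> :: "(real^2) set set"
    and Vh Vr :: "(real^2 \<Rightarrow> real) set"
  assumes "polygonal_domain \<Omega>"
    and "set_borel_measurable lebesgue \<Omega> \<alpha>"
    and "0 < \<alpha>0"
    and "AE x in lebesgue. x \<in> \<Omega> \<longrightarrow> \<alpha>0 \<le> \<alpha> x \<and> \<alpha> x \<le> \<alpha>1"
    and "continuous_on UNIV b" and "b \<in> W2_inf"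
    and "0 < b0" and "\<forall>t. b0 \<le> b t"
    and "f \<in> L2 \<Omega>"
    and "element_partition \<Omega> h \<T>"
    and "finite_element_space \<Omega> \<T> Vh"
    and "is_direct_sum \<Omega> Vr Vh (bubble_space \<Omega> \<T>)"
  shows "\<exists>ur\<in>Vr. \<forall>vr\<in>Vr.
    (LINT x:\<Omega>|lebesgue. \<alpha> x * b (ur x) * (weak_gradient \<Omega> ur x \<bullet> weak_gradient \<Omega> vr x))
      = (LINT x:\<Omega>|lebesgue. f x * vr x)"
proof -
  have \<Omega>: "open \<Omega>" "bounded \<Omega>" using assms(1) by (auto simp: polygonal_domain_def)
  have \<T>: "open K \<and> K \<subseteq> \<Omega>" if "K \<in> \<T>" for K
    using assms(10) that by (auto simp: element_partition_def polygonal_domain_def)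
  obtain \<beta> where \<beta>: "\<And>t. \<bar>b t\<bar> \<le> \<beta>"
    using continuous_Linf_bounded[OF assms(5)] assms(6) by (auto simp: W2_inf_def)
  have "Vr = Vh + bubble_space \<Omega> \<T>" using assms(12) by (simp add: is_direct_sum_def)
  with closed_subspace_residual_free_bubble[OF \<Omega>(1) \<T> assms(11)]
  have V: "Vr \<subseteq> H10 \<Omega>" "closed (sobolev_pair \<Omega> ` Vr)" "subspace (sobolev_pair \<Omega> ` Vr)" by simp_all
  show ?thesis
    by (rule quasilinear_sobolev_existence[OF \<Omega> assms(2-5,7) _ \<beta> assms(9) V]) (use assms(8) in blast)
qed

end
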